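(* Let $(G,\delta_G)$ be a compact metric monoid and let $(G_n,\delta_n)_{n\in\mathbb{N}}$ be a sequence of compact metric monoids converging to $(G,\delta_G)$ in the sense of the covariant Gromov-Hausdorff topology. Let $(\varepsilon_n)_{n\in\mathbb{N}}$ be a sequence of positive numbers with $\lim_{n\to\infty}\varepsilon_n=0$ and such that for each $n\in\mathbb{N}$ there exists an $\varepsilon_n$-near isometric isomorphism $(\varsigma_n,\varkappa_n)$ from $(G_n,\delta_n)$ to $(G,\delta_G)$ (so $\varsigma_n:G_n\to G$ and $\varkappa_n:G\to G_n$). Let $D:G\to[0,\infty)$ be continuous, and let $K:[0,\infty)\to[0,\infty)$ be continuous with $K(0)=0$. Let $\mathcal{C}$ be a nonempty class of $F$-quasi-Leibniz quantum compact metric spaces for some admissible function $F$, and let $\mathcal{T}$ be a class of tunnels appropriate for $\mathcal{C}$. Let $(\mathfrak{A}_n,\mathsf{L}_n)_{n\in\mathbb{N}}$ be a sequence in $\mathcal{C}$ such that for each $n\in\mathbb{N}$ there is an action $\alpha_n$ of the monoid $G_n$ by Lipschitz linear endomorphisms of $(\mathfrak{A}_n,\mathsf{L}_n)$ with $$\forall n\in\mathbb{N},\ g\in G_n:\quad \|\alpha_n^g\|_{\mathrm{op}}\le D(\varsigma_n(g))\ \text{ and }\ \mathsf{L}_n\circ\alpha_n^g\le D(\varsigma_n(g))\,\mathsf{L}_n,$$ $$\forall n\in\mathbb{N},\ g,g'\in G_n,\ a\in\mathfrak{sa}(\mathfrak{A}_n):\quad\|\alpha_n^g(a)-\alpha_n^{g'}(a)\|_{\mathfrak{A}_n}\le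 K(\delta_n(g,g'))\,\mathsf{L}_n(a).$$ If there exists $(\mathfrak{A},\mathsf{L})\in\mathcal{C}$ such that $\lim_{n\to\infty}\Lambda^\ast_{\mathcal{T}}((\mathfrak{A}_n,\mathsf{L}_n),(\mathfrak{A},\mathsf{L}))=0$, then there exists a strongly continuous action $\alpha$ of the monoid $G$ on $\mathfrak{A}$ by Lipschitz linear endomorphisms such that for all $g\in G$ $$\|\alpha^g\|_{\mathrm{op}}\le D(g)\ \text{ and }\ \mathsf{L}\circ\alpha^g\le D(g)\,\mathsf{L},$$ for all $g,h\in G$ $$\liminf_{n\to\infty}\mathrm{mkD}^{\mathsf{L}_n}_{\mathfrak{A}_n}\big(\alpha_n^{\varkappa_n(g)},\alpha_n^{\varkappa_n(h)}\big)\le\mathrm{mkD}^{\mathsf{L}}_{\mathfrak{A}}(\alpha^g,\alpha^h)\le\limsup_{n\to\infty}\mathrm{mkD}^{\mathsf{L}_n}_{\mathfrak{A}_n}\big(\alpha_n^{\varkappa_n(g)},\alpha_n^{\varkappa_n(h)}\big),$$ and for all $g,h\in G$ and $a\in\mathrm{dom}(\mathsf{L})$ $$\|\alpha^g(a)-\alpha^h(a)\|_{\mathfrak{A}}\le\mathsf{L}(a)\,K(\delta_G(g,h)).$$ If moreover, for all $n\in\mathbb{N}$, the action $\alpha_n$ of $G_n$ is by positive unital linear maps (resp. by Lipschitz morphisms), then $\alpha$ is a strongly continuous action of $G$ by positive unital linear maps (resp. by Lipschitz morphisms).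
   Context: For a unital C*-algebra $\mathfrak{A}$: $1_{\mathfrak{A}}$ is its unit, $\mathfrak{sa}(\mathfrak{A})$ its self-adjoint part, $\mathscr{S}(\mathfrak{A})$ its state space; $a\circ b=\frac{ab+ba}{2}$ and $\{a,b\}=\frac{ab-ba}{2i}$ are the Jordan and Lie products of $a,b\in\mathfrak{sa}(\mathfrak{A})$; $\|\cdot\|_{\mathrm{op}}$ is the operator norm of a continuous linear map $\mathfrak{A}\to\mathfrak{A}$. A function $F:[0,\infty]^4\to[0,\infty]$ is admissible when it is weakly increasing for the product order and $xl_y+yl_x\le F(x,y,l_x,l_y)$ for all $x,y,l_x,l_y\ge0$. An $F$-quasi-Leibniz quantum compact metric space $(\mathfrak{A},\mathsf{L})$ is a unital C*-algebra $\mathfrak{A}$ with a seminorm $\mathsf{L}$ defined on a dense Jordan-Lie subalgebra $\mathrm{dom}(\mathsf{L})$ of $\mathfrak{sa}(\mathfrak{A})$ such that: (1) $\{a\in\mathrm{dom}(\mathsf{L}):\mathsf{L}(a)=0\}=\mathbb{R}1_{\mathfrak{A}}$; (2) the Monge-Kantorovich metric $\mathsf{mk}_{\mathsf{L}}(\varphi,\psi)=\sup\{|\varphi(a)-\psi(a)|:a\in\mathrm{dom}(\mathsf{L}),\mathsf{L}(a)\le1\}$ metrizes the weak* topology of $\mathscr{S}(\mathfrak{A})$; (3) $\max\{\mathsf{L}(a\circ b),\mathsf{L}(\{a,b\})\}\le F(\|a\|_{\mathfrak{A}},\|b\|_{\mathfrak{A}},\mathsf{L}(a),\mathsf{L}(b))$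 for all $a,b\in\mathrm{dom}(\mathsf{L})$; (4) $\mathsf{L}$ is lower semicontinuous on $\mathfrak{sa}(\mathfrak{A})$ for the norm, where $\mathsf{L}(a)=\infty$ for $a\in\mathfrak{sa}(\mathfrak{A})\setminus\mathrm{dom}(\mathsf{L})$. A Lipschitz linear map $\varphi:(\mathfrak{A},\mathsf{L}_{\mathfrak{A}})\to(\mathfrak{B},\mathsf{L}_{\mathfrak{B}})$ is a continuous linear map $\mathfrak{A}\to\mathfrak{B}$ with $\varphi(\mathrm{dom}(\mathsf{L}_{\mathfrak{A}}))\subseteq\mathrm{dom}(\mathsf{L}_{\mathfrak{B}})$ and $\varphi(1_{\mathfrak{A}})=1_{\mathfrak{B}}$; a Lipschitz linear endomorphism is one with $(\mathfrak{A},\mathsf{L}_{\mathfrak{A}})=(\mathfrak{B},\mathsf{L}_{\mathfrak{B}})$. A Lipschitz morphism is a unital *-homomorphism which is Lipschitz linear. Inequalities such as $\mathsf{L}\circ\varphi\le D\,\mathsf{L}$ are understood on $\mathfrak{sa}(\mathfrak{A})$. For linear maps $\varphi,\psi:\mathfrak{A}\to\mathfrak{B}$ mapping unit to unit, $\mathrm{mkD}^{\mathsf{L}_{\mathfrak{A}}}_{\mathfrak{B}}(\varphi,\psi)=\sup\{\|\varphi(a)-\psi(a)\|_{\mathfrak{B}}:a\in\mathrm{dom}(\mathsf{L}_{\mathfrak{A}}),\mathsf{L}_{\mathfrak{A}}(a)\le1\}$. A quantum isometry $\pi:(\mathfrak{A},\mathsf{L}_{\mathfrak{A}})\to(\mathfrak{B},\mathsf{L}_{\mathfrak{B}})$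 is a surjective *-homomorphism with $\mathsf{L}_{\mathfrak{B}}(b)=\inf\{\mathsf{L}_{\mathfrak{A}}(a):a\in\mathfrak{sa}(\mathfrak{A}),\pi(a)=b\}$ for all $b\in\mathfrak{sa}(\mathfrak{B})$. A full quantum isometry is a *-isomorphism $\pi$ with $\mathsf{L}_{\mathfrak{B}}\circ\pi=\mathsf{L}_{\mathfrak{A}}$. An ($F$-)tunnel $\tau=(\mathfrak{D},\mathsf{L}_{\mathfrak{D}},\pi_{\mathfrak{A}},\pi_{\mathfrak{B}})$ from $(\mathfrak{A},\mathsf{L}_{\mathfrak{A}})$ (its domain) to $(\mathfrak{B},\mathsf{L}_{\mathfrak{B}})$ (its codomain) is an $F$-quasi-Leibniz quantum compact metric space $(\mathfrak{D},\mathsf{L}_{\mathfrak{D}})$ with quantum isometries $\pi_{\mathfrak{A}},\pi_{\mathfrak{B}}$ from it onto $(\mathfrak{A},\mathsf{L}_{\mathfrak{A}})$ and $(\mathfrak{B},\mathsf{L}_{\mathfrak{B}})$; $\tau^{-1}=(\mathfrak{D},\mathsf{L}_{\mathfrak{D}},\pi_{\mathfrak{B}},\pi_{\mathfrak{A}})$. With $\mathsf{Haus}_d$ the Hausdorff distance, the extent $\chi(\tau)$ is the maximum of $\mathsf{Haus}_{\mathsf{mk}_{\mathsf{L}_{\mathfrak{D}}}}(\mathscr{S}(\mathfrak{D}),\{\varphi\circ\pi:\varphi\in\mathscr{S}(\mathfrak{E})\})$ over $(\pi,\mathfrak{E})\in\{(\pi_{\mathfrak{A}},\mathfrak{A}),(\pi_{\mathfrak{B}},\mathfrak{B})\}$.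 A class $\mathcal{T}$ of ($F$-)tunnels is appropriate for a nonempty class $\mathcal{C}$ of $F$-quasi-Leibniz quantum compact metric spaces when: (1) domains and codomains of elements of $\mathcal{T}$ are in $\mathcal{C}$; (2) any two elements of $\mathcal{C}$ are the domain and codomain of some $\tau\in\mathcal{T}$; (3) $\tau\in\mathcal{T}\Rightarrow\tau^{-1}\in\mathcal{T}$; (4) if $h:(\mathfrak{A},\mathsf{L}_{\mathfrak{A}})\to(\mathfrak{B},\mathsf{L}_{\mathfrak{B}})$ is a full quantum isometry between elements of $\mathcal{C}$, then $(\mathfrak{A},\mathsf{L}_{\mathfrak{A}},\mathrm{id}_{\mathfrak{A}},h)$ and $(\mathfrak{B},\mathsf{L}_{\mathfrak{B}},h^{-1},\mathrm{id}_{\mathfrak{B}})$ are in $\mathcal{T}$; (5) if $\tau,\gamma\in\mathcal{T}$ and the codomain of $\tau$ is the domain of $\gamma$, then for all $\varepsilon>0$ there is $\tau\circ_\varepsilon\gamma\in\mathcal{T}$ from the domain of $\tau$ to the codomain of $\gamma$ with $\chi(\tau\circ_\varepsilon\gamma)<\chi(\tau)+\chi(\gamma)+\varepsilon$. The dual $\mathcal{T}$-propinquity $\Lambda^\ast_{\mathcal{T}}((\mathfrak{A},\mathsf{L}_{\mathfrak{A}}),(\mathfrak{B},\mathsf{L}_{\mathfrak{B}}))$ is the infimum of $\chi(\tau)$ over $\tau\in\mathcal{T}$ from $(\mathfrak{A},\mathsf{L}_{\mathfrak{A}})$ to $(\mathfrak{B},\mathsf{L}_{\mathfrak{B}})$.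 A metric monoid $(G,\delta_G)$ is a monoid (associative operation with identity element) with a distance for whose topology the multiplication is continuous; it is compact if $(G,\delta_G)$ is compact. For metric monoids $(G_1,\delta_1),(G_2,\delta_2)$ with units $e_1,e_2$ and $\varepsilon>0$, an $\varepsilon$-near isometric isomorphism from $(G_1,\delta_1)$ to $(G_2,\delta_2)$ is a pair of functions $\varsigma_1:G_1\to G_2$, $\varsigma_2:G_2\to G_1$ such that for $\{j,k\}=\{1,2\}$ and all $g,g'\in G_j$: $\delta_k(\varsigma_j(g)\varsigma_j(g'),\varsigma_j(gg'))\le\varepsilon$; $\delta_j(\varsigma_k(\varsigma_j(g)),g)\le\varepsilon$; $|\delta_k(\varsigma_j(g),\varsigma_j(g'))-\delta_j(g,g')|\le\varepsilon$; $\delta_k(\varsigma_j(e_j),e_k)\le\varepsilon$. A sequence $(G_n,\delta_n)$ converges to $(G,\delta_G)$ (covariant Gromov-Hausdorff topology) when for all $\varepsilon>0$ there is $N$ such that for all $n\ge N$ there is an $\varepsilon$-near isometric isomorphism from $G_n$ to $G$. An action $\alpha$ of a monoid satisfies $\alpha^{gh}=\alpha^g\circ\alpha^h$ and the unit acts as the identity map; it is strongly continuous when $g\mapsto\alpha^g(a)$ is norm continuous for each $a\in\mathfrak{A}$.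
   Formalization: The admissible function F is additionally assumed to be finite at finite arguments; for F identically infinite the quasi-Leibniz condition is void and the claim about Lipschitz morphisms fails (M_2+M_2 with a partial transpose). *)

theory Defs
  imports
    "HOL-Analysis.Analysis"
    "HOL-Algebra.Module"
    "HOL-Algebra.Algebraic_Closure_Type"
begin

section \<open>Unital C*-algebras\<close>

record 'a cstar = "(complex, 'a) module" +
  star :: "'a \<Rightarrow> 'a"
  cnorm :: "'a \<Rightarrow> real"

text \<open>Cut off outside the carrier because \<^locale>\<open>Metric_space\<close> requires non-negativity and symmetry
  on the whole type.\<close>

definition cdist :: "('a, 'm) cstar_scheme \<Rightarrow> 'a \<Rightarrow> 'a \<Rightarrow> real" where
  "cdist A a b =
     (if a \<in> carrier A \<and> b \<in> carrier A then cnorm A (a \<ominus>\<^bsub>A\<^esub> b) else 0)"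

definition ctop :: "('a, 'm) cstar_scheme \<Rightarrow> 'a topology" where
  "ctop A = Metric_space.mtopology (carrier A) (cdist A)"

text \<open>Here \<^const>\<open>ring_of_type_algebra\<close> is the field of complex numbers as a ring record.  The zero
  algebra is not excluded.\<close>

locale unital_cstar_algebra =
  Module.module "ring_of_type_algebra :: complex ring" A + Ring.ring A
  for A :: "('a, 'm) cstar_scheme" (structure) +
  assumes smult_mult_left:
      "\<lbrakk>x \<in> carrier A; y \<in> carrier A\<rbrakk> \<Longrightarrow> (c \<odot> x) \<otimes> y = c \<odot> (x \<otimes> y)"
    and smult_mult_right:
      "\<lbrakk>x \<in> carrier A; y \<in> carrier A\<rbrakk> \<Longrightarrow> x \<otimes> (c \<odot> y) = c \<odot> (x \<otimes> y)"
    and star_closed: "x \<in> carrier A \<Longrightarrow> star A x \<in> carrier A"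
    and star_star: "x \<in> carrier A \<Longrightarrow> star A (star A x) = x"
    and star_add:
      "\<lbrakk>x \<in> carrier A; y \<in> carrier A\<rbrakk> \<Longrightarrow> star A (x \<oplus> y) = star A x \<oplus> star A y"
    and star_smult: "x \<in> carrier A \<Longrightarrow> star A (c \<odot> x) = cnj c \<odot> star A x"
    and star_mult:
      "\<lbrakk>x \<in> carrier A; y \<in> carrier A\<rbrakk> \<Longrightarrow> star A (x \<otimes> y) = star A y \<otimes> star A x"
    and cnorm_nonneg: "x \<in> carrier A \<Longrightarrow> 0 \<le> cnorm A x"
    and cnorm_eq_zero: "x \<in> carrier A \<Longrightarrow> cnorm A x = 0 \<longleftrightarrow> x = \<zero>"
    and cnorm_add:
      "\<lbrakk>x \<in> carrier A; y \<in> carrier A\<rbrakk> \<Longrightarrow> cnorm A (x \<oplus> y) \<le> cnorm A x + cnorm A y"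
    and cnorm_smult: "x \<in> carrier A \<Longrightarrow> cnorm A (c \<odot> x) = cmod c * cnorm A x"
    and cnorm_mult:
      "\<lbrakk>x \<in> carrier A; y \<in> carrier A\<rbrakk> \<Longrightarrow> cnorm A (x \<otimes> y) \<le> cnorm A x * cnorm A y"
    and cstar_identity: "x \<in> carrier A \<Longrightarrow> cnorm A (star A x \<otimes> x) = (cnorm A x)\<^sup>2"
    and complete: "Metric_space.mcomplete (carrier A) (cdist A)"

definition sa :: "('a, 'm) cstar_scheme \<Rightarrow> 'a set" where
  "sa A = {a \<in> carrier A. star A a = a}"

definition jordan :: "('a, 'm) cstar_scheme \<Rightarrow> 'a \<Rightarrow> 'a \<Rightarrow> 'a" where
  "jordan A a b = (1 / 2) \<odot>\<^bsub>A\<^esub> (a \<otimes>\<^bsub>A\<^esub> b \<oplus>\<^bsub>A\<^esub> b \<otimes>\<^bsub>A\<^esub> a)"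

definition lie :: "('a, 'm) cstar_scheme \<Rightarrow> 'a \<Rightarrow> 'a \<Rightarrow> 'a" where
  "lie A a b = (1 / (2 * \<i>)) \<odot>\<^bsub>A\<^esub> (a \<otimes>\<^bsub>A\<^esub> b \<ominus>\<^bsub>A\<^esub> b \<otimes>\<^bsub>A\<^esub> a)"

definition positive_cone :: "('a, 'm) cstar_scheme \<Rightarrow> 'a set" where
  "positive_cone A = (\<lambda>b. star A b \<otimes>\<^bsub>A\<^esub> b) ` carrier A"

definition linear_map ::
    "('a, 'm) cstar_scheme \<Rightarrow> ('b, 'n) cstar_scheme \<Rightarrow> ('a \<Rightarrow> 'b) \<Rightarrow> bool" where
  "linear_map A B f \<longleftrightarrow>
     f \<in> carrier A \<rightarrow> carrier B \<and>
     (\<forall>x\<in>carrier A. \<forall>y\<in>carrier A. f (x \<oplus>\<^bsub>A\<^esub> y) = f x \<oplus>\<^bsub>B\<^esub> f y) \<and>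
     (\<forall>c. \<forall>x\<in>carrier A. f (c \<odot>\<^bsub>A\<^esub> x) = c \<odot>\<^bsub>B\<^esub> f x)"

definition positive_map ::
    "('a, 'm) cstar_scheme \<Rightarrow> ('b, 'n) cstar_scheme \<Rightarrow> ('a \<Rightarrow> 'b) \<Rightarrow> bool" where
  "positive_map A B f \<longleftrightarrow> f ` positive_cone A \<subseteq> positive_cone B"

definition star_hom ::
    "('a, 'm) cstar_scheme \<Rightarrow> ('b, 'n) cstar_scheme \<Rightarrow> ('a \<Rightarrow> 'b) \<Rightarrow> bool" where
  "star_hom A B f \<longleftrightarrow>
     linear_map A B f \<and>
     (\<forall>x\<in>carrier A. \<forall>y\<in>carrier A. f (x \<otimes>\<^bsub>A\<^esub> y) = f x \<otimes>\<^bsub>B\<^esub> f y) \<and>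
     (\<forall>x\<in>carrier A. f (star A x) = star B (f x))"

definition op_norm :: "('a, 'm) cstar_scheme \<Rightarrow> ('a \<Rightarrow> 'a) \<Rightarrow> ennreal" where
  "op_norm A f = (SUP a\<in>{a \<in> carrier A. cnorm A a \<le> 1}. ennreal (cnorm A (f a)))"

text \<open>States are extensional (\<^const>\<open>undefined\<close> off the carrier), so that equality of states is equality
  of functionals on the algebra and the weak* topology is a subspace of a product topology.\<close>

definition states :: "('a, 'm) cstar_scheme \<Rightarrow> ('a \<Rightarrow> complex) set" where
  "states A = {\<phi> \<in> extensional (carrier A).
     (\<forall>x\<in>carrier A. \<forall>y\<in>carrier A. \<phi> (x \<oplus>\<^bsub>A\<^esub> y) = \<phi> x + \<phi> y) \<and>
     (\<forall>c. \<forall>x\<in>carrier A. \<phi> (c \<odot>\<^bsub>A\<^esub> x) = c * \<phi> x) \<and>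
     (\<forall>p\<in>positive_cone A. \<phi> p \<in> \<real>\<^sub>\<ge>\<^sub>0) \<and>
     \<phi> \<one>\<^bsub>A\<^esub> = 1}"

definition weak_star :: "('a, 'm) cstar_scheme \<Rightarrow> ('a \<Rightarrow> complex) topology" where
  "weak_star A = subtopology (product_topology (\<lambda>_. euclidean) (carrier A)) (states A)"

section \<open>Quasi-Leibniz quantum compact metric spaces\<close>

text \<open>The seminorm takes values in \<open>[0,\<infinity>]\<close>; its domain is where it is finite on the self-adjoint part.
  Values of \<open>lip\<close> outside the self-adjoint part are never used.\<close>

record 'a qcms = "'a cstar" +
  lip :: "'a \<Rightarrow> ennreal"

definition ldom :: "('a, 'm) qcms_scheme \<Rightarrow> 'a set" where
  "ldom M = {a \<in> sa M. lip M a < \<infinity>}"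

definition mk :: "('a, 'm) qcms_scheme \<Rightarrow> ('a \<Rightarrow> complex) \<Rightarrow> ('a \<Rightarrow> complex) \<Rightarrow> ennreal" where
  "mk M \<phi> \<psi> = (SUP a\<in>{a \<in> ldom M. lip M a \<le> 1}. ennreal (cmod (\<phi> a - \<psi> a)))"

text \<open>With the convention \<open>0 * \<infinity> = 0\<close> of \<^typ>\<open>ennreal\<close>, the lower bound at infinite arguments follows
  from the one at finite arguments by monotonicity.  Finiteness of \<open>F\<close> at finite arguments is not part
  of this definition; where needed, it is a separate hypothesis.\<close>

definition admissible :: "(ennreal \<Rightarrow> ennreal \<Rightarrow> ennreal \<Rightarrow> ennreal \<Rightarrow> ennreal) \<Rightarrow> bool" where
  "admissible F \<longleftrightarrow>
     (\<forall>x x' y y' l l' k k'. x \<le> x' \<longrightarrow> y \<le> y' \<longrightarrow> l \<le> l' \<longrightarrow> k \<le> k' \<longrightarrow> F x y l k \<le> F x' y' l' k') \<and>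
     (\<forall>x y l k. x * k + y * l \<le> F x y l k)"

locale quasi_leibniz_qcms = unital_cstar_algebra M
  for F :: "ennreal \<Rightarrow> ennreal \<Rightarrow> ennreal \<Rightarrow> ennreal \<Rightarrow> ennreal"
    and M :: "('a, 'm) qcms_scheme" (structure) +
  assumes ldom_zero: "\<zero> \<in> ldom M"
    and ldom_add: "\<lbrakk>a \<in> ldom M; b \<in> ldom M\<rbrakk> \<Longrightarrow> a \<oplus> b \<in> ldom M"
    and ldom_smult: "a \<in> ldom M \<Longrightarrow> complex_of_real t \<odot> a \<in> ldom M"
    and ldom_jordan: "\<lbrakk>a \<in> ldom M; b \<in> ldom M\<rbrakk> \<Longrightarrow> jordan M a b \<in> ldom M"
    and ldom_lie: "\<lbrakk>a \<in> ldom M; b \<in> ldom M\<rbrakk> \<Longrightarrow> lie M a b \<in> ldom M"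
    and ldom_dense: "sa M \<subseteq> ctop M closure_of ldom M"
    and lip_add: "\<lbrakk>a \<in> ldom M; b \<in> ldom M\<rbrakk> \<Longrightarrow> lip M (a \<oplus> b) \<le> lip M a + lip M b"
    and lip_smult:
      "a \<in> ldom M \<Longrightarrow> lip M (complex_of_real t \<odot> a) = ennreal \<bar>t\<bar> * lip M a"
    and lip_kernel: "{a \<in> ldom M. lip M a = 0} = {complex_of_real t \<odot> \<one> | t. True}"
    and mk_finite: "\<lbrakk>\<phi> \<in> states M; \<psi> \<in> states M\<rbrakk> \<Longrightarrow> mk M \<phi> \<psi> < \<infinity>"
    and mk_metric: "Metric_space (states M) (\<lambda>\<phi> \<psi>. enn2real (mk M \<phi> \<psi>))"
    and mk_metrizes:
      "Metric_space.mtopology (states M) (\<lambda>\<phi> \<psi>. enn2real (mk M \<phi> \<psi>)) = weak_star M"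
    and quasi_leibniz: "\<lbrakk>a \<in> ldom M; b \<in> ldom M\<rbrakk> \<Longrightarrow>
      max (lip M (jordan M a b)) (lip M (lie M a b))
        \<le> F (ennreal (cnorm M a)) (ennreal (cnorm M b)) (lip M a) (lip M b)"
    and lower_semicontinuous:
      "closedin (subtopology (ctop M) (sa M)) {a \<in> sa M. lip M a \<le> r}"

definition lipschitz_linear ::
    "('a, 'm) qcms_scheme \<Rightarrow> ('b, 'n) qcms_scheme \<Rightarrow> ('a \<Rightarrow> 'b) \<Rightarrow> bool" where
  "lipschitz_linear M N f \<longleftrightarrow>
     linear_map M N f \<and> continuous_map (ctop M) (ctop N) f \<and>
     f ` ldom M \<subseteq> ldom N \<and> f \<one>\<^bsub>M\<^esub> = \<one>\<^bsub>N\<^esub>"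

definition lipschitz_morphism ::
    "('a, 'm) qcms_scheme \<Rightarrow> ('b, 'n) qcms_scheme \<Rightarrow> ('a \<Rightarrow> 'b) \<Rightarrow> bool" where
  "lipschitz_morphism M N f \<longleftrightarrow> star_hom M N f \<and> lipschitz_linear M N f"

definition mkD ::
    "('a, 'm) qcms_scheme \<Rightarrow> ('b, 'n) cstar_scheme \<Rightarrow> ('a \<Rightarrow> 'b) \<Rightarrow> ('a \<Rightarrow> 'b) \<Rightarrow> ennreal" where
  "mkD M B f g = (SUP a\<in>{a \<in> ldom M. lip M a \<le> 1}. ennreal (cnorm B (f a \<ominus>\<^bsub>B\<^esub> g a)))"

definition quantum_isometry ::
    "('a, 'm) qcms_scheme \<Rightarrow> ('b, 'n) qcms_scheme \<Rightarrow> ('a \<Rightarrow> 'b) \<Rightarrow> bool" where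
  "quantum_isometry M N p \<longleftrightarrow>
     star_hom M N p \<and> p ` carrier M = carrier N \<and>
     (\<forall>b\<in>sa N. lip N b = (INF a\<in>{a \<in> sa M. p a = b}. lip M a))"

definition full_quantum_isometry ::
    "('a, 'm) qcms_scheme \<Rightarrow> ('b, 'n) qcms_scheme \<Rightarrow> ('a \<Rightarrow> 'b) \<Rightarrow> bool" where
  "full_quantum_isometry M N p \<longleftrightarrow>
     star_hom M N p \<and> bij_betw p (carrier M) (carrier N) \<and>
     (\<forall>a\<in>sa M. lip N (p a) = lip M a)"

section \<open>Tunnels and the propinquity\<close>

record 'a tunnel =
  tspace :: "'a qcms"
  tdom :: "'a qcms"
  tcod :: "'a qcms"
  to_dom :: "'a \<Rightarrow> 'a"
  to_cod :: "'a \<Rightarrow> 'a"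

text \<open>The quantum isometries of a tunnel are extensional, so that equality of tunnels only depends on
  the values of these maps on the algebra.\<close>

definition is_tunnel ::
    "(ennreal \<Rightarrow> ennreal \<Rightarrow> ennreal \<Rightarrow> ennreal \<Rightarrow> ennreal) \<Rightarrow> 'a tunnel \<Rightarrow> bool" where
  "is_tunnel F \<tau> \<longleftrightarrow>
     quasi_leibniz_qcms F (tspace \<tau>) \<and>
     quasi_leibniz_qcms F (tdom \<tau>) \<and>
     quasi_leibniz_qcms F (tcod \<tau>) \<and>
     to_dom \<tau> \<in> extensional (carrier (tspace \<tau>)) \<and>
     to_cod \<tau> \<in> extensional (carrier (tspace \<tau>)) \<and>
     quantum_isometry (tspace \<tau>) (tdom \<tau>) (to_dom \<tau>) \<and>
     quantum_isometry (tspace \<tau>) (tcod \<tau>) (to_cod \<tau>)"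

definition reverse_tunnel :: "'a tunnel \<Rightarrow> 'a tunnel" where
  "reverse_tunnel \<tau> =
     \<lparr>tspace = tspace \<tau>, tdom = tcod \<tau>, tcod = tdom \<tau>, to_dom = to_cod \<tau>, to_cod = to_dom \<tau>\<rparr>"

definition hausdorff :: "('s \<Rightarrow> 's \<Rightarrow> ennreal) \<Rightarrow> 's set \<Rightarrow> 's set \<Rightarrow> ennreal" where
  "hausdorff d S T = max (SUP x\<in>S. INF y\<in>T. d x y) (SUP y\<in>T. INF x\<in>S. d x y)"

definition pullback_states ::
    "('a, 'm) cstar_scheme \<Rightarrow> ('b, 'n) cstar_scheme \<Rightarrow> ('a \<Rightarrow> 'b) \<Rightarrow> ('a \<Rightarrow> complex) set" where
  "pullback_states A B p = (\<lambda>\<phi>. compose (carrier A) \<phi> p) ` states B"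

definition extent :: "'a tunnel \<Rightarrow> ennreal" where
  "extent \<tau> = max
     (hausdorff (mk (tspace \<tau>)) (states (tspace \<tau>))
        (pullback_states (tspace \<tau>) (tdom \<tau>) (to_dom \<tau>)))
     (hausdorff (mk (tspace \<tau>)) (states (tspace \<tau>))
        (pullback_states (tspace \<tau>) (tcod \<tau>) (to_cod \<tau>)))"

locale appropriate_tunnels =
  fixes F :: "ennreal \<Rightarrow> ennreal \<Rightarrow> ennreal \<Rightarrow> ennreal \<Rightarrow> ennreal"
    and \<C> :: "'a qcms set"
    and \<T> :: "'a tunnel set"
  assumes nonempty: "\<C> \<noteq> {}"
    and spaces: "M \<in> \<C> \<Longrightarrow> quasi_leibniz_qcms F M"
    and tunnels: "\<tau> \<in> \<T> \<Longrightarrow> is_tunnel F \<tau>"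
    and ends: "\<tau> \<in> \<T> \<Longrightarrow> tdom \<tau> \<in> \<C> \<and> tcod \<tau> \<in> \<C>"
    and connected: "\<lbrakk>M \<in> \<C>; N \<in> \<C>\<rbrakk> \<Longrightarrow> \<exists>\<tau>\<in>\<T>. tdom \<tau> = M \<and> tcod \<tau> = N"
    and reversed: "\<tau> \<in> \<T> \<Longrightarrow> reverse_tunnel \<tau> \<in> \<T>"
    and isometries:
      "\<lbrakk>M \<in> \<C>; N \<in> \<C>; full_quantum_isometry M N h; h \<in> extensional (carrier M)\<rbrakk> \<Longrightarrow>
       \<lparr>tspace = M, tdom = M, tcod = N, to_dom = restrict id (carrier M), to_cod = h\<rparr> \<in> \<T> \<and>
       \<lparr>tspace = N, tdom = M, tcod = N,
        to_dom = restrict (inv_into (carrier M) h) (carrier N),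
        to_cod = restrict id (carrier N)\<rparr> \<in> \<T>"
    and composed:
      "\<lbrakk>\<tau> \<in> \<T>; \<gamma> \<in> \<T>; tcod \<tau> = tdom \<gamma>; (\<epsilon>::real) > 0\<rbrakk> \<Longrightarrow>
       \<exists>\<sigma>\<in>\<T>. tdom \<sigma> = tdom \<tau> \<and> tcod \<sigma> = tcod \<gamma> \<and>
         extent \<sigma> < extent \<tau> + extent \<gamma> + ennreal \<epsilon>"

definition propinquity :: "'a tunnel set \<Rightarrow> 'a qcms \<Rightarrow> 'a qcms \<Rightarrow> ennreal" where
  "propinquity \<T> M N = (INF \<tau>\<in>{\<tau> \<in> \<T>. tdom \<tau> = M \<and> tcod \<tau> = N}. extent \<tau>)"

section \<open>Metric monoids and their actions\<close>

locale compact_metric_monoid = Group.monoid G + Metric_space "carrier G" d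
  for G :: "'g monoid" (structure) and d :: "'g \<Rightarrow> 'g \<Rightarrow> real" +
  assumes mult_continuous:
      "continuous_map (prod_topology mtopology mtopology) mtopology (\<lambda>(x, y). x \<otimes> y)"
    and compact: "compact_space mtopology"

definition near_morphism ::
    "real \<Rightarrow> 'g monoid \<Rightarrow> ('g \<Rightarrow> 'g \<Rightarrow> real) \<Rightarrow> 'h monoid \<Rightarrow> ('h \<Rightarrow> 'h \<Rightarrow> real) \<Rightarrow>
     ('g \<Rightarrow> 'h) \<Rightarrow> ('h \<Rightarrow> 'g) \<Rightarrow> bool" where
  "near_morphism \<epsilon> G dG H dH s t \<longleftrightarrow>
     s \<in> carrier G \<rightarrow> carrier H \<and>
     (\<forall>g\<in>carrier G. \<forall>g'\<in>carrier G.
        dH (s g \<otimes>\<^bsub>H\<^esub> s g') (s (g \<otimes>\<^bsub>G\<^esub> g')) \<le> \<epsilon> \<and>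
        dG (t (s g)) g \<le> \<epsilon> \<and>
        \<bar>dH (s g) (s g') - dG g g'\<bar> \<le> \<epsilon>) \<and>
     dH (s \<one>\<^bsub>G\<^esub>) \<one>\<^bsub>H\<^esub> \<le> \<epsilon>"

definition near_isometric_isomorphism ::
    "real \<Rightarrow> 'g monoid \<Rightarrow> ('g \<Rightarrow> 'g \<Rightarrow> real) \<Rightarrow> 'h monoid \<Rightarrow> ('h \<Rightarrow> 'h \<Rightarrow> real) \<Rightarrow>
     ('g \<Rightarrow> 'h) \<Rightarrow> ('h \<Rightarrow> 'g) \<Rightarrow> bool" where
  "near_isometric_isomorphism \<epsilon> G dG H dH s t \<longleftrightarrow>
     0 < \<epsilon> \<and> near_morphism \<epsilon> G dG H dH s t \<and> near_morphism \<epsilon> H dH G dG t s"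

definition covariant_GH_convergent ::
    "(nat \<Rightarrow> 'g monoid) \<Rightarrow> (nat \<Rightarrow> 'g \<Rightarrow> 'g \<Rightarrow> real) \<Rightarrow> 'h monoid \<Rightarrow> ('h \<Rightarrow> 'h \<Rightarrow> real) \<Rightarrow> bool" where
  "covariant_GH_convergent Gs ds G d \<longleftrightarrow>
     (\<forall>\<epsilon>>0. \<exists>N. \<forall>n\<ge>N. \<exists>s t. near_isometric_isomorphism \<epsilon> (Gs n) (ds n) G d s t)"

definition lipschitz_linear_action ::
    "'g monoid \<Rightarrow> ('a, 'm) qcms_scheme \<Rightarrow> ('g \<Rightarrow> 'a \<Rightarrow> 'a) \<Rightarrow> bool" where
  "lipschitz_linear_action G M \<alpha> \<longleftrightarrow>
     (\<forall>g\<in>carrier G. lipschitz_linear M M (\<alpha> g)) \<and>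
     (\<forall>g\<in>carrier G. \<forall>h\<in>carrier G. \<forall>a\<in>carrier M. \<alpha> (g \<otimes>\<^bsub>G\<^esub> h) a = \<alpha> g (\<alpha> h a)) \<and>
     (\<forall>a\<in>carrier M. \<alpha> \<one>\<^bsub>G\<^esub> a = a)"

definition strongly_continuous ::
    "'g monoid \<Rightarrow> ('g \<Rightarrow> 'g \<Rightarrow> real) \<Rightarrow> ('a, 'm) cstar_scheme \<Rightarrow> ('g \<Rightarrow> 'a \<Rightarrow> 'a) \<Rightarrow> bool" where
  "strongly_continuous G d A \<alpha> \<longleftrightarrow>
     (\<forall>a\<in>carrier A.
        continuous_map (Metric_space.mtopology (carrier G) d) (ctop A) (\<lambda>g. \<alpha> g a))"

end

theory Submission
  imports Defs
begin

text \<open>Fix a non-principal ultrafilter on the indices and tunnels from \<open>A\<^sub>n\<close> to \<open>A\<close> of extents tending to \<open>0\<close>.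
  Say that a sequence \<open>x\<^sub>n\<close> converges to \<open>a\<close> if the two are approximated by images of elements \<open>d\<^sub>n\<close> of the tunnels
  of bounded Lipschitz seminorm.  Testing against states gives \<open>\<parallel>d\<parallel> \<le> \<parallel>\<pi>(d)\<parallel> + L(d) \<chi>(\<tau>)\<close> on self-adjoint elements
  for each of the two quantum isometries \<open>\<pi>\<close> of a tunnel \<open>\<tau>\<close>, so that limits are unique and norms converge, and
  the quasi-Leibniz property makes the relation compatible with the algebra operations.  Lipschitz balls of \<open>A\<close>
  are totally bounded and closed, so sequences \<open>x\<^sub>n\<close> of uniformly bounded norm and seminorm have ultralimits.
  The limit action sends the limit of \<open>x\<^sub>n\<close> to the limit of the images of \<open>x\<^sub>n\<close> under \<open>\<kappa>\<^sub>n(g)\<close>; all the estimates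
  and algebraic identities pass to the ultralimit.\<close>

section \<open>Unital C*-algebras\<close>

text \<open>The seminorm, the quasi-Leibniz bound and the norm estimate by states all concern
  self-adjoint elements. A general \<open>d\<close> in a tunnel is reached through the C*-identity,
  applying the estimate to the product of \<open>star d\<close> and \<open>d\<close>; its seminorm
  is bounded uniformly because all tunnels share one \<open>F\<close>, finite at finite arguments.
  The estimate needs enough states, and \<open>states\<close> are required to be positive on
  products of \<open>star b\<close> and \<open>b\<close>. Norm and order must therefore be tied
  together first: square roots by a power series, then Kaplansky's theorem, then Hahn-Banach for the
  order-unit gauge.

  The ultrafilter fixes the limits for all elements and all \<open>g\<close> at once, so limit maps
  compose without extracting subsequences. Since its limits lie between liminf and limsup, the
  bounds for \<open>mkD\<close> take that form. The maps \<open>\<kappa> n\<close> are only nearly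
  multiplicative; \<open>K\<close> turns their defect into one that vanishes on Lipschitz elements,
  and the bound of \<open>D\<close> on the compact \<open>G\<close> extends the identities to the
  whole algebra.\<close>

context unital_cstar_algebra
begin

lemma smult_in [simp, intro]: "x \<in> carrier A \<Longrightarrow> c \<odot> x \<in> carrier A"
  using smult_closed[of c x] by (simp add: ring_of_type_algebra_def)

lemma smult_add_l: "x \<in> carrier A \<Longrightarrow> (b + c) \<odot> x = b \<odot> x \<oplus> c \<odot> x"
  using smult_l_distr[of b c x] by (simp add: ring_of_type_algebra_def)

lemma smult_add_r: "\<lbrakk>x \<in> carrier A; y \<in> carrier A\<rbrakk> \<Longrightarrow> c \<odot> (x \<oplus> y) = c \<odot> x \<oplus> c \<odot> y"
  using smult_r_distr[of c x y] by (simp add: ring_of_type_algebra_def)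

lemma smult_assoc: "x \<in> carrier A \<Longrightarrow> b \<odot> (c \<odot> x) = (b * c) \<odot> x"
  using smult_assoc1[of b c x] by (simp add: ring_of_type_algebra_def)

lemma smult_1 [simp]: "x \<in> carrier A \<Longrightarrow> 1 \<odot> x = x"
  using smult_one[of x] by (simp add: ring_of_type_algebra_def)

lemma smult_0 [simp]: "x \<in> carrier A \<Longrightarrow> 0 \<odot> x = \<zero>"
  using smult_l_null[of x] by (simp add: ring_of_type_algebra_def)

lemma smult_zero [simp]: "c \<odot> \<zero> = \<zero>"
  using smult_r_null[of c] by (simp add: ring_of_type_algebra_def)

lemma smult_uminus_r: "x \<in> carrier A \<Longrightarrow> c \<odot> (\<ominus> x) = \<ominus> (c \<odot> x)"
  using smult_r_minus[of c x] by (simp add: ring_of_type_algebra_def)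

lemma smult_uminus_l: "x \<in> carrier A \<Longrightarrow> (- c) \<odot> x = \<ominus> (c \<odot> x)"
  using smult_add_l[of x "- c" c] by (simp add: minus_equality)

lemma smult_diff_l: "x \<in> carrier A \<Longrightarrow> (b - c) \<odot> x = b \<odot> x \<ominus> c \<odot> x"
  using smult_add_l[of x b "- c"] by (simp add: smult_uminus_l minus_eq)

lemma smult_diff_r: "\<lbrakk>x \<in> carrier A; y \<in> carrier A\<rbrakk> \<Longrightarrow> c \<odot> (x \<ominus> y) = c \<odot> x \<ominus> c \<odot> y"
  by (simp add: minus_eq smult_add_r smult_uminus_r)

lemma star_in [simp, intro]: "x \<in> carrier A \<Longrightarrow> star A x \<in> carrier A"
  by (rule star_closed)

lemma star_zero [simp]: "star A \<zero> = \<zero>"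
  using star_smult[of \<zero> 0] by simp

lemma star_one [simp]: "star A \<one> = \<one>"
  using star_mult[of "star A \<one>" \<one>] star_star[of \<one>] by (simp add: star_star)

lemma star_uminus: "x \<in> carrier A \<Longrightarrow> star A (\<ominus> x) = \<ominus> star A x"
  using star_smult[of x "-1"] by (simp add: smult_uminus_l)

lemma star_diff: "\<lbrakk>x \<in> carrier A; y \<in> carrier A\<rbrakk> \<Longrightarrow> star A (x \<ominus> y) = star A x \<ominus> star A y"
  by (simp add: minus_eq star_add star_uminus)

lemma sa_iff: "a \<in> sa A \<longleftrightarrow> a \<in> carrier A \<and> star A a = a"
  by (simp add: sa_def)

lemma sa_in: "a \<in> sa A \<Longrightarrow> a \<in> carrier A"
  by (simp add: sa_def)

lemma sa_add: "\<lbrakk>a \<in> sa A; b \<in> sa A\<rbrakk> \<Longrightarrow> a \<oplus> b \<in> sa A"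
  by (simp add: sa_def star_add)

lemma sa_diff: "\<lbrakk>a \<in> sa A; b \<in> sa A\<rbrakk> \<Longrightarrow> a \<ominus> b \<in> sa A"
  by (simp add: sa_def star_diff)

lemma sa_smult: "a \<in> sa A \<Longrightarrow> complex_of_real t \<odot> a \<in> sa A"
  by (simp add: sa_def star_smult)

lemma sa_uminus: "a \<in> sa A \<Longrightarrow> \<ominus> a \<in> sa A"
  by (simp add: sa_def star_uminus)

lemma sa_zero [simp]: "\<zero> \<in> sa A" and sa_one [simp]: "\<one> \<in> sa A"
  by (simp_all add: sa_def)

lemma sa_mult_commute: "\<lbrakk>a \<in> sa A; b \<in> sa A; a \<otimes> b = b \<otimes> a\<rbrakk> \<Longrightarrow> a \<otimes> b \<in> sa A"
  by (simp add: sa_def star_mult)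

lemma star_mult_self_sa: "x \<in> carrier A \<Longrightarrow> star A x \<otimes> x \<in> sa A"
  by (simp add: sa_def star_mult star_star)

declare sa_in [simp]

lemma cnorm_zero [simp]: "cnorm A \<zero> = 0"
  by (simp add: cnorm_eq_zero)

lemma cnorm_uminus [simp]: "x \<in> carrier A \<Longrightarrow> cnorm A (\<ominus> x) = cnorm A x"
  using cnorm_smult[of x "-1"] by (simp add: smult_uminus_l)

lemma cnorm_diff: "\<lbrakk>x \<in> carrier A; y \<in> carrier A\<rbrakk> \<Longrightarrow> cnorm A (x \<ominus> y) \<le> cnorm A x + cnorm A y"
  using cnorm_add[of x "\<ominus> y"] by (simp add: minus_eq)

lemma cnorm_diff_commute: "\<lbrakk>x \<in> carrier A; y \<in> carrier A\<rbrakk> \<Longrightarrow> cnorm A (x \<ominus> y) = cnorm A (y \<ominus> x)"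
proof -
  assume *: "x \<in> carrier A" "y \<in> carrier A"
  then have "y \<ominus> x = \<ominus> (x \<ominus> y)" by algebra
  with * show ?thesis by simp
qed

lemma cnorm_diff_triangle:
  "\<lbrakk>x \<in> carrier A; y \<in> carrier A; z \<in> carrier A\<rbrakk>
   \<Longrightarrow> cnorm A (x \<ominus> z) \<le> cnorm A (x \<ominus> y) + cnorm A (y \<ominus> z)"
proof -
  assume *: "x \<in> carrier A" "y \<in> carrier A" "z \<in> carrier A"
  then have "(x \<ominus> y) \<oplus> (y \<ominus> z) = x \<ominus> z" by algebra
  with * show ?thesis using cnorm_add[of "x \<ominus> y" "y \<ominus> z"] by simp
qed

lemma cnorm_triangle_sub:
  "\<lbrakk>x \<in> carrier A; y \<in> carrier A\<rbrakk> \<Longrightarrow> cnorm A x \<le> cnorm A y + cnorm A (x \<ominus> y)"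
proof -
  assume *: "x \<in> carrier A" "y \<in> carrier A"
  then have "y \<oplus> (x \<ominus> y) = x" by algebra
  with * show ?thesis using cnorm_add[of y "x \<ominus> y"] by simp
qed

lemma cnorm_diff_bound:
  "\<lbrakk>x \<in> carrier A; y \<in> carrier A\<rbrakk> \<Longrightarrow> \<bar>cnorm A x - cnorm A y\<bar> \<le> cnorm A (x \<ominus> y)"
  using cnorm_triangle_sub[of x y] cnorm_triangle_sub[of y x] cnorm_diff_commute[of x y] by auto

lemma cnorm_diff_zero: "\<lbrakk>x \<in> carrier A; y \<in> carrier A; cnorm A (x \<ominus> y) \<le> 0\<rbrakk> \<Longrightarrow> x = y"
  using cnorm_nonneg[of "x \<ominus> y"] cnorm_eq_zero[of "x \<ominus> y"] by simp

lemma cnorm_star: "x \<in> carrier A \<Longrightarrow> cnorm A (star A x) = cnorm A x"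
proof -
  have *: "cnorm A x \<le> cnorm A (star A x)" if x: "x \<in> carrier A" for x
  proof (cases "cnorm A x = 0")
    case True with x show ?thesis by (simp add: cnorm_nonneg)
  next
    case False
    have "cnorm A x * cnorm A x \<le> cnorm A (star A x) * cnorm A x"
      using cstar_identity[OF x] cnorm_mult[of "star A x" x] x by (simp add: power2_eq_square)
    with False cnorm_nonneg[OF x] show ?thesis by simp
  qed
  assume x: "x \<in> carrier A"
  show ?thesis using *[OF x] *[OF star_in[OF x]] star_star[OF x] by simp
qed

lemma cnorm_sa_square: "a \<in> sa A \<Longrightarrow> cnorm A (a \<otimes> a) = (cnorm A a)\<^sup>2"
  by (metis cstar_identity sa_iff)

lemma cnorm_one_le: "cnorm A \<one> \<le> 1"
proof -
  have "cnorm A \<one> * (cnorm A \<one> - 1) = 0"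
    using cnorm_sa_square[OF sa_one] unfolding l_one[OF one_closed] power2_eq_square right_diff_distrib by linarith
  then show ?thesis by auto
qed

lemma cnorm_scalar_le: "cnorm A (complex_of_real t \<odot> \<one>) \<le> \<bar>t\<bar>"
  using cnorm_one_le by (simp add: cnorm_smult mult_left_le)

sublocale metric: Metric_space "carrier A" "cdist A"
proof
  fix x y z
  show "0 \<le> cdist A x y" by (simp add: cdist_def cnorm_nonneg)
  show "cdist A x y = cdist A y x" by (auto simp: cdist_def cnorm_diff_commute)
  assume x: "x \<in> carrier A" and y: "y \<in> carrier A"
  show "cdist A x y = 0 \<longleftrightarrow> x = y" using x y by (simp add: cdist_def cnorm_eq_zero)
  assume z: "z \<in> carrier A"
  show "cdist A x z \<le> cdist A x y + cdist A y z"
    using x y z by (simp add: cdist_def cnorm_diff_triangle)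
qed

lemma complete_sequence:
  assumes x: "\<And>n. x n \<in> carrier A"
    and cauchy: "\<And>e. e > 0 \<Longrightarrow> \<exists>N. \<forall>m\<ge>N. \<forall>n\<ge>N. cnorm A (x m \<ominus> x n) < e"
  obtains l where "l \<in> carrier A" "(\<lambda>n. cnorm A (x n \<ominus> l)) \<longlonglongrightarrow> 0"
proof -
  have "metric.MCauchy x"
    unfolding metric.MCauchy_def using x cauchy by (auto simp: cdist_def)
  then obtain l where "limitin metric.mtopology x l sequentially"
    using complete unfolding metric.mcomplete_def by blast
  then have l: "l \<in> carrier A" and "(\<lambda>n. cdist A (x n) l) \<longlonglongrightarrow> 0"
    unfolding metric.limitin_metric_dist_null by auto
  then have "(\<lambda>n. cnorm A (x n \<ominus> l)) \<longlonglongrightarrow> 0" using x by (simp add: cdist_def)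
  with l that show thesis by blast
qed

text \<open>Evaluation of a real polynomial by the Horner scheme; real coefficients keep
  self-adjoint elements self-adjoint. It stands in for functional calculus: identities are checked
  for real polynomials and then evaluated.\<close>

definition ev :: "'a \<Rightarrow> real poly \<Rightarrow> 'a" where
  "ev x p = fold_coeffs (\<lambda>c y. complex_of_real c \<odot> \<one> \<oplus> x \<otimes> y) p \<zero>"

lemma ev_0 [simp]: "ev x 0 = \<zero>"
  by (simp add: ev_def)

lemma ev_pCons: "x \<in> carrier A \<Longrightarrow> ev x (pCons c p) = complex_of_real c \<odot> \<one> \<oplus> x \<otimes> ev x p"
  by (cases "p = 0 \<and> c = 0") (auto simp: ev_def cCons_def fold_coeffs_def)

lemma ev_in [simp]: "x \<in> carrier A \<Longrightarrow> ev x p \<in> carrier A"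
  by (induction p) (simp_all add: ev_pCons)

lemma ev_add: "x \<in> carrier A \<Longrightarrow> ev x (p + q) = ev x p \<oplus> ev x q"
proof (induction p q rule: poly_induct2)
  case (pCons a p b q)
  let ?a = "complex_of_real a \<odot> \<one>" and ?b = "complex_of_real b \<odot> \<one>"
  have "?a \<oplus> ?b \<oplus> x \<otimes> (ev x p \<oplus> ev x q) = (?a \<oplus> x \<otimes> ev x p) \<oplus> (?b \<oplus> x \<otimes> ev x q)"
    using smult_in[OF one_closed] ev_in[OF pCons.prems] pCons.prems by algebra
  with pCons show ?case by (simp add: ev_pCons smult_add_l)
qed simp

lemma ev_smult: "x \<in> carrier A \<Longrightarrow> ev x (Polynomial.smult c p) = complex_of_real c \<odot> ev x p"
  by (induction p) (simp_all add: ev_pCons smult_add_r smult_assoc smult_mult_right)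

lemma ev_uminus: "x \<in> carrier A \<Longrightarrow> ev x (- p) = \<ominus> ev x p"
  using ev_smult[of x "-1" p] by (simp add: smult_uminus_l)

lemma ev_diff: "x \<in> carrier A \<Longrightarrow> ev x (p - q) = ev x p \<ominus> ev x q"
  using ev_add[of x p "- q"] by (simp add: ev_uminus minus_eq)

lemma ev_mult: "x \<in> carrier A \<Longrightarrow> ev x (p * q) = ev x p \<otimes> ev x q"
proof (induction p)
  case (pCons a p)
  then show ?case
    by (simp add: ev_pCons ev_add ev_smult smult_mult_left l_distr m_assoc)
qed simp

lemma ev_const: "x \<in> carrier A \<Longrightarrow> ev x [:c:] = complex_of_real c \<odot> \<one>"
  by (simp add: ev_pCons)

lemma ev_1 [simp]: "x \<in> carrier A \<Longrightarrow> ev x 1 = \<one>"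
  by (simp add: one_pCons ev_pCons)

lemma ev_X: "x \<in> carrier A \<Longrightarrow> ev x [:0, 1:] = x"
  by (simp add: ev_pCons)

text \<open>Commutation passes from \<open>x\<close> to polynomials in \<open>x\<close>, and by norm
  limits to the square roots built from them. This is how commuting square roots are obtained
  without a spectrum.\<close>

lemma ev_commute:
  assumes "x \<in> carrier A" "z \<in> carrier A" "z \<otimes> x = x \<otimes> z"
  shows "z \<otimes> ev x p = ev x p \<otimes> z"
proof (induction p)
  case (pCons a p)
  have "z \<otimes> (x \<otimes> ev x p) = (x \<otimes> ev x p) \<otimes> z"
    using assms pCons.IH by (metis ev_in m_assoc)
  then show ?case using assms
    by (simp add: ev_pCons r_distr l_distr smult_mult_right smult_mult_left)
qed (use assms in simp)

lemma ev_sa: "x \<in> sa A \<Longrightarrow> ev x p \<in> sa A"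
proof (induction p)
  case (pCons a p)
  have "x \<otimes> ev x p = ev x p \<otimes> x" using ev_commute[of x x] pCons by simp
  with pCons show ?case
    by (simp add: ev_pCons sa_add sa_smult sa_mult_commute)
qed simp

text \<open>With nonnegative coefficients the triangle inequality, applied term by term, yields the
  same polynomial at the real point 1. Cauchy estimates in the algebra thereby reduce to real
  numbers.\<close>

lemma cnorm_ev_le:
  assumes "x \<in> carrier A" "cnorm A x \<le> 1" "\<And>i. 0 \<le> Polynomial.coeff p i"
  shows "cnorm A (ev x p) \<le> poly p 1"
  using assms(3)
proof (induction p)
  case (pCons a p)
  have a: "0 \<le> a" using pCons.prems[of 0] by simp
  have IH: "cnorm A (ev x p) \<le> poly p 1"
    using pCons.IH pCons.prems[of "Suc i" for i] by simp
  have "cnorm A (ev x (pCons a p)) \<le> cnorm A (complex_of_real a \<odot> \<one>) + cnorm A (x \<otimes> ev x p)"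
    using assms by (simp add: ev_pCons cnorm_add)
  also have "\<dots> \<le> a + cnorm A x * cnorm A (ev x p)"
    using cnorm_scalar_le[of a] cnorm_mult[of x "ev x p"] a assms by simp
  also have "\<dots> \<le> a + 1 * poly p 1"
    using assms IH by (intro add_left_mono mult_mono) (auto simp: cnorm_nonneg)
  finally show ?case by simp
qed simp

end

text \<open>Iterates of y := (X + y^2)/2 from 0. A fixed point satisfies (1 - y)^2 = 1 - X, so the
  limit is the power series of 1 - sqrt(1 - X), obtained without binomial coefficients.\<close>

primrec sqrt_poly :: "nat \<Rightarrow> real poly" where
  "sqrt_poly 0 = 0"
| "sqrt_poly (Suc n) = Polynomial.smult (1 / 2) ([:0, 1:] + sqrt_poly n * sqrt_poly n)"

lemma coeff_mult_nonneg:
  fixes p q :: "real poly"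
  assumes "\<And>i. 0 \<le> Polynomial.coeff p i" "\<And>i. 0 \<le> Polynomial.coeff q i"
  shows "0 \<le> Polynomial.coeff (p * q) i"
  by (simp add: coeff_mult sum_nonneg assms)

lemma sqrt_poly_coeff_nonneg: "0 \<le> Polynomial.coeff (sqrt_poly n) i"
proof (induction n arbitrary: i)
  case (Suc n)
  then show ?case
    by (simp add: coeff_mult_nonneg coeff_pCons split: nat.split)
qed simp

text \<open>Consecutive iterates satisfy 2(y_{n+2} - y_{n+1}) = (y_{n+1} - y_n)(y_{n+1} + y_n),
  where inductively both factors have nonnegative coefficients.\<close>

lemma sqrt_poly_step_nonneg: "0 \<le> Polynomial.coeff (sqrt_poly (Suc n) - sqrt_poly n) i"
proof (induction n arbitrary: i)
  case 0
  show ?case by (simp add: coeff_pCons split: nat.split)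
next
  case (Suc n)
  have "sqrt_poly (Suc (Suc n)) - sqrt_poly (Suc n) =
      Polynomial.smult (1 / 2) ((sqrt_poly (Suc n) - sqrt_poly n) * (sqrt_poly (Suc n) + sqrt_poly n))"
    unfolding sqrt_poly.simps(2)[of "Suc n"] sqrt_poly.simps(2)[of n, symmetric]
    by (subst (2) sqrt_poly.simps(2)) (simp add: algebra_simps smult_diff_right smult_add_right del: sqrt_poly.simps)
  moreover have "0 \<le> Polynomial.coeff ((sqrt_poly (Suc n) - sqrt_poly n) * (sqrt_poly (Suc n) + sqrt_poly n)) i"
    by (intro coeff_mult_nonneg Suc.IH) (simp add: sqrt_poly_coeff_nonneg del: sqrt_poly.simps)
  ultimately show ?case by (simp del: sqrt_poly.simps)
qed

lemma sqrt_poly_diff_nonneg: "m \<le> n \<Longrightarrow> 0 \<le> Polynomial.coeff (sqrt_poly n - sqrt_poly m) i"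
proof (induction n rule: dec_induct)
  case (step n)
  have "sqrt_poly (Suc n) - sqrt_poly m = (sqrt_poly (Suc n) - sqrt_poly n) + (sqrt_poly n - sqrt_poly m)"
    by (simp del: sqrt_poly.simps)
  then show ?case
    using step.IH sqrt_poly_step_nonneg[of n i] by (metis add_nonneg_nonneg coeff_add)
qed simp

lemma sqrt_poly_at_1: "0 \<le> poly (sqrt_poly n) 1" "poly (sqrt_poly n) 1 \<le> 1"
proof (induction n)
  case (Suc n)
  { case 1 then show ?case using Suc by simp }
  { case 2
    have "poly (sqrt_poly n) 1 * poly (sqrt_poly n) 1 \<le> 1 * 1"
      using Suc by (intro mult_mono) auto
    then show ?case by simp }
qed simp_all

lemma sqrt_poly_at_1_mono: "m \<le> n \<Longrightarrow> poly (sqrt_poly m) 1 \<le> poly (sqrt_poly n) 1"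
proof -
  assume "m \<le> n"
  then have "0 \<le> poly (sqrt_poly n - sqrt_poly m) 1"
    by (simp add: poly_altdef sum_nonneg sqrt_poly_diff_nonneg del: poly_diff coeff_diff)
  then show ?thesis by simp
qed

text \<open>The values at 1 increase and stay below 1. Together with the coefficientwise
  monotonicity this is the only convergence needed.\<close>

lemma sqrt_poly_at_1_Cauchy: "Cauchy (\<lambda>n. poly (sqrt_poly n) 1)"
proof -
  have "convergent (\<lambda>n. poly (sqrt_poly n) 1)"
    by (rule Bseq_monoseq_convergent[OF BseqI'[of _ 1]])
      (simp_all add: monoseq_def sqrt_poly_at_1 sqrt_poly_at_1_mono)
  then show ?thesis by (rule convergent_Cauchy)
qed

section \<open>Norm limits along a filter, and the square root of 1 - x\<close>

context unital_cstar_algebra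
begin

lemma diff_self [simp]: "x \<in> carrier A \<Longrightarrow> x \<ominus> x = \<zero>"
  by (simp add: minus_eq r_neg)

text \<open>Membership in the carrier is demanded at every index, not just eventually, so that the
  algebraic laws can be applied to each term.\<close>

definition nlim :: "('n \<Rightarrow> 'a) \<Rightarrow> 'a \<Rightarrow> 'n filter \<Rightarrow> bool" where
  "nlim f l U \<longleftrightarrow> (\<forall>n. f n \<in> carrier A) \<and> l \<in> carrier A \<and> ((\<lambda>n. cnorm A (f n \<ominus> l)) \<longlongrightarrow> 0) U"

lemma nlimI:
  assumes "\<And>n. f n \<in> carrier A" "l \<in> carrier A" "\<And>n. cnorm A (f n \<ominus> l) \<le> g n" "(g \<longlongrightarrow> 0) U"
  shows "nlim f l U"
proof -
  have "((\<lambda>n. cnorm A (f n \<ominus> l)) \<longlongrightarrow> 0) U"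
    by (rule Lim_null_comparison[OF _ assms(4)]) (use assms in \<open>simp add: cnorm_nonneg\<close>)
  with assms show ?thesis by (simp add: nlim_def)
qed

lemma nlim_const: "l \<in> carrier A \<Longrightarrow> nlim (\<lambda>_. l) l U"
  by (simp add: nlim_def)

lemma nlim_add:
  assumes "nlim f l U" "nlim g m U"
  shows "nlim (\<lambda>n. f n \<oplus> g n) (l \<oplus> m) U"
proof (rule nlimI)
  show "((\<lambda>n. cnorm A (f n \<ominus> l) + cnorm A (g n \<ominus> m)) \<longlongrightarrow> 0) U"
    using assms by (auto simp: nlim_def intro!: tendsto_add_zero)
  fix n
  have c: "f n \<in> carrier A" "g n \<in> carrier A" "l \<in> carrier A" "m \<in> carrier A"
    using assms by (auto simp: nlim_def)
  then have "f n \<oplus> g n \<ominus> (l \<oplus> m) = (f n \<ominus> l) \<oplus> (g n \<ominus> m)" by algebra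
  then show "cnorm A (f n \<oplus> g n \<ominus> (l \<oplus> m)) \<le> cnorm A (f n \<ominus> l) + cnorm A (g n \<ominus> m)"
    using c by (simp add: cnorm_add)
qed (use assms in \<open>auto simp: nlim_def\<close>)

lemma nlim_smult:
  assumes "nlim f l U"
  shows "nlim (\<lambda>n. c \<odot> f n) (c \<odot> l) U"
proof (rule nlimI)
  show "((\<lambda>n. cmod c * cnorm A (f n \<ominus> l)) \<longlongrightarrow> 0) U"
    using assms by (auto simp: nlim_def intro!: tendsto_mult_right_zero)
  fix n
  have c: "f n \<in> carrier A" "l \<in> carrier A" using assms by (auto simp: nlim_def)
  then show "cnorm A (c \<odot> f n \<ominus> c \<odot> l) \<le> cmod c * cnorm A (f n \<ominus> l)"
    by (simp add: smult_diff_r[symmetric] cnorm_smult)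
qed (use assms in \<open>auto simp: nlim_def\<close>)

lemma nlim_uminus: "nlim f l U \<Longrightarrow> nlim (\<lambda>n. \<ominus> f n) (\<ominus> l) U"
  using nlim_smult[of f l U "-1"] by (simp add: nlim_def smult_uminus_l)

lemma nlim_diff: "\<lbrakk>nlim f l U; nlim g m U\<rbrakk> \<Longrightarrow> nlim (\<lambda>n. f n \<ominus> g n) (l \<ominus> m) U"
  using nlim_add[of f l U "\<lambda>n. \<ominus> g n" "\<ominus> m"] nlim_uminus[of g m U] by (simp add: minus_eq)

lemma nlim_star:
  assumes "nlim f l U"
  shows "nlim (\<lambda>n. star A (f n)) (star A l) U"
proof -
  have "cnorm A (star A (f n) \<ominus> star A l) = cnorm A (f n \<ominus> l)" for n
    using assms cnorm_star[of "f n \<ominus> l"] by (simp add: nlim_def star_diff)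
  then show ?thesis using assms by (simp add: nlim_def)
qed

text \<open>Expands ab - lm as (a - l)(b - m) + (a - l)m + l(b - m). In this form only the norms of
  the intended limits \<open>l\<close> and \<open>m\<close> have to be known.\<close>

lemma cnorm_mult_diff:
  assumes c: "a \<in> carrier A" "b \<in> carrier A" "l \<in> carrier A" "m \<in> carrier A"
  shows "cnorm A (a \<otimes> b \<ominus> l \<otimes> m)
    \<le> cnorm A (a \<ominus> l) * cnorm A (b \<ominus> m) + cnorm A (a \<ominus> l) * cnorm A m + cnorm A l * cnorm A (b \<ominus> m)"
proof -
  have 1: "cnorm A (((a \<ominus> l) \<otimes> (b \<ominus> m) \<oplus> (a \<ominus> l) \<otimes> m) \<oplus> l \<otimes> (b \<ominus> m))
      \<le> cnorm A ((a \<ominus> l) \<otimes> (b \<ominus> m) \<oplus> (a \<ominus> l) \<otimes> m) + cnorm A (l \<otimes> (b \<ominus> m))"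
    using c by (intro cnorm_add) simp_all
  have 2: "cnorm A ((a \<ominus> l) \<otimes> (b \<ominus> m) \<oplus> (a \<ominus> l) \<otimes> m)
      \<le> cnorm A ((a \<ominus> l) \<otimes> (b \<ominus> m)) + cnorm A ((a \<ominus> l) \<otimes> m)"
    using c by (intro cnorm_add) simp_all
  have 3: "cnorm A ((a \<ominus> l) \<otimes> (b \<ominus> m)) \<le> cnorm A (a \<ominus> l) * cnorm A (b \<ominus> m)"
    "cnorm A ((a \<ominus> l) \<otimes> m) \<le> cnorm A (a \<ominus> l) * cnorm A m"
    "cnorm A (l \<otimes> (b \<ominus> m)) \<le> cnorm A l * cnorm A (b \<ominus> m)"
    using c by (simp_all add: cnorm_mult)
  have "((a \<ominus> l) \<otimes> (b \<ominus> m) \<oplus> (a \<ominus> l) \<otimes> m) \<oplus> l \<otimes> (b \<ominus> m) = a \<otimes> b \<ominus> l \<otimes> m"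
    using c by algebra
  with 1 2 3 show ?thesis by simp
qed

lemma nlim_mult:
  assumes f: "nlim f l U" and g: "nlim g m U"
  shows "nlim (\<lambda>n. f n \<otimes> g n) (l \<otimes> m) U"
proof -
  have c: "\<And>n. f n \<in> carrier A" "\<And>n. g n \<in> carrier A" "l \<in> carrier A" "m \<in> carrier A"
    using f g by (simp_all add: nlim_def)
  define a b where "a = (\<lambda>n. cnorm A (f n \<ominus> l))" and "b = (\<lambda>n. cnorm A (g n \<ominus> m))"
  have "(a \<longlongrightarrow> 0) U" "(b \<longlongrightarrow> 0) U"
    using f g by (simp_all add: nlim_def a_def b_def)
  then have lim: "((\<lambda>n. a n * b n + a n * cnorm A m + cnorm A l * b n) \<longlongrightarrow> 0) U"
    by (auto intro!: tendsto_eq_intros)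
  show ?thesis
    by (rule nlimI[OF _ _ _ lim]) (use c in \<open>simp_all add: a_def b_def cnorm_mult_diff\<close>)
qed

lemma nlim_unique:
  assumes "nlim f l U" "nlim f m U" "U \<noteq> bot"
  shows "l = m"
proof -
  have c: "\<And>n. f n \<in> carrier A" "l \<in> carrier A" "m \<in> carrier A" using assms by (auto simp: nlim_def)
  have "((\<lambda>n. cnorm A (f n \<ominus> l) + cnorm A (f n \<ominus> m)) \<longlongrightarrow> 0) U"
    using assms by (auto simp: nlim_def intro!: tendsto_add_zero)
  moreover have "cnorm A (l \<ominus> m) \<le> cnorm A (f n \<ominus> l) + cnorm A (f n \<ominus> m)" for n
    using cnorm_diff_triangle[of l "f n" m] cnorm_diff_commute[of l "f n"] c by simp
  ultimately have "cnorm A (l \<ominus> m) \<le> 0"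
    using assms(3) by (intro tendsto_lowerbound) auto
  then show ?thesis using c cnorm_diff_zero by blast
qed

lemma nlim_sa: "\<lbrakk>nlim f l U; \<And>n. f n \<in> sa A; U \<noteq> bot\<rbrakk> \<Longrightarrow> l \<in> sa A"
proof -
  assume *: "nlim f l U" "\<And>n. f n \<in> sa A" "U \<noteq> bot"
  then have "star A (f n) = f n" for n by (simp only: sa_iff)
  with nlim_star[OF *(1)] have "nlim f (star A l) U" by simp
  with * have "star A l = l" using nlim_unique by blast
  moreover have "l \<in> carrier A" using * by (simp only: nlim_def)
  ultimately show ?thesis by (simp only: sa_iff)
qed

text \<open>The root is k = 1 - y with y the norm limit of \<open>ev x (sqrt_poly n)\<close>. Being
  a limit of polynomials in \<open>x\<close>, it commutes with whatever commutes with
  \<open>x\<close>; this is recorded because several roots must later commute with each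
  other.\<close>

lemma sqrt_one_minus:
  assumes x: "x \<in> sa A" and x1: "cnorm A x \<le> 1"
  obtains k where "k \<in> sa A" "k \<otimes> k = \<one> \<ominus> x"
    "\<And>z. z \<in> carrier A \<Longrightarrow> z \<otimes> x = x \<otimes> z \<Longrightarrow> z \<otimes> k = k \<otimes> z"
proof -
  note xc [simp] = sa_in[OF x]
  let ?y = "\<lambda>n. ev x (sqrt_poly n)"
  have d: "cnorm A (?y n \<ominus> ?y m) \<le> \<bar>poly (sqrt_poly n) 1 - poly (sqrt_poly m) 1\<bar>" if "m \<le> n" for m n
    using cnorm_ev_le[OF xc x1 sqrt_poly_diff_nonneg[OF that]] by (simp add: ev_diff)
  have d': "cnorm A (?y n \<ominus> ?y m) \<le> \<bar>poly (sqrt_poly n) 1 - poly (sqrt_poly m) 1\<bar>" for m n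
    using d[of m n] d[of n m] cnorm_diff_commute[of "?y n" "?y m"] by (cases "m \<le> n") auto
  have "\<exists>N. \<forall>m\<ge>N. \<forall>n\<ge>N. cnorm A (?y m \<ominus> ?y n) < e" if "e > 0" for e
  proof -
    obtain N where "\<forall>m\<ge>N. \<forall>n\<ge>N. \<bar>poly (sqrt_poly m) 1 - poly (sqrt_poly n) 1\<bar> < e"
      using sqrt_poly_at_1_Cauchy \<open>e > 0\<close> unfolding Cauchy_def dist_real_def by blast
    then show ?thesis using d' by (meson le_less_trans)
  qed
  then obtain y where y: "y \<in> carrier A" "(\<lambda>n. cnorm A (?y n \<ominus> y)) \<longlonglongrightarrow> 0"
    using complete_sequence[of ?y] ev_in[OF xc] by blast
  then have lim: "nlim ?y y sequentially" by (simp add: nlim_def)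
  then have lim': "nlim (\<lambda>n. ?y (Suc n)) y sequentially"
    unfolding nlim_def using LIMSEQ_Suc by blast
  define k where "k = \<one> \<ominus> y"
  have k: "nlim (\<lambda>n. \<one> \<ominus> ?y n) k sequentially"
    unfolding k_def by (intro nlim_diff nlim_const lim one_closed)
  have ks: "k \<in> sa A"
    by (rule nlim_sa[OF k]) (intro sa_diff ev_sa x sa_one, simp)
  have "nlim (\<lambda>n. (\<one> \<ominus> ?y n) \<otimes> (\<one> \<ominus> ?y n)) (k \<otimes> k) sequentially"
    by (intro nlim_mult k)
  \<comment> \<open>The recursion rewritten: (1 - y_n)^2 misses 1 - x exactly by 2(y_{n+1} - y_n),
    which tends to 0.\<close>
  moreover have eq: "(\<one> \<ominus> ?y n) \<otimes> (\<one> \<ominus> ?y n) = (\<one> \<ominus> x) \<oplus> 2 \<odot> (?y (Suc n) \<ominus> ?y n)" for n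
  proof -
    have "(1 - sqrt_poly n) * (1 - sqrt_poly n) = (1 - [:0, 1:]) + Polynomial.smult 2 (sqrt_poly (Suc n) - sqrt_poly n)"
    proof -
      have "Polynomial.smult 2 (sqrt_poly (Suc n)) = [:0, 1:] + sqrt_poly n * sqrt_poly n"
        by simp
      moreover have "Polynomial.smult 2 (sqrt_poly n) = sqrt_poly n + sqrt_poly n"
        using smult_add_left[of 1 1 "sqrt_poly n"] by simp
      ultimately show ?thesis
        unfolding smult_diff_right by (simp add: algebra_simps del: sqrt_poly.simps)
    qed
    from arg_cong[OF this, of "ev x"] show ?thesis
      by (simp only: ev_add ev_diff ev_mult ev_smult ev_1 ev_X xc) simp
  qed
  moreover have "nlim (\<lambda>n. (\<one> \<ominus> x) \<oplus> 2 \<odot> (?y (Suc n) \<ominus> ?y n)) ((\<one> \<ominus> x) \<oplus> 2 \<odot> (y \<ominus> y)) sequentially"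
    by (intro nlim_add nlim_smult nlim_diff nlim_const lim lim') auto
  ultimately have "k \<otimes> k = (\<one> \<ominus> x) \<oplus> 2 \<odot> (y \<ominus> y)"
    unfolding eq using nlim_unique sequentially_bot by blast
  also have "\<dots> = \<one> \<ominus> x" using y by (simp add: minus_eq r_neg)
  finally have sq: "k \<otimes> k = \<one> \<ominus> x" .
  have "z \<otimes> k = k \<otimes> z" if z: "z \<in> carrier A" and zx: "z \<otimes> x = x \<otimes> z" for z
  proof -
    have "z \<otimes> (\<one> \<ominus> ?y n) = (\<one> \<ominus> ?y n) \<otimes> z" for n
      using ev_commute[OF xc z zx, of "1 - sqrt_poly n"] by (simp add: ev_diff)
    then have eq: "(\<lambda>n. z \<otimes> (\<one> \<ominus> ?y n)) = (\<lambda>n. (\<one> \<ominus> ?y n) \<otimes> z)" by blast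
    have "nlim (\<lambda>n. z \<otimes> (\<one> \<ominus> ?y n)) (z \<otimes> k) sequentially"
      "nlim (\<lambda>n. (\<one> \<ominus> ?y n) \<otimes> z) (k \<otimes> z) sequentially"
      by (intro nlim_mult nlim_const k z)+
    then show ?thesis unfolding eq by (rule nlim_unique) simp
  qed
  with ks sq that show thesis by blast
qed

end

section \<open>Positive elements and Kaplansky's theorem\<close>

context unital_cstar_algebra
begin

abbreviation sc :: "real \<Rightarrow> 'a" where "sc t \<equiv> complex_of_real t \<odot> \<one>"

lemma sc_sa [simp]: "sc t \<in> sa A"
  by (rule sa_smult) simp

lemma sc_commute: "x \<in> carrier A \<Longrightarrow> x \<otimes> sc t = sc t \<otimes> x"
  by (simp add: smult_mult_left smult_mult_right)

lemma double: "x \<in> carrier A \<Longrightarrow> x \<oplus> x = 2 \<odot> x"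
  using smult_add_l[of x 1 1] by simp

lemma cnorm_double: "x \<in> carrier A \<Longrightarrow> cnorm A (x \<oplus> x) = 2 * cnorm A x"
  by (simp add: double cnorm_smult)

lemma square_sa: "k \<in> sa A \<Longrightarrow> k \<otimes> k \<in> sa A"
  by (rule sa_mult_commute) auto

text \<open>With \<open>u = k + il\<close> one has \<open>u\<^sup>*u = T\<close>, and \<open>l\<close> and \<open>k\<^sup>2 - l\<^sup>2\<close> are the imaginary part of \<open>u\<close>
  and the real part of \<open>u\<^sup>2\<close>.\<close>

lemma commuting_squares_bound:
  assumes k: "k \<in> sa A" and l: "l \<in> sa A" and kl: "k \<otimes> l = l \<otimes> k"
    and T: "k \<otimes> k \<oplus> l \<otimes> l = sc T" "0 \<le> T"
  shows "(cnorm A l)\<^sup>2 \<le> T" and "cnorm A (k \<otimes> k \<ominus> l \<otimes> l) \<le> T"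
proof -
  define m where "m = \<i> \<odot> l"
  have c [simp]: "k \<in> carrier A" "l \<in> carrier A" "m \<in> carrier A"
    using k l by (auto simp: m_def)
  have m2: "m \<otimes> m = \<ominus> (l \<otimes> l)"
    by (simp add: m_def smult_mult_left smult_mult_right smult_assoc smult_uminus_l)
  have km: "m \<otimes> k = k \<otimes> m"
    by (simp add: m_def smult_mult_left smult_mult_right kl)
  define u v where "u = k \<oplus> m" and "v = k \<ominus> m"
  have uv [simp]: "u \<in> carrier A" "v \<in> carrier A" by (auto simp: u_def v_def)
  have sm: "star A m = \<ominus> m" "star A k = k"
    using l k by (simp_all only: sa_iff m_def star_smult) (simp_all add: smult_uminus_l)
  have v: "star A u = v"
    by (simp add: u_def v_def star_add sm minus_eq)
  have "v \<otimes> u = (k \<otimes> k \<ominus> m \<otimes> m) \<oplus> (k \<otimes> m \<ominus> m \<otimes> k)"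
    unfolding u_def v_def using c by algebra
  also have "\<dots> = k \<otimes> k \<oplus> l \<otimes> l" by (simp add: km m2 minus_eq r_neg)
  finally have "v \<otimes> u = sc T" by (simp add: T)
  then have "(cnorm A u)\<^sup>2 = cnorm A (sc T)" using cstar_identity[of u] v by simp
  then have u: "(cnorm A u)\<^sup>2 \<le> T" using cnorm_scalar_le[of T] T by simp
  have nv: "cnorm A v = cnorm A u" using cnorm_star[of u] v by simp
  have "u \<ominus> v = m \<oplus> m" unfolding u_def v_def using c by algebra
  then have "2 * cnorm A m \<le> 2 * cnorm A u"
    using cnorm_diff[of u v] nv by (simp add: cnorm_double)
  then have "cnorm A l \<le> cnorm A u" by (simp add: m_def cnorm_smult)
  then show "(cnorm A l)\<^sup>2 \<le> T"
    using u order_trans[OF power_mono[of "cnorm A l" "cnorm A u" 2]] by (simp add: cnorm_nonneg)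
  have "u \<otimes> u \<oplus> v \<otimes> v = (k \<otimes> k \<oplus> m \<otimes> m) \<oplus> (k \<otimes> k \<oplus> m \<otimes> m)"
    unfolding u_def v_def using c by algebra
  also have "k \<otimes> k \<oplus> m \<otimes> m = k \<otimes> k \<ominus> l \<otimes> l" by (simp add: m2 minus_eq)
  finally have "2 * cnorm A (k \<otimes> k \<ominus> l \<otimes> l) = cnorm A (u \<otimes> u \<oplus> v \<otimes> v)"
    by (simp add: cnorm_double)
  also have "\<dots> \<le> cnorm A (u \<otimes> u) + cnorm A (v \<otimes> v)" by (simp add: cnorm_add)
  also have "\<dots> \<le> 2 * (cnorm A u)\<^sup>2"
    using cnorm_mult[of u u] cnorm_mult[of v v] nv by (simp add: power2_eq_square)
  finally show "cnorm A (k \<otimes> k \<ominus> l \<otimes> l) \<le> T" using u by simp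
qed

text \<open>Positivity without a spectrum: for self-adjoint \<open>h\<close> the ball condition says
  that the spectrum lies in [0, 2s]. Sums and nonnegative multiples are immediate from it, and
  \<open>pos_ball\<close> frees the choice of \<open>s\<close>.\<close>

definition pos :: "'a \<Rightarrow> bool" where
  "pos h \<longleftrightarrow> h \<in> sa A \<and> (\<exists>s\<ge>0. cnorm A (sc s \<ominus> h) \<le> s)"

lemma pos_sa: "pos h \<Longrightarrow> h \<in> sa A"
  by (simp add: pos_def)

lemma pos_in [simp]: "pos h \<Longrightarrow> h \<in> carrier A"
  using pos_sa sa_in by blast

text \<open>For s > 0 the element x = 1 - h/s has norm at most 1, so h = s(1 - x) has the root
  sqrt(s) sqrt(1 - x). The radius s = 0 forces h = 0.\<close>

lemma sqrt_ball:
  assumes h: "h \<in> sa A" and s: "cnorm A (sc s \<ominus> h) \<le> s" "0 \<le> s"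
  obtains k where "k \<in> sa A" "k \<otimes> k = h"
    "\<And>z. z \<in> carrier A \<Longrightarrow> z \<otimes> h = h \<otimes> z \<Longrightarrow> z \<otimes> k = k \<otimes> z"
proof (cases "s = 0")
  case True
  then have "\<zero> \<ominus> h = \<zero>" using s h cnorm_eq_zero[of "\<zero> \<ominus> h"] cnorm_nonneg[of "\<zero> \<ominus> h"] by simp
  then have "h = \<zero>" using h by (simp add: minus_eq)
  then show thesis using that[of \<zero>] by simp
next
  case False
  with s have s0: "0 < s" by simp
  note hc [simp] = sa_in[OF h]
  define x where "x = complex_of_real (1 / s) \<odot> (sc s \<ominus> h)"
  have x: "x \<in> sa A" unfolding x_def by (intro sa_smult sa_diff sc_sa h)
  have "cnorm A x \<le> 1" using s s0 by (simp add: x_def cnorm_smult norm_divide)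
  then obtain k where k: "k \<in> sa A" "k \<otimes> k = \<one> \<ominus> x"
    "\<And>z. z \<in> carrier A \<Longrightarrow> z \<otimes> x = x \<otimes> z \<Longrightarrow> z \<otimes> k = k \<otimes> z"
    using sqrt_one_minus[OF x] by blast
  note kc [simp] = sa_in[OF k(1)]
  have x': "x = \<one> \<ominus> complex_of_real (1 / s) \<odot> h"
    using s0 by (simp add: x_def smult_diff_r smult_assoc)
  have kk: "k \<otimes> k = complex_of_real (1 / s) \<odot> h"
  proof -
    have "\<one> \<ominus> (\<one> \<ominus> complex_of_real (1 / s) \<odot> h) = complex_of_real (1 / s) \<odot> h"
      using smult_in[OF hc, of "complex_of_real (1 / s)"] by algebra
    with k(2) x' show ?thesis by simp
  qed
  show thesis
  proof (rule that[of "complex_of_real (sqrt s) \<odot> k"])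
    show "complex_of_real (sqrt s) \<odot> k \<in> sa A" by (rule sa_smult) (rule k)
    show "complex_of_real (sqrt s) \<odot> k \<otimes> (complex_of_real (sqrt s) \<odot> k) = h"
      using s0 by (simp add: smult_mult_left smult_mult_right smult_assoc kk flip: of_real_mult)
    fix z assume z: "z \<in> carrier A" "z \<otimes> h = h \<otimes> z"
    then have "z \<otimes> x = x \<otimes> z"
      by (simp add: x' minus_eq r_distr l_distr smult_mult_left smult_mult_right
          flip: smult_uminus_l)
    then show "z \<otimes> (complex_of_real (sqrt s) \<odot> k) = complex_of_real (sqrt s) \<odot> k \<otimes> z"
      using k(3) z by (simp add: smult_mult_left smult_mult_right)
  qed
qed

lemma pos_sqrt:
  assumes "pos h"
  obtains k where "k \<in> sa A" "k \<otimes> k = h"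
    "\<And>z. z \<in> carrier A \<Longrightarrow> z \<otimes> h = h \<otimes> z \<Longrightarrow> z \<otimes> k = k \<otimes> z"
  using assms sqrt_ball unfolding pos_def by blast

text \<open>Put w = s - k^2. Then s - w = k^2 has norm at most s, so w = l^2 with \<open>l\<close>
  commuting with \<open>k\<close>. Now k^2 + l^2 = s bounds the norm of \<open>l\<close> by the root
  of s, and the norm of w is the square of that of \<open>l\<close>.\<close>

lemma square_ball:
  assumes k: "k \<in> sa A" and s: "cnorm A (k \<otimes> k) \<le> s"
  shows "cnorm A (sc s \<ominus> k \<otimes> k) \<le> s"
proof -
  note kc [simp] = sa_in[OF k]
  have s0: "0 \<le> s" using s cnorm_nonneg[of "k \<otimes> k"] by simp
  define w where "w = sc s \<ominus> k \<otimes> k"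
  have w: "w \<in> sa A" unfolding w_def by (intro sa_diff sc_sa square_sa k)
  have sw: "sc s \<ominus> w = k \<otimes> k"
    unfolding w_def using m_closed[OF kc kc] sa_in[OF sc_sa[of s]] by algebra
  obtain l where l: "l \<in> sa A" "l \<otimes> l = w" "\<And>z. z \<in> carrier A \<Longrightarrow> z \<otimes> w = w \<otimes> z \<Longrightarrow> z \<otimes> l = l \<otimes> z"
    using sqrt_ball[OF w, of s] s s0 sw by auto
  have "k \<otimes> w = w \<otimes> k"
    unfolding w_def using sc_commute[of k s] by (simp add: minus_eq r_distr l_distr r_minus l_minus m_assoc)
  then have "k \<otimes> l = l \<otimes> k" using l by simp
  moreover have "k \<otimes> k \<oplus> l \<otimes> l = sc s"
    unfolding l w_def using m_closed[OF kc kc] sa_in[OF sc_sa[of s]] by algebra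
  ultimately have "(cnorm A l)\<^sup>2 \<le> s" using commuting_squares_bound(1)[OF k l(1)] s0 by blast
  then show ?thesis using cnorm_sa_square[OF l(1)] l(2) by (simp add: w_def)
qed

lemma pos_square: "k \<in> sa A \<Longrightarrow> pos (k \<otimes> k)"
  unfolding pos_def using square_sa square_ball cnorm_nonneg by (metis order_refl sa_in)

lemma pos_ball: "\<lbrakk>pos h; cnorm A h \<le> s\<rbrakk> \<Longrightarrow> cnorm A (sc s \<ominus> h) \<le> s"
  using pos_sqrt square_ball by metis

lemma pos_sc: "0 \<le> t \<Longrightarrow> pos (sc t)"
  unfolding pos_def by (metis sa_in sc_sa diff_self cnorm_zero)

lemma pos_zero: "pos \<zero>"
  using pos_sc[of 0] by simp

lemma pos_add: "\<lbrakk>pos a; pos b\<rbrakk> \<Longrightarrow> pos (a \<oplus> b)"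
proof -
  assume a: "pos a" and b: "pos b"
  then obtain s t where st: "0 \<le> s" "0 \<le> t" "cnorm A (sc s \<ominus> a) \<le> s" "cnorm A (sc t \<ominus> b) \<le> t"
    unfolding pos_def by blast
  have "sc (s + t) \<ominus> (a \<oplus> b) = (sc s \<oplus> sc t) \<ominus> (a \<oplus> b)" by (simp add: smult_add_l)
  also have "\<dots> = (sc s \<ominus> a) \<oplus> (sc t \<ominus> b)"
    using pos_in[OF a] pos_in[OF b] sa_in[OF sc_sa[of s]] sa_in[OF sc_sa[of t]] by algebra
  finally have "cnorm A (sc (s + t) \<ominus> (a \<oplus> b)) \<le> s + t"
    using cnorm_add[of "sc s \<ominus> a" "sc t \<ominus> b"] st a b by simp
  with a b st show ?thesis unfolding pos_def using sa_add[of a b] by (metis add_nonneg_nonneg)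
qed

lemma pos_smult: "\<lbrakk>pos a; 0 \<le> c\<rbrakk> \<Longrightarrow> pos (complex_of_real c \<odot> a)"
proof -
  assume a: "pos a" and c: "0 \<le> c"
  then obtain s where s: "0 \<le> s" "cnorm A (sc s \<ominus> a) \<le> s" unfolding pos_def by blast
  have "sc (c * s) \<ominus> complex_of_real c \<odot> a = complex_of_real c \<odot> (sc s \<ominus> a)"
    using a by (simp add: smult_diff_r smult_assoc)
  then have "cnorm A (sc (c * s) \<ominus> complex_of_real c \<odot> a) \<le> c * s"
    using s c a by (simp add: cnorm_smult mult_left_mono)
  with s c a show ?thesis unfolding pos_def using sa_smult[of a c] by (metis mult_nonneg_nonneg)
qed

text \<open>For a root \<open>k\<close> of \<open>p\<close> commuting with \<open>z\<close>, the
  product in question is the square of the self-adjoint element zk.\<close>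

lemma pos_conj:
  assumes p: "pos p" and z: "z \<in> sa A" and zp: "z \<otimes> p = p \<otimes> z"
  shows "pos (z \<otimes> p \<otimes> z)"
proof -
  obtain k where k: "k \<in> sa A" "k \<otimes> k = p" "z \<otimes> k = k \<otimes> z"
    using pos_sqrt[OF p] zp z sa_in by metis
  note c [simp] = sa_in[OF z] sa_in[OF k(1)]
  have "z \<otimes> k \<in> sa A" using k z by (intro sa_mult_commute)
  then have "pos ((z \<otimes> k) \<otimes> (z \<otimes> k))" by (rule pos_square)
  moreover have "(z \<otimes> k) \<otimes> (z \<otimes> k) = (z \<otimes> k) \<otimes> (k \<otimes> z)" by (simp only: k(3))
  moreover have "\<dots> = z \<otimes> (k \<otimes> k) \<otimes> z" by (simp add: m_assoc)
  ultimately show ?thesis by (simp only: k(2))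
qed

text \<open>With commuting roots k^2 = t - d and l^2 = t + d, the sum of squares is the scalar 2t
  and the difference is -2d, so \<open>commuting_squares_bound\<close> applies.\<close>

lemma cnorm_le_pos:
  assumes d: "d \<in> sa A" and t: "0 \<le> t" and p: "pos (sc t \<ominus> d)" and q: "pos (sc t \<oplus> d)"
  shows "cnorm A d \<le> t"
proof -
  note c [simp] = sa_in[OF d] and sct [simp] = sa_in[OF sc_sa[of t]]
  obtain k where k: "k \<in> sa A" "k \<otimes> k = sc t \<ominus> d"
    "\<And>z. z \<in> carrier A \<Longrightarrow> z \<otimes> (sc t \<ominus> d) = (sc t \<ominus> d) \<otimes> z \<Longrightarrow> z \<otimes> k = k \<otimes> z"
    using pos_sqrt[OF p] by metis
  obtain l where l: "l \<in> sa A" "l \<otimes> l = sc t \<oplus> d"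
    "\<And>z. z \<in> carrier A \<Longrightarrow> z \<otimes> (sc t \<oplus> d) = (sc t \<oplus> d) \<otimes> z \<Longrightarrow> z \<otimes> l = l \<otimes> z"
    using pos_sqrt[OF q] by metis
  note c' [simp] = sa_in[OF k(1)] sa_in[OF l(1)]
  have "d \<otimes> (sc t \<ominus> d) = (sc t \<ominus> d) \<otimes> d"
    using sc_commute[OF c, of t] by (simp add: minus_eq r_distr l_distr r_minus l_minus)
  then have "d \<otimes> k = k \<otimes> d" using k(3) by simp
  then have "k \<otimes> (sc t \<oplus> d) = (sc t \<oplus> d) \<otimes> k"
    using sc_commute[of k t] by (simp add: r_distr l_distr)
  then have kl: "k \<otimes> l = l \<otimes> k" using l(3) by simp
  have "k \<otimes> k \<oplus> l \<otimes> l = sc t \<oplus> sc t" unfolding k l using c sct by algebra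
  then have "k \<otimes> k \<oplus> l \<otimes> l = sc (2 * t)" using smult_add_l[of \<one> t t] by simp
  then have "cnorm A (k \<otimes> k \<ominus> l \<otimes> l) \<le> 2 * t"
    using commuting_squares_bound(2)[OF k(1) l(1) kl] t by simp
  moreover have "k \<otimes> k \<ominus> l \<otimes> l = \<ominus> (d \<oplus> d)" unfolding k l using c sct by algebra
  ultimately show ?thesis by (simp add: cnorm_double)
qed

text \<open>All approximants can be tested with nearly the same radius, the norm of
  \<open>h\<close>, thanks to \<open>pos_ball\<close>. The three errors of e/3 come from enlarging
  the radius, moving the centre back, and replacing \<open>p\<close> by \<open>h\<close>.\<close>

lemma pos_closed:
  assumes h: "h \<in> sa A" and *: "\<And>e. 0 < e \<Longrightarrow> \<exists>p. pos p \<and> cnorm A (p \<ominus> h) \<le> e"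
  shows "pos h"
proof -
  note hc [simp] = sa_in[OF h]
  let ?s = "cnorm A h"
  have "cnorm A (sc ?s \<ominus> h) \<le> ?s + e" if e: "0 < e" for e
  proof -
    obtain p where p: "pos p" "cnorm A (p \<ominus> h) \<le> e / 3" using *[of "e / 3"] e by (metis divide_pos_pos zero_less_numeral)
    have "cnorm A p \<le> ?s + e / 3" using cnorm_triangle_sub[of p h] p by simp
    then have "cnorm A (sc (?s + e / 3) \<ominus> p) \<le> ?s + e / 3" using p by (intro pos_ball) auto
    moreover have "cnorm A (sc ?s \<ominus> sc (?s + e / 3)) \<le> e / 3"
      using cnorm_scalar_le[of "- (e / 3)"] that by (simp flip: smult_diff_l)
    ultimately show ?thesis
      using cnorm_diff_triangle[of "sc ?s" "sc (?s + e / 3)" h] p that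
        cnorm_diff_triangle[of "sc (?s + e / 3)" p h] by simp
  qed
  then have "cnorm A (sc ?s \<ominus> h) \<le> ?s" by (rule field_le_epsilon)
  then show ?thesis unfolding pos_def using h cnorm_nonneg by (metis hc)
qed

lemma pos_sc_minus: "\<lbrakk>h \<in> sa A; cnorm A h \<le> t\<rbrakk> \<Longrightarrow> pos (sc t \<ominus> h)"
proof -
  assume h: "h \<in> sa A" "cnorm A h \<le> t"
  then have "sc t \<ominus> (sc t \<ominus> h) = h"
    using sa_in[OF h(1)] sa_in[OF sc_sa[of t]] by algebra
  with h show ?thesis
    unfolding pos_def using sa_diff[OF sc_sa h(1)] cnorm_nonneg[of h] by (metis order_trans sa_in)
qed

lemma pos_sc_plus: "\<lbrakk>h \<in> sa A; cnorm A h \<le> t\<rbrakk> \<Longrightarrow> pos (sc t \<oplus> h)"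
  using pos_sc_minus[of "\<ominus> h" t] by (simp add: sa_uminus minus_eq)

text \<open>The polynomial t(1 - t)^2: for y = x(1 - x*x) one has y*y = kap(x*x). Its maximum on
  [0, 1] is 4/27, attained at 1/3, which is the origin of that constant.\<close>

definition kap :: "real poly" where "kap = [:0, 1:] * ([:1, -1:] * [:1, -1:])"

lemma ev_linear: "x \<in> carrier A \<Longrightarrow> ev x [:t, -1:] = sc t \<ominus> x"
  by (simp add: ev_pCons minus_eq smult_uminus_l r_minus)

text \<open>Turns a factorization of a real polynomial as a square times \<open>p\<close> into an
  operator inequality, once \<open>p\<close> is known to be positive at \<open>h\<close>.\<close>

lemma ev_sandwich_pos:
  assumes h: "h \<in> sa A" and p: "pos (ev h p)"
  shows "pos (ev h (q * p * q))"
proof -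
  note hc [simp] = sa_in[OF h]
  have "ev h q \<otimes> ev h p = ev h p \<otimes> ev h q"
    by (simp add: mult.commute flip: ev_mult)
  then show ?thesis using pos_conj[OF p ev_sa[OF h]] by (simp add: ev_mult)
qed

text \<open>Rests on 4/27 - t(1 - t)^2 = (t - 1/3)^2 (4/3 - t). This needs only t <= 4/3, so no
  positivity of \<open>h\<close> is presupposed, which would be circular.\<close>

lemma kap_upper:
  assumes h: "h \<in> sa A" "cnorm A h \<le> 1"
  shows "pos (sc (4 / 27) \<ominus> ev h kap)"
proof -
  note hc [simp] = sa_in[OF h(1)]
  have "pos (ev h [:4/3, -1:])" using pos_sc_minus[OF h(1), of "4/3"] h by (simp add: ev_linear)
  then have "pos (ev h ([:-1/3, 1:] * [:4/3, -1:] * [:-1/3, 1:]))" by (rule ev_sandwich_pos[OF h(1)])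
  also have "[:-1/3, 1:] * [:4/3, -1:] * [:-1/3, 1:] = [:4/27:] - kap"
    by (simp add: kap_def)
  finally show ?thesis by (simp only: ev_diff ev_const hc)
qed

text \<open>Rests on t - t(1 - t)^2 = t(2 - t)t, again without presupposing positivity of
  \<open>h\<close>.\<close>

lemma kap_lower:
  assumes h: "h \<in> sa A" "cnorm A h \<le> 1"
  shows "pos (h \<ominus> ev h kap)"
proof -
  note hc [simp] = sa_in[OF h(1)]
  have "pos (ev h [:2, -1:])" using pos_sc_minus[OF h(1), of 2] h by (simp add: ev_linear)
  then have "pos (ev h ([:0, 1:] * [:2, -1:] * [:0, 1:]))" by (rule ev_sandwich_pos[OF h(1)])
  also have "[:0, 1:] * [:2, -1:] * [:0, 1:] = [:0, 1:] - kap"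
    by (simp add: kap_def)
  finally show ?thesis by (simp only: ev_diff ev_X hc)
qed

text \<open>With the self-adjoint elements a = y + y* and b = i(y - y* ), the sum equals (a^2 +
  b^2)/2.\<close>

lemma pos_sum_star_mult:
  assumes y [simp]: "y \<in> carrier A"
  shows "pos (star A y \<otimes> y \<oplus> y \<otimes> star A y)"
proof -
  let ?z = "star A y"
  define a b where "a = y \<oplus> ?z" and "b = \<i> \<odot> (y \<ominus> ?z)"
  have a: "a \<in> sa A" by (simp only: sa_iff) (simp add: a_def star_add star_star a_comm)
  have "star A b = (- \<i>) \<odot> (?z \<ominus> y)" by (simp add: b_def star_smult star_diff star_star)
  also have "\<dots> = \<i> \<odot> (\<ominus> (?z \<ominus> y))" by (simp add: smult_uminus_l smult_uminus_r)
  also have "\<ominus> (?z \<ominus> y) = y \<ominus> ?z" using y star_in[OF y] by algebra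
  finally have b: "b \<in> sa A" by (simp only: sa_iff) (simp add: b_def)
  have "pos (a \<otimes> a \<oplus> b \<otimes> b)" using a b by (intro pos_add pos_square)
  also have "b \<otimes> b = \<ominus> ((y \<ominus> ?z) \<otimes> (y \<ominus> ?z))"
    by (simp add: b_def smult_mult_left smult_mult_right smult_assoc smult_uminus_l)
  also have "a \<otimes> a \<oplus> \<ominus> ((y \<ominus> ?z) \<otimes> (y \<ominus> ?z)) =
      (?z \<otimes> y \<oplus> y \<otimes> ?z) \<oplus> (?z \<otimes> y \<oplus> y \<otimes> ?z)"
    unfolding a_def using y star_in[OF y] by algebra
  also have "\<dots> = 2 \<odot> (?z \<otimes> y \<oplus> y \<otimes> ?z)" by (rule double) simp
  finally have "pos (complex_of_real (1/2) \<odot> (2 \<odot> (?z \<otimes> y \<oplus> y \<otimes> ?z)))"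
    by (rule pos_smult) simp
  then show ?thesis by (simp add: smult_assoc)
qed

lemma pos_sc_plusI:
  assumes c: "a \<in> carrier A" "b \<in> carrier A" and p: "pos (a \<oplus> b)" "pos (sc t \<ominus> b)"
  shows "pos (sc t \<oplus> a)"
proof -
  have "(a \<oplus> b) \<oplus> (sc t \<ominus> b) = sc t \<oplus> a"
    using c sa_in[OF sc_sa[of t]] by algebra
  with pos_add[OF p] show ?thesis by simp
qed

lemma pos_diff_trans:
  assumes c: "a \<in> carrier A" "b \<in> carrier A" "h \<in> carrier A" and p: "pos (h \<ominus> a)" "pos (a \<oplus> b)"
  shows "pos (h \<oplus> b)"
proof -
  have "(h \<ominus> a) \<oplus> (a \<oplus> b) = h \<oplus> b" using c by algebra
  with pos_add[OF p] show ?thesis by simp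
qed

text \<open>Replacing \<open>x\<close> by \<open>y = x(1 - x\<^sup>*x)\<close> compresses \<open>y\<^sup>*y\<close> and \<open>yy\<^sup>*\<close> below \<open>4/27\<close>, and since their
  sum is a sum of squares, also above \<open>-4/27\<close>.  Iterating, the lower bound tends to \<open>0\<close>.\<close>

lemma star_mult_pos_step:
  assumes P: "\<And>x. \<lbrakk>x \<in> carrier A; cnorm A x \<le> 1\<rbrakk> \<Longrightarrow> pos (star A x \<otimes> x \<oplus> sc c)"
    and x [simp]: "x \<in> carrier A" and x1: "cnorm A x \<le> 1"
  shows "pos (star A x \<otimes> x \<oplus> sc (4 / 27 * c))"
proof -
  define h k where "h = star A x \<otimes> x" and "k = x \<otimes> star A x"
  have h: "h \<in> sa A" unfolding h_def by (rule star_mult_self_sa[OF x])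
  have k: "k \<in> sa A" unfolding k_def using star_mult_self_sa[OF star_in[OF x]] by (simp add: star_star)
  note hc [simp] = sa_in[OF h] sa_in[OF k]
  have "cnorm A x * cnorm A x \<le> 1 * 1" using x1 by (intro mult_mono) (auto simp: cnorm_nonneg)
  then have h1: "cnorm A h \<le> 1" and k1: "cnorm A k \<le> 1"
    using cnorm_mult[of "star A x" x] cnorm_mult[of x "star A x"]
    by (simp_all add: h_def k_def cnorm_star)
  let ?e = "ev h [:1, -1:]" and ?f = "ev k [:1, -1:]"
  define y where "y = x \<otimes> ?e"
  have y [simp]: "y \<in> carrier A" by (simp add: y_def)
  \<comment> \<open>The relation x(x*x) = (xx* )x moves a polynomial in x*x across \<open>x\<close>,
    where it becomes the same polynomial in \<open>k\<close>. This puts both products of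
    \<open>y\<close> and its adjoint in the form \<open>kap\<close>.\<close>
  have y': "y = ?f \<otimes> x"
  proof -
    have "x \<otimes> h = k \<otimes> x" by (simp add: h_def k_def m_assoc)
    then show ?thesis
      by (simp add: y_def ev_linear minus_eq r_distr l_distr r_minus l_minus)
  qed
  have e: "star A ?e = ?e" "star A ?f = ?f" using ev_sa[OF h] ev_sa[OF k] by (simp_all only: sa_iff)
  have "star A (x \<otimes> a) \<otimes> (x \<otimes> a) = a \<otimes> (star A x \<otimes> x) \<otimes> a" if "a \<in> carrier A" "star A a = a" for a
    using that by (simp add: star_mult m_assoc)
  from this[of ?e] have "star A y \<otimes> y = ?e \<otimes> h \<otimes> ?e"
    using e unfolding y_def h_def[symmetric] by simp
  also have "\<dots> = ev h ([:1, -1:] * [:0, 1:] * [:1, -1:])" by (simp only: ev_mult ev_X hc)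
  also have "[:1, -1:] * [:0, 1:] * [:1, -1:] = kap" by (simp add: kap_def)
  finally have yy: "star A y \<otimes> y = ev h kap" .
  have "(a \<otimes> x) \<otimes> star A (a \<otimes> x) = a \<otimes> (x \<otimes> star A x) \<otimes> a" if "a \<in> carrier A" "star A a = a" for a
    using that by (simp add: star_mult m_assoc)
  from this[of ?f] have "y \<otimes> star A y = ?f \<otimes> k \<otimes> ?f"
    using e unfolding y' k_def[symmetric] by simp
  also have "\<dots> = ev k ([:1, -1:] * [:0, 1:] * [:1, -1:])" by (simp only: ev_mult ev_X hc)
  also have "[:1, -1:] * [:0, 1:] * [:1, -1:] = kap" by (simp add: kap_def)
  finally have yy': "y \<otimes> star A y = ev k kap" .
  have "pos (star A y \<otimes> y \<oplus> ev k kap)" using pos_sum_star_mult[OF y] by (simp only: yy')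
  then have "pos (sc (4/27) \<oplus> star A y \<otimes> y)"
    using kap_upper[OF k k1] by (intro pos_sc_plusI[of _ "ev k kap"]) simp_all
  moreover have "pos (sc (4/27) \<ominus> star A y \<otimes> y)" using kap_upper[OF h h1] by (simp only: yy)
  ultimately have "cnorm A (star A y \<otimes> y) \<le> 4/27"
    using star_mult_self_sa[OF y] by (intro cnorm_le_pos) simp_all
  then have ny: "(cnorm A y)\<^sup>2 \<le> 4/27" by (simp add: cstar_identity)
  \<comment> \<open>The norm of \<open>y\<close> is at most the root of 4/27, so \<open>z\<close> is
    in the unit ball and \<open>P\<close> applies to it. Scaling back multiplies the deficit
    \<open>c\<close> by 4/27.\<close>
  define z where "z = complex_of_real (sqrt (27/4)) \<odot> y"
  have z: "z \<in> carrier A" by (simp add: z_def)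
  have "(cnorm A z)\<^sup>2 = 27/4 * (cnorm A y)\<^sup>2" by (simp add: z_def cnorm_smult power_mult_distrib)
  also have "\<dots> \<le> 1\<^sup>2" using ny by simp
  finally have "cnorm A z \<le> 1" using power2_le_imp_le[of "cnorm A z" 1] by simp
  then have "pos (complex_of_real (4/27) \<odot> (star A z \<otimes> z \<oplus> sc c))" by (intro pos_smult P z) auto
  also have "star A z \<otimes> z = complex_of_real (27/4) \<odot> (star A y \<otimes> y)"
    by (simp add: z_def star_smult smult_mult_left smult_mult_right smult_assoc flip: of_real_mult)
  also have "complex_of_real (4/27) \<odot> (complex_of_real (27/4) \<odot> (star A y \<otimes> y) \<oplus> sc c)
      = star A y \<otimes> y \<oplus> sc (4/27 * c)"
    by (simp add: smult_add_r smult_assoc)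
  finally have 1: "pos (star A y \<otimes> y \<oplus> sc (4/27 * c))" .
  have 2: "pos (h \<ominus> star A y \<otimes> y)" using kap_lower[OF h h1] by (simp only: yy)
  have "pos (h \<oplus> sc (4/27 * c))"
    by (rule pos_diff_trans[OF _ _ _ 2 1]) simp_all
  then show ?thesis by (simp add: h_def)
qed

text \<open>The induction starts from the deficit 1, which is the trivial bound given by the norm;
  each step multiplies it by 4/27.\<close>

lemma star_mult_pos_iterate:
  "\<lbrakk>x \<in> carrier A; cnorm A x \<le> 1\<rbrakk> \<Longrightarrow> pos (star A x \<otimes> x \<oplus> sc ((4 / 27) ^ n))"
proof (induction n arbitrary: x)
  case 0
  have "cnorm A (star A x \<otimes> x) \<le> 1"
    using 0 by (simp add: cstar_identity power_le_one cnorm_nonneg)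
  then have "pos (sc 1 \<oplus> star A x \<otimes> x)" using 0 star_mult_self_sa[of x] by (intro pos_sc_plus) auto
  then show ?case using 0 by (simp add: a_comm)
next
  case (Suc n)
  then show ?case using star_mult_pos_step[of "(4/27) ^ n" x] by simp
qed

text \<open>In the unit ball the deficits (4/27)^n tend to 0 and the cone is closed; the general
  case follows by scaling.\<close>

theorem star_mult_pos:
  assumes x [simp]: "x \<in> carrier A"
  shows "pos (star A x \<otimes> x)"
proof -
  have *: "pos (star A x \<otimes> x)" if x [simp]: "x \<in> carrier A" and "cnorm A x \<le> 1" for x
  proof (rule pos_closed[OF star_mult_self_sa[OF x]])
    fix e :: real assume "0 < e"
    then obtain n where n: "(4 / 27 :: real) ^ n < e" using real_arch_pow_inv[of e "4/27"] by auto
    have "star A x \<otimes> x \<oplus> sc ((4 / 27) ^ n) \<ominus> star A x \<otimes> x = sc ((4 / 27) ^ n)"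
      using m_closed[OF star_in[OF x] x] sa_in[OF sc_sa[of "(4 / 27) ^ n"]] by algebra
    then have "cnorm A (star A x \<otimes> x \<oplus> sc ((4 / 27) ^ n) \<ominus> star A x \<otimes> x) \<le> e"
      using cnorm_scalar_le[of "(4/27) ^ n"] n by simp
    then show "\<exists>p. pos p \<and> cnorm A (p \<ominus> star A x \<otimes> x) \<le> e"
      using star_mult_pos_iterate[OF that] by blast
  qed
  show ?thesis
  proof (cases "x = \<zero>")
    case True then show ?thesis by (simp add: pos_zero)
  next
    case False
    then have n: "0 < cnorm A x" using cnorm_nonneg[OF x] cnorm_eq_zero[OF x] by simp
    define y where "y = complex_of_real (1 / cnorm A x) \<odot> x"
    have "y \<in> carrier A" "cnorm A y \<le> 1" using n by (simp_all add: y_def cnorm_smult norm_divide)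
    then have "pos (complex_of_real ((cnorm A x)\<^sup>2) \<odot> (star A y \<otimes> y))" by (intro pos_smult *) auto
    also have "complex_of_real ((cnorm A x)\<^sup>2) \<odot> (star A y \<otimes> y) = star A x \<otimes> x"
      using n by (simp add: y_def star_smult smult_mult_left smult_mult_right smult_assoc power2_eq_square)
    finally show ?thesis .
  qed
qed

text \<open>Bridge between the cone used by \<open>states\<close> and \<open>positive_map\<close>
  and the norm condition \<open>pos\<close> used in every estimate. One direction is Kaplansky's
  theorem, the other the square root.\<close>

lemma positive_cone_iff: "p \<in> positive_cone A \<longleftrightarrow> pos p"
proof
  assume "pos p"
  then obtain k where "k \<in> sa A" "k \<otimes> k = p" using pos_sqrt by metis
  then have "k \<in> carrier A" "star A k \<otimes> k = p" by (auto simp only: sa_iff)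
  then show "p \<in> positive_cone A" unfolding positive_cone_def by blast
qed (auto simp: positive_cone_def star_mult_pos)

end

section \<open>States\<close>

context unital_cstar_algebra
begin

section \<open>Hahn-Banach theorem on the real space of self-adjoint elements\<close>

abbreviation rs :: "real \<Rightarrow> 'a \<Rightarrow> 'a" where "rs t a \<equiv> complex_of_real t \<odot> a"

text \<open>The value 0 off the self-adjoint part makes the pointwise order of functions coincide
  with the order on \<open>sa A\<close>, so that minimality can be expressed by equality of
  functions.\<close>

definition sublinear :: "('a \<Rightarrow> real) \<Rightarrow> bool" where
  "sublinear q \<longleftrightarrow>
     (\<forall>a\<in>sa A. \<forall>b\<in>sa A. q (a \<oplus> b) \<le> q a + q b) \<and>
     (\<forall>a\<in>sa A. \<forall>t\<ge>0. q (rs t a) \<le> t * q a) \<and>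
     (\<forall>a. a \<notin> sa A \<longrightarrow> q a = 0)"

lemma sublinearD:
  assumes "sublinear q"
  shows "\<lbrakk>a \<in> sa A; b \<in> sa A\<rbrakk> \<Longrightarrow> q (a \<oplus> b) \<le> q a + q b"
    and "\<lbrakk>a \<in> sa A; 0 \<le> t\<rbrakk> \<Longrightarrow> q (rs t a) \<le> t * q a"
    and "a \<notin> sa A \<Longrightarrow> q a = 0"
  using assms by (auto simp: sublinear_def)

lemma sublinear_zero: "sublinear q \<Longrightarrow> q \<zero> = 0"
  using sublinearD(1)[of q \<zero> \<zero>] sublinearD(2)[of q \<zero> 0] by simp

lemma sublinear_neg: "\<lbrakk>sublinear q; a \<in> sa A\<rbrakk> \<Longrightarrow> - q (\<ominus> a) \<le> q a"
  using sublinearD(1)[of q a "\<ominus> a"] sublinear_zero[of q] by (simp add: sa_uminus r_neg)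

lemma sublinear_rs:
  assumes q: "sublinear q" and a: "a \<in> sa A" and t: "0 \<le> t"
  shows "q (rs t a) = t * q a"
proof (cases "t = 0")
  case True
  then show ?thesis using a sublinear_zero[OF q] by simp
next
  case False
  with t have t: "0 < t" by simp
  have "q (rs (1 / t) (rs t a)) \<le> 1 / t * q (rs t a)"
    by (rule sublinearD(2)[OF q sa_smult[OF a]]) (use t in simp)
  moreover have "rs (1 / t) (rs t a) = a" using t a by (simp add: smult_assoc)
  ultimately have "t * q a \<le> q (rs t a)" using t by (simp add: field_simps)
  with sublinearD(2)[OF q a, of t] t show ?thesis by simp
qed

text \<open>The auxiliary functional of the Hahn-Banach argument. It is sublinear and below
  \<open>q\<close>, and takes a value at most -q(b) at the negative of \<open>b\<close>; hence every
  linear functional below it agrees with \<open>q\<close> at \<open>b\<close>.\<close>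

definition tilt :: "('a \<Rightarrow> real) \<Rightarrow> 'a \<Rightarrow> 'a \<Rightarrow> real" where
  "tilt q b a = (if a \<in> sa A then INF t\<in>{0..}. q (a \<oplus> rs t b) - t * q b else 0)"

lemma tilt_bdd:
  assumes q: "sublinear q" and ab: "a \<in> sa A" "b \<in> sa A"
  shows "bdd_below ((\<lambda>t. q (a \<oplus> rs t b) - t * q b) ` {0..})"
proof (rule bdd_belowI2[where m = "- q (\<ominus> a)"])
  fix t :: real assume t: "t \<in> {0..}"
  have "(a \<oplus> rs t b) \<oplus> \<ominus> a = rs t b"
    using sa_in[OF ab(1)] sa_in[OF sa_smult[OF ab(2), of t]] by algebra
  then have "q (rs t b) \<le> q (a \<oplus> rs t b) + q (\<ominus> a)"
    using sublinearD(1)[OF q, of "a \<oplus> rs t b" "\<ominus> a"] ab by (simp add: sa_add sa_smult sa_uminus)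
  then show "- q (\<ominus> a) \<le> q (a \<oplus> rs t b) - t * q b"
    using sublinear_rs[OF q ab(2), of t] t by simp
qed

lemma tilt_le:
  assumes q: "sublinear q" and ab: "a \<in> sa A" "b \<in> sa A" and t: "0 \<le> t"
  shows "tilt q b a \<le> q (a \<oplus> rs t b) - t * q b"
  unfolding tilt_def using ab t cINF_lower[OF tilt_bdd[OF q ab], of t] by simp

lemma tilt_greatest:
  assumes "a \<in> sa A" "\<And>t. 0 \<le> t \<Longrightarrow> c \<le> q (a \<oplus> rs t b) - t * q b"
  shows "c \<le> tilt q b a"
  unfolding tilt_def using assms by (auto intro!: cINF_greatest)

lemma tilt_sublinear:
  assumes q: "sublinear q" and b: "b \<in> sa A"
  shows "sublinear (tilt q b)"
  unfolding sublinear_def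
proof (intro conjI ballI allI impI)
  fix a a' assume a: "a \<in> sa A" and a': "a' \<in> sa A"
  have *: "tilt q b (a \<oplus> a') \<le> (q (a \<oplus> rs t b) - t * q b) + (q (a' \<oplus> rs s b) - s * q b)"
    if "0 \<le> t" "0 \<le> s" for t s
  proof -
    have "(a \<oplus> a') \<oplus> rs (t + s) b = (a \<oplus> a') \<oplus> (rs t b \<oplus> rs s b)"
      using b by (simp add: smult_add_l)
    also have "\<dots> = (a \<oplus> rs t b) \<oplus> (a' \<oplus> rs s b)"
      using sa_in[OF a] sa_in[OF a'] sa_in[OF sa_smult[OF b, of t]] sa_in[OF sa_smult[OF b, of s]]
      by algebra
    finally have "q ((a \<oplus> a') \<oplus> rs (t + s) b) \<le> q (a \<oplus> rs t b) + q (a' \<oplus> rs s b)"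
      using sublinearD(1)[OF q, of "a \<oplus> rs t b" "a' \<oplus> rs s b"] a a' b by (simp add: sa_add sa_smult)
    then show ?thesis
      using tilt_le[OF q sa_add[OF a a'] b, of "t + s"] that by (simp add: algebra_simps)
  qed
  have "tilt q b (a \<oplus> a') - (q (a' \<oplus> rs s b) - s * q b) \<le> tilt q b a" if "0 \<le> s" for s
    by (rule tilt_greatest[OF a]) (use *[OF _ that] in \<open>simp add: algebra_simps\<close>)
  then have "tilt q b (a \<oplus> a') - tilt q b a \<le> tilt q b a'"
    by (intro tilt_greatest[OF a']) (simp add: algebra_simps)
  then show "tilt q b (a \<oplus> a') \<le> tilt q b a + tilt q b a'" by simp
next
  fix a and s :: real assume a: "a \<in> sa A" and s: "0 \<le> s"
  show "tilt q b (rs s a) \<le> s * tilt q b a"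
  proof (cases "s = 0")
    case True
    then show ?thesis
      using tilt_le[OF q sa_zero b, of 0] a sublinear_zero[OF q] b by simp
  next
    case False
    with s have s: "0 < s" by simp
    have "tilt q b (rs s a) / s \<le> tilt q b a"
    proof (rule tilt_greatest[OF a])
      fix t :: real assume t: "0 \<le> t"
      have "rs s a \<oplus> rs (s * t) b = rs s (a \<oplus> rs t b)"
        using a b by (simp add: smult_add_r smult_assoc)
      moreover have "q (rs s (a \<oplus> rs t b)) = s * q (a \<oplus> rs t b)"
        using sublinear_rs[OF q sa_add[OF a sa_smult[OF b]]] s by simp
      ultimately have "tilt q b (rs s a) \<le> s * (q (a \<oplus> rs t b) - t * q b)"
        using tilt_le[OF q sa_smult[OF a, of s] b, of "s * t"] s t by (simp add: algebra_simps)
      then show "tilt q b (rs s a) / s \<le> q (a \<oplus> rs t b) - t * q b"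
        using s by (simp add: pos_divide_le_eq mult.commute)
    qed
    then show ?thesis using s by (simp add: field_simps)
  qed
qed (simp add: tilt_def)

lemma tilt_below:
  assumes q: "sublinear q" and b: "b \<in> sa A"
  shows "tilt q b a \<le> q a"
proof (cases "a \<in> sa A")
  case True
  then show ?thesis using tilt_le[OF q True b, of 0] b by simp
next
  case False
  then show ?thesis using sublinearD(3)[OF q False] by (simp add: tilt_def)
qed

lemma tilt_neg: "\<lbrakk>sublinear q; b \<in> sa A\<rbrakk> \<Longrightarrow> tilt q b (\<ominus> b) \<le> - q b"
  using tilt_le[of q "\<ominus> b" b 1] sublinear_zero[of q] by (simp add: sa_uminus l_neg)

text \<open>Finiteness of the infimum comes from the common majorant: each member is at least -p(-a)
  at \<open>a\<close>. Subadditivity uses that a chain is directed downwards.\<close>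

lemma INF_sublinear:
  assumes ne: "C \<noteq> {}" and sub: "\<And>q. q \<in> C \<Longrightarrow> sublinear q"
    and chain: "\<And>q r. q \<in> C \<Longrightarrow> r \<in> C \<Longrightarrow> q \<le> r \<or> r \<le> q"
    and p: "\<And>q. q \<in> C \<Longrightarrow> q \<le> p"
  shows "sublinear (\<lambda>a. INF q\<in>C. q a)" and "q \<in> C \<Longrightarrow> (INF q\<in>C. q a) \<le> q a"
proof -
  have bdd: "bdd_below ((\<lambda>q. q a) ` C)" for a
  proof (cases "a \<in> sa A")
    case True
    show ?thesis
    proof (rule bdd_belowI2[where m = "- p (\<ominus> a)"])
      fix q assume "q \<in> C"
      then show "- p (\<ominus> a) \<le> q a"
        using sublinear_neg[OF sub True] p[of q] le_funD[of q p "\<ominus> a"] by force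
    qed
  next
    case False
    then show ?thesis
      by (intro bdd_belowI2[where m = 0]) (simp add: sublinearD(3)[OF sub])
  qed
  show low: "(INF q\<in>C. q a) \<le> q a" if "q \<in> C" for q a
    using cINF_lower[OF bdd that] .
  show "sublinear (\<lambda>a. INF q\<in>C. q a)"
    unfolding sublinear_def
  proof (intro conjI ballI allI impI)
    fix a b assume a: "a \<in> sa A" and b: "b \<in> sa A"
    have *: "(INF q\<in>C. q (a \<oplus> b)) \<le> q a + r b" if q: "q \<in> C" and r: "r \<in> C" for q r
    proof -
      \<comment> \<open>Two members of the chain are evaluated at different points; the smaller of
        them serves for both summands.\<close>
      obtain m where m: "m \<in> C" "m \<le> q" "m \<le> r" using chain[OF q r] q r by blast
      have "(INF q\<in>C. q (a \<oplus> b)) \<le> m (a \<oplus> b)" using low m by simp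
      also have "\<dots> \<le> m a + m b" using sublinearD(1)[OF sub[OF m(1)] a b] .
      also have "\<dots> \<le> q a + r b" using m by (simp add: le_fun_def add_mono)
      finally show ?thesis .
    qed
    have "(INF q\<in>C. q (a \<oplus> b)) - r b \<le> (INF q\<in>C. q a)" if "r \<in> C" for r
      by (rule cINF_greatest[OF ne]) (use *[OF _ that] in \<open>simp add: algebra_simps\<close>)
    then have "(INF q\<in>C. q (a \<oplus> b)) - (INF q\<in>C. q a) \<le> (INF q\<in>C. q b)"
      by (intro cINF_greatest[OF ne]) (simp add: algebra_simps)
    then show "(INF q\<in>C. q (a \<oplus> b)) \<le> (INF q\<in>C. q a) + (INF q\<in>C. q b)" by simp
  next
    fix a and t :: real assume a: "a \<in> sa A" and t: "0 \<le> t"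
    obtain q where q: "q \<in> C" using ne by blast
    show "(INF q\<in>C. q (rs t a)) \<le> t * (INF q\<in>C. q a)"
    proof (cases "t = 0")
      case True
      then show ?thesis using low[OF q, of \<zero>] sublinear_zero[OF sub[OF q]] a by simp
    next
      case False
      with t have t: "0 < t" by simp
      have "(INF q\<in>C. q (rs t a)) / t \<le> (INF q\<in>C. q a)"
      proof (rule cINF_greatest[OF ne])
        fix q assume q: "q \<in> C"
        have "(INF q\<in>C. q (rs t a)) \<le> t * q a"
          using low[OF q, of "rs t a"] sublinearD(2)[OF sub[OF q] a, of t] t by simp
        then show "(INF q\<in>C. q (rs t a)) / t \<le> q a" using t by (simp add: field_simps)
      qed
      then show ?thesis using t by (simp add: field_simps)
    qed
  next
    fix a assume "a \<notin> sa A"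
    then have "q a = 0" if "q \<in> C" for q using sublinearD(3)[OF sub[OF that]] by simp
    then have "(\<lambda>q. q a) ` C = {0}" using ne by force
    then show "(INF q\<in>C. q a) = 0" by simp
  qed
qed

text \<open>Zorn's lemma in the reversed pointwise order, with the pointwise infimum bounding a
  nonempty chain and \<open>p\<close> itself the empty one.\<close>

lemma minimal_sublinear:
  assumes p: "sublinear p"
  obtains q where "sublinear q" "q \<le> p" "\<And>r. sublinear r \<Longrightarrow> r \<le> q \<Longrightarrow> r = q"
proof -
  let ?S = "{q. sublinear q \<and> q \<le> p}" and ?P = "\<lambda>q r :: 'a \<Rightarrow> real. r \<le> q"
  have "\<exists>q\<in>?S. \<forall>r\<in>?S. ?P q r \<longrightarrow> r = q"
  proof (rule predicate_Zorn)
    show "partial_order_on ?S (relation_of ?P ?S)"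
      by (rule partial_order_on_relation_ofI) auto
    fix C assume C: "C \<in> Chains (relation_of ?P ?S)"
    then have CS: "C \<subseteq> ?S" by (rule Chains_relation_of)
    show "\<exists>u\<in>?S. \<forall>a\<in>C. ?P a u"
    proof (cases "C = {}")
      case True
      then show ?thesis using p by blast
    next
      case False
      have chain: "q \<le> r \<or> r \<le> q" if "q \<in> C" "r \<in> C" for q r
        using C that unfolding Chains_def relation_of_def by blast
      have sub: "sublinear q" and le: "q \<le> p" if "q \<in> C" for q using CS that by auto
      have "sublinear (\<lambda>a. INF q\<in>C. q a)"
        by (rule INF_sublinear(1)[OF False sub chain le])
      moreover have low: "(\<lambda>a. INF q\<in>C. q a) \<le> q" if "q \<in> C" for q
        by (rule le_funI) (rule INF_sublinear(2)[OF False sub chain le that])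
      moreover obtain q where "q \<in> C" using False by blast
      then have "(\<lambda>a. INF q\<in>C. q a) \<le> p" using low le order_trans by blast
      ultimately show ?thesis by blast
    qed
  qed
  then obtain q where q: "sublinear q" "q \<le> p" and min: "\<forall>r\<in>?S. r \<le> q \<longrightarrow> r = q" by blast
  show thesis
  proof (rule that[OF q])
    fix r assume "sublinear r" "r \<le> q"
    moreover from this q have "r \<le> p" by (meson order_trans)
    ultimately show "r = q" using min by blast
  qed
qed

text \<open>A minimal sublinear functional equals all its tilts, hence is superadditive.\<close>

lemma linear_below_sublinear:
  assumes p: "sublinear p" and d: "d \<in> sa A"
  obtains f where "\<And>a b. \<lbrakk>a \<in> sa A; b \<in> sa A\<rbrakk> \<Longrightarrow> f (a \<oplus> b) = f a + f b"
    and "\<And>a t. a \<in> sa A \<Longrightarrow> f (rs t a) = t * f a"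
    and "\<And>a. f a \<le> p a" and "f d = p d"
proof -
  \<comment> \<open>Minimality is sought below \<open>tilt p d\<close> rather than \<open>p\<close>:
    the bound of the tilt at the negative of \<open>d\<close> forces the linear functional to attain
    \<open>p\<close> at \<open>d\<close>.\<close>
  obtain q where q: "sublinear q" "q \<le> tilt p d" and min: "\<And>r. sublinear r \<Longrightarrow> r \<le> q \<Longrightarrow> r = q"
    using minimal_sublinear[OF tilt_sublinear[OF p d]] by metis
  have add: "q (a \<oplus> b) = q a + q b" if a: "a \<in> sa A" and b: "b \<in> sa A" for a b
  proof -
    have "tilt q b = q"
      by (intro min tilt_sublinear q b le_funI tilt_below)
    then have "q a \<le> q (a \<oplus> b) - q b" using tilt_le[OF q(1) a b, of 1] b by simp
    with sublinearD(1)[OF q(1) a b] show ?thesis by simp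
  qed
  have neg: "q (\<ominus> a) = - q a" if "a \<in> sa A" for a
    using add[OF that sa_uminus[OF that]] sublinear_zero[OF q(1)] that by (simp add: r_neg)
  have smult: "q (rs t a) = t * q a" if a: "a \<in> sa A" for a t
  proof (cases "0 \<le> t")
    case True
    then show ?thesis using sublinear_rs[OF q(1) a] by simp
  next
    case False
    then have "q (rs (- t) a) = - t * q a" using sublinear_rs[OF q(1) a, of "- t"] by simp
    moreover have "rs (- t) a = \<ominus> (rs t a)" using a by (simp add: smult_uminus_l)
    ultimately show ?thesis using neg[OF sa_smult[OF a]] by simp
  qed
  have le: "q a \<le> p a" for a
    using q(2) tilt_below[OF p d, of a] by (meson le_funD order_trans)
  have "- q d \<le> - p d"
    using neg[OF d] le_funD[OF q(2), of "\<ominus> d"] tilt_neg[OF p d] by simp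
  with le[of d] have "q d = p d" by simp
  with add smult le that show thesis by blast
qed

text \<open>The order-unit gauge, morally the top of the spectrum. A linear functional below it is
  automatically positive and unital, which is why it is the functional handed to
  Hahn-Banach.\<close>

definition gauge :: "'a \<Rightarrow> real" where
  "gauge a = (if a \<in> sa A then Inf {t. pos (sc t \<ominus> a)} else 0)"

text \<open>In a nonzero algebra the unit has norm 1. For t < 0, \<open>pos_ball\<close> with radius
  -t would bound the norm of -2t by -t.\<close>

lemma pos_scD:
  assumes "\<one> \<noteq> \<zero>" and "pos (sc t)"
  shows "0 \<le> t"
proof (rule ccontr)
  assume t: "\<not> 0 \<le> t"
  have "cnorm A \<one> * (cnorm A \<one> - 1) = 0"
    using cnorm_sa_square[OF sa_one] unfolding l_one[OF one_closed] power2_eq_square right_diff_distrib by linarith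
  then have 1: "cnorm A \<one> = 1" using assms cnorm_eq_zero by simp
  have "cnorm A (sc (- t) \<ominus> sc t) \<le> - t" using t 1 by (intro pos_ball assms) (simp add: cnorm_smult)
  then show False using t 1 by (simp add: cnorm_smult flip: smult_diff_l)
qed

lemma gauge_props:
  assumes ne: "\<one> \<noteq> \<zero>" and a: "a \<in> sa A"
  shows "bdd_below {t. pos (sc t \<ominus> a)}" and "{t. pos (sc t \<ominus> a)} \<noteq> {}"
proof -
  show "bdd_below {t. pos (sc t \<ominus> a)}"
  proof (rule bdd_belowI)
    fix t assume "t \<in> {t. pos (sc t \<ominus> a)}"
    then have "pos ((sc t \<ominus> a) \<oplus> (sc (cnorm A a) \<oplus> a))"
      using a by (intro pos_add pos_sc_plus) auto
    also have "(sc t \<ominus> a) \<oplus> (sc (cnorm A a) \<oplus> a) = sc t \<oplus> sc (cnorm A a)"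
      using sa_in[OF a] sa_in[OF sc_sa[of t]] sa_in[OF sc_sa[of "cnorm A a"]] by algebra
    finally have "pos (sc (t + cnorm A a))" by (simp add: smult_add_l)
    then show "- cnorm A a \<le> t" using pos_scD[OF ne] by fastforce
  qed
  show "{t. pos (sc t \<ominus> a)} \<noteq> {}" using pos_sc_minus[OF a order_refl] by blast
qed

lemma gauge_le: "\<lbrakk>\<one> \<noteq> \<zero>; a \<in> sa A; pos (sc t \<ominus> a)\<rbrakk> \<Longrightarrow> gauge a \<le> t"
  unfolding gauge_def using gauge_props(1) by (auto intro: cInf_lower)

lemma gauge_less:
  assumes ne: "\<one> \<noteq> \<zero>" and a: "a \<in> sa A" and t: "gauge a < t"
  shows "pos (sc t \<ominus> a)"
proof -
  obtain s where s: "pos (sc s \<ominus> a)" "s < t"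
    using t a cInf_lessD[OF gauge_props(2)[OF ne a], of t] by (auto simp: gauge_def)
  have "pos (sc (t - s) \<oplus> (sc s \<ominus> a))" using s by (intro pos_add pos_sc) auto
  also have "sc (t - s) \<oplus> (sc s \<ominus> a) = (sc t \<ominus> sc s) \<oplus> (sc s \<ominus> a)"
    by (simp add: smult_diff_l)
  also have "\<dots> = sc t \<ominus> a"
    using sa_in[OF a] sa_in[OF sc_sa[of t]] sa_in[OF sc_sa[of s]] by algebra
  finally show ?thesis .
qed

lemma gauge_sublinear:
  assumes ne: "\<one> \<noteq> \<zero>"
  shows "sublinear gauge"
  unfolding sublinear_def
proof (intro conjI ballI allI impI)
  fix a b assume a: "a \<in> sa A" and b: "b \<in> sa A"
  show "gauge (a \<oplus> b) \<le> gauge a + gauge b"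
  proof (rule field_le_epsilon)
    fix e :: real assume e: "0 < e"
    let ?s = "gauge a + e / 2" and ?t = "gauge b + e / 2"
    have "pos ((sc ?s \<ominus> a) \<oplus> (sc ?t \<ominus> b))"
      using e by (intro pos_add gauge_less ne a b) auto
    also have "(sc ?s \<ominus> a) \<oplus> (sc ?t \<ominus> b) = (sc ?s \<oplus> sc ?t) \<ominus> (a \<oplus> b)"
      using sa_in[OF a] sa_in[OF b] sa_in[OF sc_sa[of ?s]] sa_in[OF sc_sa[of ?t]] by algebra
    also have "sc ?s \<oplus> sc ?t = sc (?s + ?t)" by (simp only: of_real_add smult_add_l one_closed)
    finally show "gauge (a \<oplus> b) \<le> gauge a + gauge b + e"
      using gauge_le[OF ne sa_add[OF a b]] by fastforce
  qed
next
  fix a and t :: real assume a: "a \<in> sa A" and t: "0 \<le> t"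
  show "gauge (rs t a) \<le> t * gauge a"
  proof (rule field_le_epsilon)
    fix e :: real assume e: "0 < e"
    \<comment> \<open>Dividing by t + 1 keeps the slack meaningful for t = 0 and bounds its
      contribution by e.\<close>
    let ?s = "gauge a + e / (t + 1)"
    have "pos (rs t (sc ?s \<ominus> a))" using e t by (intro pos_smult gauge_less ne a) auto
    also have "rs t (sc ?s \<ominus> a) = sc (t * ?s) \<ominus> rs t a" using a by (simp add: smult_diff_r smult_assoc)
    finally have "gauge (rs t a) \<le> t * ?s" using gauge_le[OF ne sa_smult[OF a]] by blast
    also have "\<dots> \<le> t * gauge a + e" using e t by (simp add: field_simps)
    finally show "gauge (rs t a) \<le> t * gauge a + e" .
  qed
qed (simp add: gauge_def)

section \<open>Real and imaginary parts\<close>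

definition re :: "'a \<Rightarrow> 'a" where "re a = (1 / 2) \<odot> (a \<oplus> star A a)"
definition im :: "'a \<Rightarrow> 'a" where "im a = (- \<i> / 2) \<odot> (a \<ominus> star A a)"

lemma re_sa: "a \<in> carrier A \<Longrightarrow> re a \<in> sa A"
  by (simp only: sa_iff) (simp add: re_def star_smult star_add star_star a_comm)

lemma im_sa: "a \<in> carrier A \<Longrightarrow> im a \<in> sa A"
proof -
  assume a: "a \<in> carrier A"
  have "star A (im a) = (\<i> / 2) \<odot> (star A a \<ominus> a)"
    using a by (simp add: im_def star_smult star_diff star_star)
  also have "star A a \<ominus> a = \<ominus> (a \<ominus> star A a)" using a star_in[OF a] by algebra
  also have "(\<i> / 2) \<odot> (\<ominus> (a \<ominus> star A a)) = im a"
    using a by (simp add: im_def smult_uminus_r smult_uminus_l)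
  finally show ?thesis using a by (simp only: sa_iff) (simp add: im_def)
qed

lemma re_im_in [simp]: "a \<in> carrier A \<Longrightarrow> re a \<in> carrier A" "a \<in> carrier A \<Longrightarrow> im a \<in> carrier A"
  using re_sa im_sa by simp_all

lemma re_im: "a \<in> carrier A \<Longrightarrow> re a \<oplus> \<i> \<odot> im a = a"
proof -
  assume a: "a \<in> carrier A"
  have "re a \<oplus> \<i> \<odot> im a = (1 / 2) \<odot> ((a \<oplus> star A a) \<oplus> (a \<ominus> star A a))"
    using a by (simp add: re_def im_def smult_assoc smult_add_r)
  also have "(a \<oplus> star A a) \<oplus> (a \<ominus> star A a) = a \<oplus> a" using a star_in[OF a] by algebra
  finally show ?thesis using a by (simp add: double smult_assoc)
qed

lemma star_re_im:
  assumes u: "u \<in> sa A" and v: "v \<in> sa A"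
  shows "star A (u \<oplus> \<i> \<odot> v) = u \<ominus> \<i> \<odot> v"
proof -
  have "star A u = u" "star A v = v" using u v by (simp_all only: sa_iff)
  then show ?thesis using u v by (simp add: star_add star_smult minus_eq smult_uminus_l)
qed

text \<open>Uniqueness of the decomposition; the additivity and scalar rules for \<open>re\<close>
  and \<open>im\<close> are read off from it instead of being computed.\<close>

lemma re_im_unique:
  assumes u: "u \<in> sa A" and v: "v \<in> sa A"
  shows "re (u \<oplus> \<i> \<odot> v) = u" and "im (u \<oplus> \<i> \<odot> v) = v"
proof -
  note c = sa_in[OF u] sa_in[OF v] smult_in[OF sa_in[OF v], of \<i>]
  have "(u \<oplus> \<i> \<odot> v) \<oplus> (u \<ominus> \<i> \<odot> v) = u \<oplus> u" using c by algebra
  then show "re (u \<oplus> \<i> \<odot> v) = u"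
    using c by (simp add: re_def star_re_im[OF u v] double smult_assoc)
  have "(u \<oplus> \<i> \<odot> v) \<ominus> (u \<ominus> \<i> \<odot> v) = \<i> \<odot> v \<oplus> \<i> \<odot> v" using c by algebra
  then show "im (u \<oplus> \<i> \<odot> v) = v"
    using c by (simp add: im_def star_re_im[OF u v] double smult_assoc)
qed

lemma cnorm_re: "a \<in> carrier A \<Longrightarrow> cnorm A (re a) \<le> cnorm A a"
  using cnorm_add[of a "star A a"] by (simp add: re_def cnorm_smult cnorm_star)

lemma cnorm_im: "a \<in> carrier A \<Longrightarrow> cnorm A (im a) \<le> cnorm A a"
  using cnorm_diff[of a "star A a"] by (simp add: im_def cnorm_smult cnorm_star norm_divide)

lemma re_im_add:
  assumes "a \<in> carrier A" "b \<in> carrier A"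
  shows "re (a \<oplus> b) = re a \<oplus> re b" and "im (a \<oplus> b) = im a \<oplus> im b"
proof -
  have "(re a \<oplus> re b) \<oplus> \<i> \<odot> (im a \<oplus> im b) = (re a \<oplus> re b) \<oplus> (\<i> \<odot> im a \<oplus> \<i> \<odot> im b)"
    using assms by (simp add: smult_add_r)
  also have "\<dots> = (re a \<oplus> \<i> \<odot> im a) \<oplus> (re b \<oplus> \<i> \<odot> im b)"
    using re_im_in[OF assms(1)] re_im_in[OF assms(2)] smult_in[OF re_im_in(2)[OF assms(1)], of \<i>]
      smult_in[OF re_im_in(2)[OF assms(2)], of \<i>] by algebra
  also have "\<dots> = a \<oplus> b" using assms by (simp add: re_im)
  finally have e: "a \<oplus> b = (re a \<oplus> re b) \<oplus> \<i> \<odot> (im a \<oplus> im b)" ..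
  have s: "re a \<oplus> re b \<in> sa A" "im a \<oplus> im b \<in> sa A"
    using assms by (auto intro: sa_add re_sa im_sa)
  show "re (a \<oplus> b) = re a \<oplus> re b" "im (a \<oplus> b) = im a \<oplus> im b"
    unfolding e by (rule re_im_unique[OF s])+
qed

lemma smult_re_im:
  assumes u: "u \<in> sa A" and v: "v \<in> sa A"
  shows "c \<odot> (u \<oplus> \<i> \<odot> v) =
    (rs (Re c) u \<ominus> rs (Im c) v) \<oplus> \<i> \<odot> (rs (Re c) v \<oplus> rs (Im c) u)"
proof -
  note uv [simp] = sa_in[OF u] sa_in[OF v]
  have s: "c \<odot> x = rs (Re c) x \<oplus> \<i> \<odot> rs (Im c) x" if x: "x \<in> carrier A" for x
  proof -
    have "c \<odot> x = (complex_of_real (Re c) + \<i> * complex_of_real (Im c)) \<odot> x"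
      using complex_eq[of c] by (rule arg_cong)
    also have "\<dots> = rs (Re c) x \<oplus> \<i> \<odot> rs (Im c) x" using x by (simp add: smult_add_l smult_assoc)
    finally show ?thesis .
  qed
  have "c \<odot> (u \<oplus> \<i> \<odot> v) = c \<odot> u \<oplus> \<i> \<odot> (c \<odot> v)"
    by (simp add: smult_add_r smult_assoc mult.commute)
  also have "\<i> \<odot> (c \<odot> v) = \<i> \<odot> rs (Re c) v \<ominus> rs (Im c) v"
    by (simp add: s[of v] smult_add_r smult_assoc smult_uminus_l minus_eq)
  also have "c \<odot> u \<oplus> (\<i> \<odot> rs (Re c) v \<ominus> rs (Im c) v) =
      (rs (Re c) u \<ominus> rs (Im c) v) \<oplus> (\<i> \<odot> rs (Re c) v \<oplus> \<i> \<odot> rs (Im c) u)"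
    unfolding s[OF uv(1)]
    using smult_in[OF uv(1), of "complex_of_real (Re c)"] smult_in[OF uv(2), of "complex_of_real (Im c)"]
      smult_in[OF smult_in[OF uv(1), of "complex_of_real (Im c)"], of \<i>]
      smult_in[OF smult_in[OF uv(2), of "complex_of_real (Re c)"], of \<i>] by algebra
  finally show ?thesis by (simp add: smult_add_r)
qed

lemma re_im_smult:
  assumes a: "a \<in> carrier A"
  shows "re (c \<odot> a) = rs (Re c) (re a) \<ominus> rs (Im c) (im a)"
    and "im (c \<odot> a) = rs (Re c) (im a) \<oplus> rs (Im c) (re a)"
proof -
  have e: "c \<odot> a = (rs (Re c) (re a) \<ominus> rs (Im c) (im a)) \<oplus> \<i> \<odot> (rs (Re c) (im a) \<oplus> rs (Im c) (re a))"
    using smult_re_im[OF re_sa[OF a] im_sa[OF a], of c] re_im[OF a] by simp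
  have s: "rs (Re c) (re a) \<ominus> rs (Im c) (im a) \<in> sa A" "rs (Re c) (im a) \<oplus> rs (Im c) (re a) \<in> sa A"
    by (intro sa_add sa_diff sa_smult re_sa im_sa a)+
  show "re (c \<odot> a) = rs (Re c) (re a) \<ominus> rs (Im c) (im a)"
    "im (c \<odot> a) = rs (Re c) (im a) \<oplus> rs (Im c) (re a)"
    unfolding e by (rule re_im_unique[OF s])+
qed

lemma re_im_of_sa: "u \<in> sa A \<Longrightarrow> re u = u \<and> im u = \<zero>"
  using re_im_unique[of u \<zero>] by simp

section \<open>States: bounds, existence and weak* compactness\<close>

lemma statesD:
  assumes "\<phi> \<in> states A"
  shows "\<lbrakk>x \<in> carrier A; y \<in> carrier A\<rbrakk> \<Longrightarrow> \<phi> (x \<oplus> y) = \<phi> x + \<phi> y"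
    and "x \<in> carrier A \<Longrightarrow> \<phi> (c \<odot> x) = c * \<phi> x"
    and "pos p \<Longrightarrow> \<phi> p \<in> \<real>\<^sub>\<ge>\<^sub>0"
    and "\<phi> \<one> = 1"
  using assms by (auto simp: states_def positive_cone_iff)

lemma states_diff: "\<lbrakk>\<phi> \<in> states A; x \<in> carrier A; y \<in> carrier A\<rbrakk> \<Longrightarrow> \<phi> (x \<ominus> y) = \<phi> x - \<phi> y"
  using statesD(1)[of \<phi> x "(-1) \<odot> y"] statesD(2)[of \<phi> y "-1"] by (simp add: minus_eq smult_uminus_l)

text \<open>With t the norm of \<open>a\<close>, both t - a and t + a are positive, so both t -
  \<phi>(a) and t + \<phi>(a) are nonnegative reals.\<close>

lemma states_sa:
  assumes \<phi>: "\<phi> \<in> states A" and a: "a \<in> sa A"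
  shows "\<phi> a \<in> \<real>" and "cmod (\<phi> a) \<le> cnorm A a"
proof -
  let ?t = "cnorm A a"
  have "\<phi> (sc ?t \<ominus> a) \<in> \<real>\<^sub>\<ge>\<^sub>0" "\<phi> (sc ?t \<oplus> a) \<in> \<real>\<^sub>\<ge>\<^sub>0"
    by (intro statesD(3)[OF \<phi>] pos_sc_minus pos_sc_plus a order_refl)+
  then have *: "of_real ?t - \<phi> a \<in> \<real>\<^sub>\<ge>\<^sub>0" "of_real ?t + \<phi> a \<in> \<real>\<^sub>\<ge>\<^sub>0"
    using a by (simp_all add: states_diff[OF \<phi>] statesD[OF \<phi>])
  then show r: "\<phi> a \<in> \<real>" by (simp add: complex_nonneg_Reals_iff complex_is_Real_iff)
  with * show "cmod (\<phi> a) \<le> ?t"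
    by (auto simp: complex_nonneg_Reals_iff norm_complex_def complex_is_Real_iff)
qed

text \<open>The factor 2 comes from treating real and imaginary parts separately; any bound
  independent of the state suffices for compactness.\<close>

lemma states_bound:
  assumes \<phi>: "\<phi> \<in> states A" and a: "a \<in> carrier A"
  shows "cmod (\<phi> a) \<le> 2 * cnorm A a"
proof -
  have "\<phi> a = \<phi> (re a) + \<i> * \<phi> (im a)"
    using statesD(1)[OF \<phi>, of "re a" "\<i> \<odot> im a"] statesD(2)[OF \<phi>, of "im a" \<i>] a by (simp add: re_im)
  then have "cmod (\<phi> a) \<le> cmod (\<phi> (re a)) + cmod (\<phi> (im a))"
    using norm_triangle_ineq[of "\<phi> (re a)" "\<i> * \<phi> (im a)"] by (simp add: norm_mult)
  also have "\<dots> \<le> cnorm A a + cnorm A a"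
    using states_sa(2)[OF \<phi> re_sa[OF a]] states_sa(2)[OF \<phi> im_sa[OF a]] cnorm_re[OF a] cnorm_im[OF a]
    by linarith
  finally show ?thesis by simp
qed

text \<open>The real functional from Hahn-Banach is extended complex linearly through
  \<open>re\<close> and \<open>im\<close>. Positivity holds because the gauge of the negative of a
  positive element is at most 0.\<close>

lemma state_attaining_gauge:
  assumes ne: "\<one> \<noteq> \<zero>" and d: "d \<in> sa A"
  obtains \<phi> where "\<phi> \<in> states A" "\<phi> d = complex_of_real (gauge d)"
proof -
  obtain f where add: "\<And>a b. \<lbrakk>a \<in> sa A; b \<in> sa A\<rbrakk> \<Longrightarrow> f (a \<oplus> b) = f a + f b"
    and smult: "\<And>a t. a \<in> sa A \<Longrightarrow> f (rs t a) = t * f a"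
    and le: "\<And>a. f a \<le> gauge a" and fd: "f d = gauge d"
    using linear_below_sublinear[OF gauge_sublinear[OF ne] d] by metis
  have neg: "f (\<ominus> a) = - f a" if "a \<in> sa A" for a
    using smult[OF that, of "-1"] that by (simp add: smult_uminus_l)
  have diff: "f (a \<ominus> b) = f a - f b" if "a \<in> sa A" "b \<in> sa A" for a b
    using add[of a "\<ominus> b"] neg[of b] that by (simp add: minus_eq sa_uminus)
  have f0: "f \<zero> = 0" using smult[of \<zero> 0] by simp
  define \<phi> where "\<phi> = (\<lambda>a. if a \<in> carrier A then Complex (f (re a)) (f (im a)) else undefined)"
  have sa: "\<phi> a = complex_of_real (f a)" if "a \<in> sa A" for a
    using that re_im_of_sa[OF that] by (simp add: \<phi>_def f0 complex_of_real_def)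
  have pos: "0 \<le> f a" if "pos a" for a
  proof -
    have "\<zero> \<ominus> (\<ominus> a) = a" using that by (simp add: minus_eq)
    then have "gauge (\<ominus> a) \<le> 0"
      using that by (intro gauge_le ne sa_uminus pos_sa) simp_all
    then show ?thesis using le[of "\<ominus> a"] neg[OF pos_sa[OF that]] by simp
  qed
  \<comment> \<open>The gauge at the unit and at its negative squeezes the functional from both
    sides, so it is unital.\<close>
  have "\<one> \<ominus> \<one> = \<zero>" "\<zero> = sc (- 1) \<ominus> \<ominus> \<one>" by (simp_all add: smult_uminus_l)
  then have "gauge \<one> \<le> 1" "gauge (\<ominus> \<one>) \<le> - 1"
    using gauge_le[OF ne sa_one, of 1] gauge_le[OF ne sa_uminus[OF sa_one], of "-1"] pos_zero by simp_all
  then have f1: "f \<one> = 1" using le[of \<one>] le[of "\<ominus> \<one>"] neg[of \<one>] by simp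
  have "\<phi> \<in> states A"
    unfolding states_def
  proof (intro CollectI conjI ballI allI)
    show "\<phi> \<in> extensional (carrier A)" by (simp add: \<phi>_def extensional_def)
    show "\<phi> (x \<oplus> y) = \<phi> x + \<phi> y" if "x \<in> carrier A" "y \<in> carrier A" for x y
      using that by (simp add: \<phi>_def re_im_add add re_sa im_sa complex_eq_iff)
    show "\<phi> (c \<odot> x) = c * \<phi> x" if "x \<in> carrier A" for c x
      using that by (simp add: \<phi>_def re_im_smult add diff smult re_sa im_sa sa_smult complex_eq_iff)
    show "\<phi> p \<in> \<real>\<^sub>\<ge>\<^sub>0" if "p \<in> positive_cone A" for p
      using that pos[of p] sa[OF pos_sa] by (simp add: positive_cone_iff complex_nonneg_Reals_iff)
    show "\<phi> \<one> = 1" using sa[of \<one>] f1 by simp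
  qed
  moreover have "\<phi> d = complex_of_real (gauge d)" using sa[OF d] fd by simp
  ultimately show thesis by (rule that)
qed

text \<open>The bound passes to the gauges of \<open>d\<close> and of its negative, since both are
  attained by states; then r + e plus or minus \<open>d\<close> is positive and
  \<open>cnorm_le_pos\<close> applies. The zero algebra has no states and is treated apart.\<close>

lemma cnorm_le_states:
  assumes d: "d \<in> sa A" and r: "0 \<le> r" and *: "\<And>\<phi>. \<phi> \<in> states A \<Longrightarrow> cmod (\<phi> d) \<le> r"
  shows "cnorm A d \<le> r"
proof (cases "\<one> = \<zero>")
  case True
  have "d = d \<otimes> \<one>" using d by simp
  also have "\<dots> = \<zero>" using d by (simp add: True)
  finally show ?thesis using r by simp
next
  case ne: False
  have g: "gauge a \<le> r" if "a = d \<or> a = \<ominus> d" for a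
  proof -
    have a: "a \<in> sa A" using that d sa_uminus by blast
    obtain \<phi> where \<phi>: "\<phi> \<in> states A" "\<phi> a = complex_of_real (gauge a)"
      using state_attaining_gauge[OF ne a] .
    have "cmod (\<phi> a) = cmod (\<phi> d)"
      using that statesD(2)[OF \<phi>(1), of d "-1"] d by (auto simp: smult_uminus_l)
    then have "\<bar>gauge a\<bar> \<le> r" using \<phi> *[OF \<phi>(1)] by simp
    then show ?thesis by simp
  qed
  have "cnorm A d \<le> r + e" if e: "0 < e" for e
  proof (rule cnorm_le_pos[OF d])
    show "pos (sc (r + e) \<ominus> d)" using g[of d] e by (intro gauge_less ne d) auto
    have "pos (sc (r + e) \<ominus> \<ominus> d)" using g[of "\<ominus> d"] e by (intro gauge_less ne d sa_uminus) auto
    then show "pos (sc (r + e) \<oplus> d)" using d by (simp add: minus_eq)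
  qed (use r e in simp)
  then show ?thesis by (rule field_le_epsilon)
qed

text \<open>Banach-Alaoglu: the states sit in a product of closed discs, compact by Tychonoff, and
  form a closed subset. The family \<open>S\<close> lists the defining conditions, each closed
  because it involves finitely many coordinates.\<close>

lemma compact_weak_star: "compact_space (weak_star A)"
proof -
  let ?X = "product_topology (\<lambda>_. euclidean :: complex topology) (carrier A)"
  have pr: "continuous_map ?X euclidean (\<lambda>\<phi>. \<phi> x)" if "x \<in> carrier A" for x
    using continuous_map_product_projection[OF that, of "\<lambda>_. euclidean"] .
  have cl: "closedin ?X {\<phi> \<in> topspace ?X. f \<phi> \<in> C}"
    if "continuous_map ?X euclidean f" "closed C" for f :: "_ \<Rightarrow> complex" and C
    using closedin_continuous_map_preimage[OF that(1)] that(2) by simp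
  have top: "topspace ?X = extensional (carrier A)" by (simp add: PiE_UNIV_domain PiE_def)
  define S where "S = {{\<phi> \<in> topspace ?X. \<phi> (x \<oplus> y) - \<phi> x - \<phi> y \<in> {0}} | x y. x \<in> carrier A \<and> y \<in> carrier A}
    \<union> {{\<phi> \<in> topspace ?X. \<phi> (c \<odot> x) - c * \<phi> x \<in> {0}} | c x. x \<in> carrier A}
    \<union> {{\<phi> \<in> topspace ?X. \<phi> p \<in> \<real>\<^sub>\<ge>\<^sub>0} | p. p \<in> positive_cone A}
    \<union> {{\<phi> \<in> topspace ?X. \<phi> \<one> \<in> {1}}}"
  have mult: "continuous_map ?X euclidean (\<lambda>\<phi>. c * \<phi> x)" if "x \<in> carrier A" for c x
  proof -
    have "continuous_map euclidean euclidean (\<lambda>z :: complex. c * z)"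
      by (simp add: continuous_map_iff_continuous2 continuous_on_mult_left)
    from continuous_map_compose[OF pr[OF that] this] show ?thesis by (simp add: o_def)
  qed
  have "closedin ?X T" if "T \<in> S" for T
    using that unfolding S_def
  proof (elim UnE CollectE exE conjE, goal_cases)
    case (1 x y)
    then show ?case
      by (simp only:) (intro cl continuous_map_diff pr a_closed; simp)
  next
    case (2 c x)
    then show ?case by (simp only:) (intro cl continuous_map_diff pr mult smult_in; simp)
  next
    case (3 p)
    then show ?case by (simp only: positive_cone_iff) (intro cl pr pos_in; simp)
  next
    case 4
    then have "T = {\<phi> \<in> topspace ?X. \<phi> \<one> \<in> {1}}" by simp
    then show ?case by (simp only:) (intro cl pr one_closed; simp)
  qed
  then have "closedin ?X (\<Inter>S)" by (intro closedin_Inter) (auto simp: S_def)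
  moreover have "states A = \<Inter>S"
  proof (intro equalityI subsetI InterI)
    fix \<phi> T assume "\<phi> \<in> states A" "T \<in> S"
    then show "\<phi> \<in> T"
      unfolding S_def by (elim UnE CollectE exE conjE) (simp_all add: states_def PiE_UNIV_domain PiE_def)
  next
    fix \<phi> assume \<phi>: "\<phi> \<in> \<Inter>S"
    have 0: "{\<phi> \<in> topspace ?X. \<phi> \<one> \<in> {1}} \<in> S" by (simp add: S_def)
    have 1: "{\<phi> \<in> topspace ?X. \<phi> (x \<oplus> y) - \<phi> x - \<phi> y \<in> {0}} \<in> S"
      if "x \<in> carrier A" "y \<in> carrier A" for x y unfolding S_def using that by blast
    have 2: "{\<phi> \<in> topspace ?X. \<phi> (c \<odot> x) - c * \<phi> x \<in> {0}} \<in> S"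
      if "x \<in> carrier A" for c x unfolding S_def using that by blast
    have 3: "{\<phi> \<in> topspace ?X. \<phi> p \<in> \<real>\<^sub>\<ge>\<^sub>0} \<in> S" if "p \<in> positive_cone A" for p
      unfolding S_def using that by blast
    show "\<phi> \<in> states A"
      unfolding states_def
      using InterD[OF \<phi> 0] InterD[OF \<phi> 1] InterD[OF \<phi> 2] InterD[OF \<phi> 3]
      by (simp add: PiE_UNIV_domain PiE_def algebra_simps)
  qed
  ultimately have closed: "closedin ?X (states A)" by simp
  have "states A \<subseteq> PiE (carrier A) (\<lambda>a. cball 0 (2 * cnorm A a))"
    using states_bound by (auto simp: PiE_def states_def)
  moreover have "compactin ?X (PiE (carrier A) (\<lambda>a. cball 0 (2 * cnorm A a)))"
    by (simp add: compactin_PiE)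
  ultimately have "compactin ?X (states A)" using closed by (metis closed_compactin)
  then show ?thesis unfolding weak_star_def by (rule compact_space_subtopology)
qed

end

section \<open>Unital star-homomorphisms are positive and contractive\<close>

locale unital_star_hom = A: unital_cstar_algebra A + B: unital_cstar_algebra B
  for A :: "('a, 'm) cstar_scheme" and B :: "('b, 'n) cstar_scheme" +
  fixes p :: "'a \<Rightarrow> 'b"
  assumes star_hom: "star_hom A B p" and unital: "p \<one>\<^bsub>A\<^esub> = \<one>\<^bsub>B\<^esub>"
begin

lemma hom_in [simp]: "x \<in> carrier A \<Longrightarrow> p x \<in> carrier B"
  using star_hom unfolding star_hom_def linear_map_def by blast

lemma hom_add: "\<lbrakk>x \<in> carrier A; y \<in> carrier A\<rbrakk> \<Longrightarrow> p (x \<oplus>\<^bsub>A\<^esub> y) = p x \<oplus>\<^bsub>B\<^esub> p y"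
  and hom_smult: "x \<in> carrier A \<Longrightarrow> p (c \<odot>\<^bsub>A\<^esub> x) = c \<odot>\<^bsub>B\<^esub> p x"
  and hom_mult: "\<lbrakk>x \<in> carrier A; y \<in> carrier A\<rbrakk> \<Longrightarrow> p (x \<otimes>\<^bsub>A\<^esub> y) = p x \<otimes>\<^bsub>B\<^esub> p y"
  and hom_star: "x \<in> carrier A \<Longrightarrow> p (star A x) = star B (p x)"
  using star_hom unfolding star_hom_def linear_map_def by blast+

lemma hom_diff: "\<lbrakk>x \<in> carrier A; y \<in> carrier A\<rbrakk> \<Longrightarrow> p (x \<ominus>\<^bsub>A\<^esub> y) = p x \<ominus>\<^bsub>B\<^esub> p y"
  using hom_add[of x "(-1) \<odot>\<^bsub>A\<^esub> y"] hom_smult[of y "-1"]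
  by (simp add: A.minus_eq B.minus_eq A.smult_uminus_l B.smult_uminus_l)

lemma hom_sa: "x \<in> sa A \<Longrightarrow> p x \<in> sa B"
  using hom_star[of x] hom_in[of x] by (simp only: A.sa_iff B.sa_iff)

lemma hom_pos: "A.pos h \<Longrightarrow> B.pos (p h)"
proof -
  assume "A.pos h"
  then obtain k where "k \<in> sa A" "k \<otimes>\<^bsub>A\<^esub> k = h" using A.pos_sqrt by metis
  then show ?thesis using B.pos_square[OF hom_sa] hom_mult[of k k] by auto
qed

text \<open>On self-adjoint elements contractivity follows by transporting the positivity of t - d
  and t + d; the C*-identity gives the rest.\<close>

lemma cnorm_hom: "x \<in> carrier A \<Longrightarrow> cnorm B (p x) \<le> cnorm A x"
proof -
  have sa: "cnorm B (p d) \<le> cnorm A d" if d: "d \<in> sa A" for d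
  proof (rule B.cnorm_le_pos[OF hom_sa[OF d]])
    show "0 \<le> cnorm A d" using d by (simp add: A.cnorm_nonneg)
    have s: "p (A.sc t) = B.sc t" for t by (simp add: hom_smult unital)
    show "B.pos (B.sc (cnorm A d) \<ominus>\<^bsub>B\<^esub> p d)"
      using hom_pos[OF A.pos_sc_minus[OF d order_refl]] d by (simp add: hom_diff s)
    show "B.pos (B.sc (cnorm A d) \<oplus>\<^bsub>B\<^esub> p d)"
      using hom_pos[OF A.pos_sc_plus[OF d order_refl]] d by (simp add: hom_add s)
  qed
  assume x: "x \<in> carrier A"
  have "(cnorm B (p x))\<^sup>2 = cnorm B (p (star A x \<otimes>\<^bsub>A\<^esub> x))"
    using x B.cstar_identity[of "p x"] by (simp add: hom_mult hom_star)
  also have "\<dots> \<le> (cnorm A x)\<^sup>2"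
    using sa[OF A.star_mult_self_sa[OF x]] A.cstar_identity[OF x] by simp
  finally show ?thesis using A.cnorm_nonneg[OF x] power2_le_imp_le by blast
qed

end

text \<open>The image of the unit acts as a unit on the range. Quantum isometries are surjective, so
  they need not be assumed unital.\<close>

lemma star_hom_onto_unital:
  assumes A: "unital_cstar_algebra A" and B: "unital_cstar_algebra B"
    and p: "star_hom A B p" and onto: "p ` carrier A = carrier B"
  shows "unital_star_hom A B p"
proof -
  interpret A: unital_cstar_algebra A by (rule A)
  interpret B: unital_cstar_algebra B by (rule B)
  have m: "p (x \<otimes>\<^bsub>A\<^esub> y) = p x \<otimes>\<^bsub>B\<^esub> p y" if "x \<in> carrier A" "y \<in> carrier A" for x y
    using p that unfolding star_hom_def by blast
  obtain x where x: "x \<in> carrier A" "p x = \<one>\<^bsub>B\<^esub>" using onto B.one_closed by (metis imageE)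
  have "p \<one>\<^bsub>A\<^esub> \<in> carrier B" using onto A.one_closed by blast
  then have "p \<one>\<^bsub>A\<^esub> = p \<one>\<^bsub>A\<^esub> \<otimes>\<^bsub>B\<^esub> p x" using x by simp
  also have "\<dots> = p (\<one>\<^bsub>A\<^esub> \<otimes>\<^bsub>A\<^esub> x)"
    by (rule m[symmetric]) (rule A.one_closed, rule x(1))
  finally have "p \<one>\<^bsub>A\<^esub> = \<one>\<^bsub>B\<^esub>" using x by simp
  with A B p show ?thesis by (simp add: unital_star_hom_def unital_star_hom_axioms_def)
qed

section \<open>Ultrafilters and Lipschitz balls\<close>

text \<open>Ultrafilters are the minimal proper filters. Staying below \<open>sequentially\<close>
  makes the ultrafilter non-principal and lets ordinary limits pass to it.\<close>

lemma ultrafilter_exists: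
  obtains U :: "nat filter" where "U \<le> sequentially" "U \<noteq> bot"
    "\<And>P. eventually P U \<or> eventually (\<lambda>n. \<not> P n) U"
proof -
  let ?S = "{F :: nat filter. F \<le> sequentially \<and> F \<noteq> bot}" and ?P = "\<lambda>F G :: nat filter. G \<le> F"
  have "\<exists>U\<in>?S. \<forall>F\<in>?S. ?P U F \<longrightarrow> F = U"
  proof (rule predicate_Zorn)
    show "partial_order_on ?S (relation_of ?P ?S)"
      by (rule partial_order_on_relation_ofI) auto
    fix C assume C: "C \<in> Chains (relation_of ?P ?S)"
    then have CS: "C \<subseteq> ?S" by (rule Chains_relation_of)
    show "\<exists>u\<in>?S. \<forall>a\<in>C. ?P a u"
    proof (cases "C = {}")
      case True
      then show ?thesis by (intro bexI[of _ sequentially]) auto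
    next
      case False
      \<comment> \<open>For a chain, a property holding eventually along the infimum already does so
        along a member; hence the infimum is still proper.\<close>
      have "eventually P (Inf C) \<longleftrightarrow> (\<exists>F\<in>C. eventually P F)" for P
      proof (rule eventually_Inf_base[OF False])
        fix F G assume "F \<in> C" "G \<in> C"
        then have "F \<le> G \<or> G \<le> F" using C unfolding Chains_def relation_of_def by blast
        then show "\<exists>x\<in>C. x \<le> inf F G" using \<open>F \<in> C\<close> \<open>G \<in> C\<close> by (auto simp: le_infI)
      qed
      then have "Inf C \<noteq> bot" using CS unfolding trivial_limit_def by blast
      moreover have "Inf C \<le> sequentially"
      proof -
        obtain F where "F \<in> C" using False by blast
        then show ?thesis using CS Inf_lower[of F C] order_trans by blast
      qed
      ultimately show ?thesis using Inf_lower by blast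
    qed
  qed
  then obtain U where U: "U \<le> sequentially" "U \<noteq> bot" and
    min: "\<And>F. F \<le> sequentially \<Longrightarrow> F \<noteq> bot \<Longrightarrow> F \<le> U \<Longrightarrow> F = U" by blast
  have "eventually P U \<or> eventually (\<lambda>n. \<not> P n) U" for P
  \<comment> \<open>Restricting to the set where \<open>P\<close> holds yields either no proper
    filter, so that \<open>P\<close> fails eventually, or by minimality the same filter, so that
    \<open>P\<close> holds eventually.\<close>
  proof (cases "inf U (principal {n. P n}) = bot")
    case True
    then have "eventually (\<lambda>_. False) (inf U (principal {n. P n}))" by simp
    then show ?thesis by (simp add: eventually_inf_principal)
  next
    case False
    have "inf U (principal {n. P n}) = U" using U False by (intro min) (auto intro: le_infI1)
    moreover have "eventually P (inf U (principal {n. P n}))" by (simp add: eventually_inf_principal)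
    ultimately show ?thesis by simp
  qed
  with U that show thesis by blast
qed

text \<open>Compactness supplies a cluster point, and an ultrafilter converges to each of its
  cluster points: it cannot meet both a neighbourhood and its complement.\<close>

lemma ultrafilter_compact_limit:
  fixes f :: "nat \<Rightarrow> 'b::topological_space"
  assumes ultra: "U \<noteq> bot" "\<And>P. eventually P U \<or> eventually (\<lambda>n. \<not> P n) U"
    and K: "compact K" and f: "eventually (\<lambda>n. f n \<in> K) U"
  shows "\<exists>l\<in>K. (f \<longlongrightarrow> l) U"
proof -
  have "filtermap f U \<noteq> bot" using ultra(1) by (simp add: filtermap_bot_iff)
  moreover have "eventually (\<lambda>x. x \<in> K) (filtermap f U)" using f by (simp add: eventually_filtermap)
  ultimately obtain l where l: "l \<in> K" "inf (nhds l) (filtermap f U) \<noteq> bot"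
    using K unfolding compact_filter by blast
  have "(f \<longlongrightarrow> l) U"
  proof (rule topological_tendstoI, rule ccontr)
    fix S assume S: "open S" "l \<in> S" and "\<not> eventually (\<lambda>n. f n \<in> S) U"
    then have "eventually (\<lambda>n. f n \<notin> S) U" using ultra(2) by blast
    then have "eventually (\<lambda>x. x \<notin> S) (filtermap f U)" by (simp add: eventually_filtermap)
    then have "eventually (\<lambda>x. x \<notin> S) (inf (nhds l) (filtermap f U))" by (rule filter_leD[OF inf_le2])
    moreover have "eventually (\<lambda>x. x \<in> S) (inf (nhds l) (filtermap f U))"
      using eventually_nhds_in_open[OF S] by (rule filter_leD[OF inf_le1])
    ultimately have "eventually (\<lambda>_. False) (inf (nhds l) (filtermap f U))"
      by eventually_elim simp
    with l(2) show False by (simp add: trivial_limit_def)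
  qed
  with l show ?thesis by blast
qed

context unital_cstar_algebra
begin

text \<open>Reduces convergence along a filter to sequential completeness by picking one index
  \<open>s k\<close> deep enough for each precision.\<close>

lemma filter_Cauchy_limit:
  fixes U :: "nat filter"
  assumes U: "U \<noteq> bot"
    and cauchy: "\<And>e. 0 < e \<Longrightarrow> \<exists>G. eventually (\<lambda>n. n \<in> G) U \<and> (\<forall>n\<in>G. a n \<in> carrier A) \<and>
      (\<forall>n\<in>G. \<forall>m\<in>G. cnorm A (a n \<ominus> a m) \<le> e)"
  obtains b where "b \<in> carrier A" "((\<lambda>n. cnorm A (a n \<ominus> b)) \<longlongrightarrow> 0) U"
proof -
  define e :: "nat \<Rightarrow> real" where "e k = 1 / Suc k" for k
  have e0: "0 < e k" for k by (simp add: e_def)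
  obtain G where G: "\<And>k. eventually (\<lambda>n. n \<in> G k) U" "\<And>k n. n \<in> G k \<Longrightarrow> a n \<in> carrier A"
    "\<And>k n m. n \<in> G k \<Longrightarrow> m \<in> G k \<Longrightarrow> cnorm A (a n \<ominus> a m) \<le> e k"
    using cauchy[OF e0] by metis
  \<comment> \<open>The sets \<open>G j\<close> need not be nested, so an index common to the first
    k + 1 of them is required.\<close>
  have "\<exists>n. \<forall>j\<le>k. n \<in> G j" for k
  proof -
    have "eventually (\<lambda>n. \<forall>j\<in>{..k}. n \<in> G j) U"
      using G(1) by (intro eventually_ball_finite) auto
    then show ?thesis using U eventually_happens'[OF U] by fastforce
  qed
  then obtain s where s: "\<And>k j. j \<le> k \<Longrightarrow> s k \<in> G j" by metis
  have c: "a (s k) \<in> carrier A" for k using G(2) s by blast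
  have d: "cnorm A (a (s m) \<ominus> a (s n)) \<le> e N" if "N \<le> m" "N \<le> n" for m n N
    using G(3) s that by blast
  have "\<exists>N. \<forall>m\<ge>N. \<forall>n\<ge>N. cnorm A (a (s m) \<ominus> a (s n)) < r" if r: "0 < r" for r
  proof -
    obtain N where "e N < r" using reals_Archimedean[OF r] by (auto simp: e_def inverse_eq_divide)
    then show ?thesis using d le_less_trans by blast
  qed
  then obtain b where b: "b \<in> carrier A" "(\<lambda>n. cnorm A (a (s n) \<ominus> b)) \<longlonglongrightarrow> 0"
    using complete_sequence[of "\<lambda>k. a (s k)"] c by blast
  have lim: "cnorm A (a (s k) \<ominus> b) \<le> e k" for k
  proof (rule tendsto_lowerbound)
    show "((\<lambda>n. e k + cnorm A (a (s n) \<ominus> b)) \<longlongrightarrow> e k) sequentially"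
      using tendsto_add[OF tendsto_const[of "e k"] b(2)] by simp
    show "eventually (\<lambda>n. cnorm A (a (s k) \<ominus> b) \<le> e k + cnorm A (a (s n) \<ominus> b)) sequentially"
      using eventually_ge_at_top[of k]
    proof eventually_elim
      case (elim n)
      then show ?case
        using d[of k k n] cnorm_diff_triangle[OF c[of k] c[of n] b(1)] by simp
    qed
  qed simp
  have "((\<lambda>n. cnorm A (a n \<ominus> b)) \<longlongrightarrow> 0) U"
  proof (rule tendstoI)
    fix r :: real assume "0 < r"
    then obtain k where k: "2 * e k < r"
      using reals_Archimedean[of "r / 2"] by (auto simp: e_def inverse_eq_divide field_simps)
    show "eventually (\<lambda>n. dist (cnorm A (a n \<ominus> b)) 0 < r) U"
      using G(1)[of k]
    proof eventually_elim
      case (elim n)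
      then have "cnorm A (a n \<ominus> b) \<le> e k + e k"
        using cnorm_diff_triangle[OF G(2)[OF elim] c[of k] b(1)] G(3)[OF elim s[OF order_refl]] lim[of k]
        by linarith
      then show ?case using k cnorm_nonneg[of "a n \<ominus> b"] G(2)[OF elim] b(1) by simp
    qed
  qed
  with b that show thesis by blast
qed

end

text \<open>The seminorm vanishes on scalars, so only the additional norm bound yields a totally
  bounded set.\<close>

definition lip_ball :: "('a, 'm) qcms_scheme \<Rightarrow> real \<Rightarrow> real \<Rightarrow> 'a set" where
  "lip_ball M l r = {a \<in> sa M. lip M a \<le> ennreal l \<and> cnorm M a \<le> r}"

lemma lip_ballD:
  assumes "a \<in> lip_ball M l r"
  shows "a \<in> sa M" "lip M a \<le> ennreal l" "cnorm M a \<le> r" "a \<in> ldom M"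
  using assms by (auto simp: lip_ball_def ldom_def intro: order.strict_trans1)

lemma lip_ball_mono: "\<lbrakk>a \<in> lip_ball M l r; l \<le> l'; r \<le> r'\<rbrakk> \<Longrightarrow> a \<in> lip_ball M l' r'"
  by (auto simp: lip_ball_def intro: order_trans ennreal_leI)

context quasi_leibniz_qcms
begin

lemma lip_scalar: "lip M (sc t) = 0" and scalar_ldom: "sc t \<in> ldom M"
  using lip_kernel by blast+

lemma lip_zero: "lip M \<zero> = 0"
  using lip_scalar[of 0] by simp

lemma lip_ball_add:
  assumes a: "a \<in> lip_ball M l r" and b: "b \<in> lip_ball M l' r'" and l: "0 \<le> l" "0 \<le> l'"
  shows "a \<oplus> b \<in> lip_ball M (l + l') (r + r')"
proof -
  have "lip M (a \<oplus> b) \<le> lip M a + lip M b" using lip_add lip_ballD[OF a] lip_ballD[OF b] by blast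
  also have "\<dots> \<le> ennreal l + ennreal l'" using lip_ballD[OF a] lip_ballD[OF b] by (intro add_mono)
  finally have "lip M (a \<oplus> b) \<le> ennreal (l + l')" using l by simp
  moreover have "cnorm M (a \<oplus> b) \<le> r + r'"
    using cnorm_add[of a b] lip_ballD[OF a] lip_ballD[OF b] by simp
  ultimately show ?thesis using lip_ballD[OF a] lip_ballD[OF b] by (simp add: lip_ball_def sa_add)
qed

lemma lip_ball_smult:
  assumes a: "a \<in> lip_ball M l r" and l: "0 \<le> l"
  shows "rs t a \<in> lip_ball M (\<bar>t\<bar> * l) (\<bar>t\<bar> * r)"
proof -
  have "lip M (rs t a) = ennreal \<bar>t\<bar> * lip M a" using lip_smult lip_ballD[OF a] by blast
  also have "\<dots> \<le> ennreal \<bar>t\<bar> * ennreal l" using lip_ballD[OF a] by (intro mult_left_mono) auto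
  finally have "lip M (rs t a) \<le> ennreal (\<bar>t\<bar> * l)" using l by (simp add: ennreal_mult)
  then show ?thesis
    using lip_ballD[OF a] by (simp add: lip_ball_def sa_smult cnorm_smult mult_left_mono)
qed

lemma lip_ball_diff:
  assumes a: "a \<in> lip_ball M l r" and b: "b \<in> lip_ball M l' r'" and l: "0 \<le> l" "0 \<le> l'"
  shows "a \<ominus> b \<in> lip_ball M (l + l') (r + r')"
  using lip_ball_add[OF a lip_ball_smult[OF b l(2), of "-1"] l(1)] l lip_ballD[OF b]
  by (simp add: minus_eq smult_uminus_l)

lemma lip_ball_one: "\<lbrakk>0 \<le> l; 1 \<le> r\<rbrakk> \<Longrightarrow> \<one> \<in> lip_ball M l r"
  using lip_scalar[of 1] cnorm_one_le by (simp add: lip_ball_def)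

lemma lip_ball_zero: "\<lbrakk>0 \<le> l; 0 \<le> r\<rbrakk> \<Longrightarrow> \<zero> \<in> lip_ball M l r"
  by (simp add: lip_ball_def lip_zero)

lemma cnorm_jordan: "\<lbrakk>a \<in> carrier M; b \<in> carrier M\<rbrakk> \<Longrightarrow> cnorm M (jordan M a b) \<le> cnorm M a * cnorm M b"
  using cnorm_add[of "a \<otimes> b" "b \<otimes> a"] cnorm_mult[of a b] cnorm_mult[of b a] mult.commute[of "cnorm M b" "cnorm M a"]
  by (simp add: jordan_def cnorm_smult)

lemma cnorm_lie: "\<lbrakk>a \<in> carrier M; b \<in> carrier M\<rbrakk> \<Longrightarrow> cnorm M (lie M a b) \<le> cnorm M a * cnorm M b"
  using cnorm_diff[of "a \<otimes> b" "b \<otimes> a"] cnorm_mult[of a b] cnorm_mult[of b a] mult.commute[of "cnorm M b" "cnorm M a"]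
  by (simp add: lie_def cnorm_smult norm_divide norm_mult)

text \<open>Recovers the product from the two operations that the quasi-Leibniz inequality
  controls.\<close>

lemma mult_jordan_lie:
  assumes "a \<in> carrier M" "b \<in> carrier M"
  shows "a \<otimes> b = jordan M a b \<oplus> \<i> \<odot> lie M a b"
proof -
  note c = m_closed[OF assms] m_closed[OF assms(2,1)]
  have "jordan M a b \<oplus> \<i> \<odot> lie M a b = (1/2) \<odot> ((a \<otimes> b \<oplus> b \<otimes> a) \<oplus> (a \<otimes> b \<ominus> b \<otimes> a))"
    using c by (simp add: jordan_def lie_def smult_assoc smult_add_r)
  also have "(a \<otimes> b \<oplus> b \<otimes> a) \<oplus> (a \<otimes> b \<ominus> b \<otimes> a) = a \<otimes> b \<oplus> a \<otimes> b" using c by algebra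
  finally show ?thesis using c by (simp add: double smult_assoc)
qed

text \<open>Rescaling by 1/l puts \<open>a\<close> among the test elements of \<open>mk\<close>;
  hence the requirement that \<open>l\<close> be strictly positive.\<close>

lemma mk_bound:
  assumes lin: "\<And>c x. x \<in> carrier M \<Longrightarrow> \<phi> (c \<odot> x) = c * \<phi> x" "\<And>c x. x \<in> carrier M \<Longrightarrow> \<psi> (c \<odot> x) = c * \<psi> x"
    and mk: "mk M \<phi> \<psi> \<le> ennreal x" and x: "0 \<le> x" and a: "a \<in> sa M" "lip M a \<le> ennreal l" and l: "0 < l"
  shows "cmod (\<phi> a - \<psi> a) \<le> l * x"
proof -
  let ?b = "rs (1 / l) a"
  have ad: "a \<in> ldom M" using a by (auto simp: ldom_def intro: order.strict_trans1)
  have "lip M ?b \<le> ennreal (1 / l) * ennreal l"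
    using lip_smult[OF ad, of "1 / l"] l a by (simp add: mult_left_mono)
  also have "\<dots> = 1" using l by (simp flip: ennreal_mult)
  finally have "?b \<in> {a \<in> ldom M. lip M a \<le> 1}" using ldom_smult[OF ad] by blast
  then have "ennreal (cmod (\<phi> ?b - \<psi> ?b)) \<le> mk M \<phi> \<psi>" unfolding mk_def by (rule SUP_upper)
  then have "ennreal (cmod (\<phi> ?b - \<psi> ?b)) \<le> ennreal x" using mk by simp
  then have "cmod (\<phi> ?b - \<psi> ?b) \<le> x" using x by simp
  moreover have "\<phi> ?b - \<psi> ?b = of_real (1 / l) * (\<phi> a - \<psi> a)"
    using lin a by (simp add: algebra_simps)
  ultimately have "cmod (\<phi> a - \<psi> a) / l \<le> x" using l by (simp add: norm_mult norm_divide)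
  then show ?thesis using l by (simp add: pos_divide_le_eq mult.commute)
qed

sublocale mkm: Metric_space "states M" "\<lambda>\<phi> \<psi>. enn2real (mk M \<phi> \<psi>)"
  by (rule mk_metric)

lemma mk_bound_states:
  assumes \<phi>: "\<phi> \<in> states M" and \<psi>: "\<psi> \<in> states M" and a: "a \<in> sa M" "lip M a \<le> ennreal l" and l: "0 < l"
  shows "cmod (\<phi> a - \<psi> a) \<le> l * enn2real (mk M \<phi> \<psi>)"
  using mk_finite[OF \<phi> \<psi>] by (intro mk_bound statesD \<phi> \<psi> a l) (auto simp: less_top)

text \<open>The metric \<open>mk\<close> induces the weak* topology, which is compact, and compact
  metric spaces are totally bounded.\<close>

lemma states_finite_net:
  assumes "0 < e"
  shows "\<exists>K. finite K \<and> K \<subseteq> states M \<and> (\<forall>\<psi>\<in>states M. \<exists>\<phi>\<in>K. enn2real (mk M \<phi> \<psi>) < e)"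
proof -
  have "compact_space mkm.mtopology" using compact_weak_star mk_metrizes by simp
  then have "mkm.mtotally_bounded (states M)"
    by (simp add: mkm.compactin_imp_mtotally_bounded compact_space_def)
  from this[unfolded mkm.mtotally_bounded_def, rule_format, OF assms]
  obtain K where K: "finite K" "K \<subseteq> states M" "states M \<subseteq> (\<Union>x\<in>K. mkm.mball x e)"
    by - (elim exE conjE, rule that)
  show ?thesis
  proof (intro exI[of _ K] conjI K ballI)
    fix \<psi> assume "\<psi> \<in> states M"
    with K(3) have "\<psi> \<in> (\<Union>x\<in>K. mkm.mball x e)" by (rule subsetD)
    then obtain \<phi> where \<phi>: "\<phi> \<in> K" "\<psi> \<in> mkm.mball \<phi> e" by (rule UN_E)
    from \<phi>(2) have "enn2real (mk M \<phi> \<psi>) < e" by (simp only: mkm.in_mball)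
    then show "\<exists>\<phi>\<in>K. enn2real (mk M \<phi> \<psi>) < e" by (rule bexI[OF _ \<phi>(1)])
  qed
qed

text \<open>Self-adjointness and the norm bound pass to the limit by the triangle inequality, the
  seminorm bound by lower semicontinuity.\<close>

lemma lip_ball_closed:
  assumes b: "b \<in> carrier M" and *: "\<And>e. 0 < e \<Longrightarrow> \<exists>a\<in>lip_ball M l r. cnorm M (a \<ominus> b) < e"
  shows "b \<in> lip_ball M l r"
proof -
  have "cnorm M (star M b \<ominus> b) \<le> 0 + e" if e: "0 < e" for e
  proof -
    obtain a where a: "a \<in> lip_ball M l r" "cnorm M (a \<ominus> b) < e / 2" using *[of "e/2"] e by auto
    note ac = sa_in[OF lip_ballD(1)[OF a(1)]]
    have "star M a = a" using lip_ballD(1)[OF a(1)] by (simp only: sa_iff)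
    then have "cnorm M (star M b \<ominus> a) = cnorm M (b \<ominus> a)"
      using cnorm_star[of "b \<ominus> a"] ac b by (simp add: star_diff)
    then show ?thesis
      using cnorm_diff_triangle[OF star_in[OF b] ac b] a(2) cnorm_diff_commute[OF ac b] by simp
  qed
  then have "cnorm M (star M b \<ominus> b) \<le> 0" by (rule field_le_epsilon)
  then have bs: "b \<in> sa M" using cnorm_diff_zero[OF star_in[OF b] b] b by (simp only: sa_iff)
  have "cnorm M b \<le> r + e" if e: "0 < e" for e
  proof -
    obtain a where a: "a \<in> lip_ball M l r" "cnorm M (a \<ominus> b) < e" using *[OF e] by auto
    note ac = sa_in[OF lip_ballD(1)[OF a(1)]]
    show ?thesis
      using cnorm_triangle_sub[OF b ac] cnorm_diff_commute[OF ac b] a(2) lip_ballD(3)[OF a(1)] by simp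
  qed
  then have "cnorm M b \<le> r" by (rule field_le_epsilon)
  moreover have "lip M b \<le> ennreal l"
  proof (rule ccontr)
    assume n: "\<not> lip M b \<le> ennreal l"
    let ?C = "{a \<in> sa M. lip M a \<le> ennreal l}"
    have top: "topspace (subtopology (ctop M) (sa M)) = sa M"
      unfolding ctop_def by (auto simp: metric.topspace_mtopology)
    have "openin (subtopology (ctop M) (sa M)) (sa M - ?C)"
      using lower_semicontinuous[of "ennreal l"] top unfolding closedin_def by simp
    then obtain T where T: "openin (ctop M) T" "sa M - ?C = T \<inter> sa M"
      unfolding openin_subtopology by blast
    have "b \<in> T" using T(2) bs n by blast
    then obtain e where e: "0 < e" "metric.mball b e \<subseteq> T"
      using T(1) unfolding ctop_def metric.openin_mtopology by blast
    obtain a where a: "a \<in> lip_ball M l r" "cnorm M (a \<ominus> b) < e" using *[OF e(1)] by auto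
    note ac = sa_in[OF lip_ballD(1)[OF a(1)]]
    have "a \<in> metric.mball b e"
      using a(2) ac b cnorm_diff_commute[OF ac b] by (simp add: cdist_def)
    then have "a \<in> sa M - ?C" using e(2) T(2) lip_ballD(1)[OF a(1)] by blast
    then show False using lip_ballD(2)[OF a(1)] by blast
  qed
  ultimately show ?thesis using bs by (simp add: lip_ball_def)
qed

text \<open>The compactness of Lipschitz balls, in ultrafilter form. Each state has an ultralimit on
  the sequence; finitely many states, dense up to a small \<open>mk\<close> distance, control all
  the others on the ball, so the sequence is Cauchy in norm along \<open>U\<close>.\<close>

lemma lip_ball_ultralimit:
  assumes ultra: "U \<noteq> bot" "\<And>P. eventually P U \<or> eventually (\<lambda>n. \<not> P n) U"
    and a: "eventually (\<lambda>n :: nat. a n \<in> lip_ball M l r) U" and l: "0 < l"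
  obtains b where "b \<in> lip_ball M l r" "((\<lambda>n. cnorm M (a n \<ominus> b)) \<longlongrightarrow> 0) U"
proof -
  have limit: "\<exists>z. ((\<lambda>n. \<phi> (a n)) \<longlongrightarrow> z) U" if \<phi>: "\<phi> \<in> states M" for \<phi>
  proof -
    have "\<phi> x \<in> cball 0 r" if "x \<in> lip_ball M l r" for x
      using states_sa(2)[OF \<phi> lip_ballD(1)[OF that]] lip_ballD(3)[OF that] by simp
    with a have "eventually (\<lambda>n. \<phi> (a n) \<in> cball 0 r) U" by (rule eventually_mono)
    then have "\<exists>z\<in>cball 0 r. ((\<lambda>n. \<phi> (a n)) \<longlongrightarrow> z) U"
      by (intro ultrafilter_compact_limit ultra compact_cball)
    then show ?thesis by (rule bexE) (rule exI)
  qed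
  define f :: "('a \<Rightarrow> complex) \<Rightarrow> complex" where "f \<phi> = (SOME z. ((\<lambda>n. \<phi> (a n)) \<longlongrightarrow> z) U)" for \<phi>
  have f: "((\<lambda>n. \<phi> (a n)) \<longlongrightarrow> f \<phi>) U" if "\<phi> \<in> states M" for \<phi>
    unfolding f_def by (rule someI_ex) (rule limit[OF that])
  obtain b where b: "b \<in> carrier M" "((\<lambda>n. cnorm M (a n \<ominus> b)) \<longlongrightarrow> 0) U"
  proof (rule filter_Cauchy_limit[OF ultra(1), of a])
    fix e :: real assume e: "0 < e"
    \<comment> \<open>A state at \<open>mk\<close> distance below e/(4l) differs by at most e/4 on
      the ball. Two such errors and two deviations from \<open>f\<close> add up to e.\<close>
    have "0 < e / (4 * l)" using e l by simp
    from states_finite_net[OF this] obtain K where K: "finite K" "K \<subseteq> states M"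
      "\<forall>\<psi>\<in>states M. \<exists>\<phi>\<in>K. enn2real (mk M \<phi> \<psi>) < e / (4 * l)" by blast
    define G where "G = {n. a n \<in> lip_ball M l r \<and> (\<forall>\<phi>\<in>K. dist (\<phi> (a n)) (f \<phi>) < e / 4)}"
    have "eventually (\<lambda>n. \<forall>\<phi>\<in>K. dist (\<phi> (a n)) (f \<phi>) < e / 4) U"
      using K f e by (intro eventually_ball_finite ballI tendstoD) auto
    with a have "eventually (\<lambda>n. n \<in> G) U" unfolding G_def by eventually_elim simp
    moreover have "a n \<in> carrier M" if "n \<in> G" for n
      using that lip_ballD(1) by (force simp: G_def)
    moreover have "cnorm M (a n \<ominus> a m) \<le> e" if n: "n \<in> G" and m: "m \<in> G" for n m
    proof (rule cnorm_le_states)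
      have an: "a n \<in> lip_ball M l r" and am: "a m \<in> lip_ball M l r" using n m by (auto simp: G_def)
      show "a n \<ominus> a m \<in> sa M" using lip_ballD(1)[OF an] lip_ballD(1)[OF am] by (rule sa_diff)
      fix \<psi> assume \<psi>: "\<psi> \<in> states M"
      from K(3)[THEN bspec, OF \<psi>]
      obtain \<phi> where \<phi>: "\<phi> \<in> K" "enn2real (mk M \<phi> \<psi>) < e / (4 * l)" by (rule bexE)
      have 1: "cmod (\<phi> x - \<psi> x) \<le> e / 4" if "x \<in> lip_ball M l r" for x
      proof -
        have "cmod (\<phi> x - \<psi> x) \<le> l * enn2real (mk M \<phi> \<psi>)"
          using \<phi>(1) K(2) \<psi> lip_ballD[OF that] l by (intro mk_bound_states) auto
        also have "\<dots> \<le> l * (e / (4 * l))" using \<phi>(2) l by (intro mult_left_mono) auto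
        finally show ?thesis using l by simp
      qed
      have 2: "cmod (\<phi> (a n) - f \<phi>) < e / 4" "cmod (\<phi> (a m) - f \<phi>) < e / 4"
        using n m \<phi>(1) by (auto simp: G_def dist_norm)
      have e: "\<psi> (a n \<ominus> a m) = - (\<phi> (a n) - \<psi> (a n)) + (\<phi> (a n) - f \<phi>) - (\<phi> (a m) - f \<phi>) + (\<phi> (a m) - \<psi> (a m))"
        using states_diff[OF \<psi>] lip_ballD(1)[OF an] lip_ballD(1)[OF am] by simp
      have le: "cmod (- w + x - y + z) \<le> cmod w + cmod x + cmod y + cmod z" for w x y z
        using norm_triangle_ineq[of "- w + x - y" z] norm_triangle_ineq4[of "- w + x" y]
          norm_triangle_ineq[of "- w" x] by simp
      have "cmod (\<psi> (a n \<ominus> a m)) \<le> cmod (\<phi> (a n) - \<psi> (a n)) + cmod (\<phi> (a n) - f \<phi>)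
          + cmod (\<phi> (a m) - f \<phi>) + cmod (\<phi> (a m) - \<psi> (a m))"
        unfolding e by (rule le)
      then show "cmod (\<psi> (a n \<ominus> a m)) \<le> e" using 1[OF an] 1[OF am] 2 by linarith
    qed (use e in simp)
    ultimately show "\<exists>G. eventually (\<lambda>n. n \<in> G) U \<and> (\<forall>n\<in>G. a n \<in> carrier M) \<and>
      (\<forall>n\<in>G. \<forall>m\<in>G. cnorm M (a n \<ominus> a m) \<le> e)" by blast
  qed
  have "b \<in> lip_ball M l r"
  proof (rule lip_ball_closed[OF b(1)])
    fix e :: real assume "0 < e"
    then have "eventually (\<lambda>n. cnorm M (a n \<ominus> b) < e) U" using order_tendstoD(2)[OF b(2)] by blast
    with a have "eventually (\<lambda>n. a n \<in> lip_ball M l r \<and> cnorm M (a n \<ominus> b) < e) U"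
      by eventually_elim simp
    then show "\<exists>a\<in>lip_ball M l r. cnorm M (a \<ominus> b) < e" using eventually_happens'[OF ultra(1)] by blast
  qed
  with b that show thesis by blast
qed

end

text \<open>Complexified Lipschitz balls. Products leave the self-adjoint part, where the seminorm
  is meaningful, so real and imaginary parts are bounded instead.\<close>

definition clip_ball :: "('a, 'm) qcms_scheme \<Rightarrow> real \<Rightarrow> real \<Rightarrow> 'a set" where
  "clip_ball M l r = {u \<oplus>\<^bsub>M\<^esub> \<i> \<odot>\<^bsub>M\<^esub> v | u v. u \<in> lip_ball M l r \<and> v \<in> lip_ball M l r}"

lemma clip_ballI: "\<lbrakk>u \<in> lip_ball M l r; v \<in> lip_ball M l r\<rbrakk> \<Longrightarrow> u \<oplus>\<^bsub>M\<^esub> \<i> \<odot>\<^bsub>M\<^esub> v \<in> clip_ball M l r"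
  unfolding clip_ball_def by blast

lemma clip_ballE:
  assumes "x \<in> clip_ball M l r"
  obtains u v where "u \<in> lip_ball M l r" "v \<in> lip_ball M l r" "x = u \<oplus>\<^bsub>M\<^esub> \<i> \<odot>\<^bsub>M\<^esub> v"
  using assms unfolding clip_ball_def by blast

lemma clip_ball_mono: "\<lbrakk>x \<in> clip_ball M l r; l \<le> l'; r \<le> r'\<rbrakk> \<Longrightarrow> x \<in> clip_ball M l' r'"
  by (elim clip_ballE) (metis clip_ballI lip_ball_mono)

section \<open>Algebra of complexified Lipschitz balls\<close>

context quasi_leibniz_qcms
begin

lemma lip_ball_bounds: "a \<in> lip_ball M l r \<Longrightarrow> 0 \<le> r"
  using lip_ballD(1,3)[of a M l r] cnorm_nonneg[of a] by fastforce

lemma clip_ball_in: "x \<in> clip_ball M l r \<Longrightarrow> x \<in> carrier M"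
  by (elim clip_ballE) (simp add: lip_ballD(1))

lemma lip_clip_ball: "\<lbrakk>a \<in> lip_ball M l r; 0 \<le> l\<rbrakk> \<Longrightarrow> a \<in> clip_ball M l r"
  using clip_ballI[of a M l r \<zero>] lip_ball_zero[of l r] lip_ball_bounds[of a l r] lip_ballD(1)[of a M l r]
  by simp

lemma clip_ball_sa:
  assumes "x \<in> clip_ball M l r" and x: "x \<in> sa M"
  shows "x \<in> lip_ball M l r"
  using assms(1)
proof (rule clip_ballE)
  fix u v assume uv: "u \<in> lip_ball M l r" "v \<in> lip_ball M l r" "x = u \<oplus> \<i> \<odot> v"
  have "re x = u"
    unfolding uv(3) by (rule re_im_unique(1)[OF lip_ballD(1)[OF uv(1)] lip_ballD(1)[OF uv(2)]])
  moreover have "re x = x" using re_im_of_sa[OF x] by (rule conjunct1)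
  ultimately show ?thesis using uv(1) by (simp only:)
qed

lemma clip_ball_add:
  assumes x: "x \<in> clip_ball M l r" and y: "y \<in> clip_ball M l' r'" and l: "0 \<le> l" "0 \<le> l'"
  shows "x \<oplus> y \<in> clip_ball M (l + l') (r + r')"
proof -
  obtain u v where u: "u \<in> lip_ball M l r" and v: "v \<in> lip_ball M l r" and x: "x = u \<oplus> \<i> \<odot> v"
    using x by (rule clip_ballE)
  obtain s t where s: "s \<in> lip_ball M l' r'" and t: "t \<in> lip_ball M l' r'" and y: "y = s \<oplus> \<i> \<odot> t"
    using y by (rule clip_ballE)
  note c = sa_in[OF lip_ballD(1)[OF u]] sa_in[OF lip_ballD(1)[OF v]]
    sa_in[OF lip_ballD(1)[OF s]] sa_in[OF lip_ballD(1)[OF t]]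
  have "x \<oplus> y = (u \<oplus> s) \<oplus> (\<i> \<odot> v \<oplus> \<i> \<odot> t)"
    unfolding x y using c smult_in[OF c(2), of \<i>] smult_in[OF c(4), of \<i>] by algebra
  then have "x \<oplus> y = (u \<oplus> s) \<oplus> \<i> \<odot> (v \<oplus> t)" using c by (simp add: smult_add_r)
  then show ?thesis using clip_ballI[OF lip_ball_add[OF u s l] lip_ball_add[OF v t l]] by simp
qed

lemma clip_ball_smult:
  assumes x: "x \<in> clip_ball M l r" and l: "0 \<le> l"
  shows "c \<odot> x \<in> clip_ball M ((\<bar>Re c\<bar> + \<bar>Im c\<bar>) * l) ((\<bar>Re c\<bar> + \<bar>Im c\<bar>) * r)"
proof -
  obtain u v where u: "u \<in> lip_ball M l r" and v: "v \<in> lip_ball M l r" and x: "x = u \<oplus> \<i> \<odot> v"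
    using x by (rule clip_ballE)
  have "rs (Re c) u \<ominus> rs (Im c) v \<in> lip_ball M (\<bar>Re c\<bar> * l + \<bar>Im c\<bar> * l) (\<bar>Re c\<bar> * r + \<bar>Im c\<bar> * r)"
    using l by (intro lip_ball_diff lip_ball_smult u v) simp_all
  moreover have "rs (Re c) v \<oplus> rs (Im c) u \<in> lip_ball M (\<bar>Re c\<bar> * l + \<bar>Im c\<bar> * l) (\<bar>Re c\<bar> * r + \<bar>Im c\<bar> * r)"
    using l by (intro lip_ball_add lip_ball_smult u v) simp_all
  ultimately show ?thesis
    using clip_ballI smult_re_im[OF lip_ballD(1)[OF u] lip_ballD(1)[OF v]] by (simp add: x distrib_right)
qed

lemma clip_ball_star:
  assumes x: "x \<in> clip_ball M l r" and l: "0 \<le> l"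
  shows "star M x \<in> clip_ball M l r"
proof -
  obtain u v where u: "u \<in> lip_ball M l r" and v: "v \<in> lip_ball M l r" and x: "x = u \<oplus> \<i> \<odot> v"
    using x by (rule clip_ballE)
  have "rs (- 1) v \<in> lip_ball M l r" using lip_ball_smult[OF v l, of "-1"] by simp
  moreover have "star M x = u \<oplus> \<i> \<odot> rs (- 1) v"
    unfolding x star_re_im[OF lip_ballD(1)[OF u] lip_ballD(1)[OF v]]
    using lip_ballD(1)[OF v] by (simp add: minus_eq smult_uminus_l smult_uminus_r)
  ultimately show ?thesis using clip_ballI[OF u] by simp
qed

text \<open>Depends on \<open>F\<close> and the radii but not on the space, so one constant serves
  for all tunnels. The conversion to a real is faithful where \<open>F\<close> is finite.\<close>

definition leibniz_const :: "real \<Rightarrow> real \<Rightarrow> real" where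
  "leibniz_const l r = enn2real (F (ennreal r) (ennreal r) (ennreal l) (ennreal l))"

text \<open>The Jordan and Lie products are the real and imaginary parts of the product, and both
  fall under the quasi-Leibniz inequality.\<close>

lemma lip_ball_mult:
  assumes F: "admissible F" "\<And>x y l k. \<lbrakk>x < \<infinity>; y < \<infinity>; l < \<infinity>; k < \<infinity>\<rbrakk> \<Longrightarrow> F x y l k < \<infinity>"
    and a: "a \<in> lip_ball M l r" and b: "b \<in> lip_ball M l r" and l: "0 \<le> l"
  shows "a \<otimes> b \<in> clip_ball M (leibniz_const l r) (r * r)"
proof -
  note ad = lip_ballD[OF a] and bd = lip_ballD[OF b]
  have "max (lip M (jordan M a b)) (lip M (lie M a b))
      \<le> F (ennreal (cnorm M a)) (ennreal (cnorm M b)) (lip M a) (lip M b)"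
    using quasi_leibniz ad(4) bd(4) by blast
  also have "\<dots> \<le> F (ennreal r) (ennreal r) (ennreal l) (ennreal l)"
    using F(1) ad bd unfolding admissible_def by (simp add: ennreal_leI)
  also have "\<dots> = ennreal (leibniz_const l r)"
    unfolding leibniz_const_def using F(2) by (simp add: less_top)
  finally have L: "lip M (jordan M a b) \<le> ennreal (leibniz_const l r)" "lip M (lie M a b) \<le> ennreal (leibniz_const l r)"
    by simp_all
  have "cnorm M a * cnorm M b \<le> r * r"
    using ad bd lip_ball_bounds[OF a] by (intro mult_mono) (auto simp: cnorm_nonneg)
  then have "jordan M a b \<in> lip_ball M (leibniz_const l r) (r * r)" "lie M a b \<in> lip_ball M (leibniz_const l r) (r * r)"
    using L cnorm_jordan[of a b] cnorm_lie[of a b] ldom_jordan[OF ad(4) bd(4)] ldom_lie[OF ad(4) bd(4)] ad(1) bd(1)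
    by (simp_all add: lip_ball_def ldom_def)
  from clip_ballI[OF this] show ?thesis using mult_jordan_lie[of a b] ad(1) bd(1) by simp
qed

text \<open>The product of two complex elements splits into four products of self-adjoint ones,
  hence the factor 4; multiplying by i or -1 does not enlarge a ball.\<close>

lemma clip_ball_mult:
  assumes F: "admissible F" "\<And>x y l k. \<lbrakk>x < \<infinity>; y < \<infinity>; l < \<infinity>; k < \<infinity>\<rbrakk> \<Longrightarrow> F x y l k < \<infinity>"
    and x: "x \<in> clip_ball M l r" and y: "y \<in> clip_ball M l r" and l: "0 \<le> l"
  shows "x \<otimes> y \<in> clip_ball M (4 * leibniz_const l r) (4 * (r * r))"
proof -
  obtain u v where u: "u \<in> lip_ball M l r" and v: "v \<in> lip_ball M l r" and x: "x = u \<oplus> \<i> \<odot> v"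
    using x by (rule clip_ballE)
  obtain s t where s: "s \<in> lip_ball M l r" and t: "t \<in> lip_ball M l r" and y: "y = s \<oplus> \<i> \<odot> t"
    using y by (rule clip_ballE)
  note c = sa_in[OF lip_ballD(1)[OF u]] sa_in[OF lip_ballD(1)[OF v]]
    sa_in[OF lip_ballD(1)[OF s]] sa_in[OF lip_ballD(1)[OF t]]
  let ?J = "leibniz_const l r"
  have J: "0 \<le> ?J" by (simp add: leibniz_const_def)
  note m = lip_ball_mult[OF F _ _ l]
  have i: "c \<odot> z \<in> clip_ball M ?J (r * r)" if "z \<in> clip_ball M ?J (r * r)" "c = \<i> \<or> c = -1" for z c
    using clip_ball_smult[OF that(1) J, of c] that(2) by auto
  have "(u \<otimes> s \<oplus> (-1) \<odot> (v \<otimes> t)) \<oplus> (\<i> \<odot> (u \<otimes> t) \<oplus> \<i> \<odot> (v \<otimes> s))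
      \<in> clip_ball M ((?J + ?J) + (?J + ?J)) ((r * r + r * r) + (r * r + r * r))"
    using J by (intro clip_ball_add i m u v s t) simp_all
  also have "(u \<otimes> s \<oplus> (-1) \<odot> (v \<otimes> t)) \<oplus> (\<i> \<odot> (u \<otimes> t) \<oplus> \<i> \<odot> (v \<otimes> s)) =
      (u \<otimes> s \<oplus> (\<i> \<odot> v) \<otimes> (\<i> \<odot> t)) \<oplus> (u \<otimes> (\<i> \<odot> t) \<oplus> (\<i> \<odot> v) \<otimes> s)"
    using c by (simp add: smult_mult_left smult_mult_right smult_assoc)
  also have "\<dots> = x \<otimes> y"
    unfolding x y using c smult_in[OF c(2), of \<i>] smult_in[OF c(4), of \<i>] by algebra
  finally show ?thesis by simp
qed

end

section \<open>Quantum isometries\<close>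

locale quantum_isometry_pair = M: quasi_leibniz_qcms F M + N: quasi_leibniz_qcms F N
  for F and M :: "('a, 'm) qcms_scheme" and N :: "('b, 'n) qcms_scheme" +
  fixes p :: "'a \<Rightarrow> 'b"
  assumes isometry: "quantum_isometry M N p"
begin

sublocale unital_star_hom M N p
proof (rule star_hom_onto_unital)
  show "unital_cstar_algebra M" "unital_cstar_algebra N"
    by (rule M.unital_cstar_algebra_axioms, rule N.unital_cstar_algebra_axioms)
  show "star_hom M N p" "p ` carrier M = carrier N"
    using isometry unfolding quantum_isometry_def by blast+
qed

lemma lip_eq_INF: "b \<in> sa N \<Longrightarrow> lip N b = (INF a\<in>{a \<in> sa M. p a = b}. lip M a)"
  using isometry by (simp add: quantum_isometry_def)

lemma lip_hom: "a \<in> sa M \<Longrightarrow> lip N (p a) \<le> lip M a"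
  using lip_eq_INF[OF hom_sa] by (auto intro: INF_lower)

lemma lip_ball_hom: "a \<in> lip_ball M l r \<Longrightarrow> p a \<in> lip_ball N l r"
  using lip_hom[of a] cnorm_hom[of a] hom_sa[of a] by (auto simp: lip_ball_def intro: order_trans)

lemma clip_ball_hom: "x \<in> clip_ball M l r \<Longrightarrow> p x \<in> clip_ball N l r"
proof (elim clip_ballE)
  fix u v assume u: "u \<in> lip_ball M l r" and v: "v \<in> lip_ball M l r" and x: "x = u \<oplus>\<^bsub>M\<^esub> \<i> \<odot>\<^bsub>M\<^esub> v"
  have "p x = p u \<oplus>\<^bsub>N\<^esub> \<i> \<odot>\<^bsub>N\<^esub> p v"
    using lip_ballD(1)[OF u] lip_ballD(1)[OF v] by (simp add: x hom_add hom_smult)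
  then show ?thesis using clip_ballI[OF lip_ball_hom[OF u] lip_ball_hom[OF v]] by simp
qed

text \<open>The strict inequality is essential: the quotient seminorm is an infimum that is not
  claimed to be attained.\<close>

lemma lip_lift:
  assumes "b \<in> sa N" "lip N b < ennreal l"
  shows "\<exists>a\<in>sa M. p a = b \<and> lip M a < ennreal l"
  using assms(2) unfolding lip_eq_INF[OF assms(1)] INF_less_iff by blast

lemma pullback_state:
  assumes \<psi>: "\<psi> \<in> states N"
  shows "compose (carrier M) \<psi> p \<in> states M"
proof -
  have "\<psi> (p h) \<in> \<real>\<^sub>\<ge>\<^sub>0" if "M.pos h" for h using N.statesD(3)[OF \<psi> hom_pos[OF that]] .
  then show ?thesis
    unfolding states_def
    by (auto simp: compose_def hom_add hom_smult N.statesD[OF \<psi>] M.positive_cone_iff unital)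
qed

text \<open>Every state of the tunnel is within \<open>mk\<close> distance \<open>x\<close> of one
  pulled back along \<open>p\<close>, which sees \<open>d\<close> only through \<open>p d\<close>.
  Moving the state costs l * x on \<open>d\<close>, and the states recover the norm.\<close>

lemma cnorm_le_hausdorff:
  assumes h: "hausdorff (mk M) (states M) (pullback_states M N p) < ennreal x" and x: "0 \<le> x"
    and d: "d \<in> sa M" "lip M d \<le> ennreal l" and l: "0 < l"
  shows "cnorm M d \<le> cnorm N (p d) + l * x"
proof (rule M.cnorm_le_states[OF d(1)])
  show "0 \<le> cnorm N (p d) + l * x" using d l x by (simp add: N.cnorm_nonneg)
  fix \<phi> assume \<phi>: "\<phi> \<in> states M"
  have "(SUP \<phi>\<in>states M. INF y\<in>pullback_states M N p. mk M \<phi> y) < ennreal x"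
    using h unfolding hausdorff_def by simp
  then have "(INF y\<in>pullback_states M N p. mk M \<phi> y) < ennreal x"
    using SUP_upper[OF \<phi>] by (rule order.strict_trans1[rotated])
  then obtain y where "y \<in> pullback_states M N p" and y: "mk M \<phi> y < ennreal x"
    unfolding INF_less_iff by blast
  then obtain \<psi> where \<psi>: "\<psi> \<in> states N" "y = compose (carrier M) \<psi> p"
    unfolding pullback_states_def by blast
  have ys: "y \<in> states M" using pullback_state \<psi> by simp
  have "cmod (\<phi> d - y d) \<le> l * x"
    by (intro M.mk_bound M.statesD(2) \<phi> ys x d l less_imp_le[OF y])
  moreover have "cmod (y d) \<le> cnorm N (p d)"
    using N.states_sa(2)[OF \<psi>(1) hom_sa[OF d(1)]] d(1) by (simp add: \<psi>(2) compose_def)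
  ultimately show "cmod (\<phi> d) \<le> cnorm N (p d) + l * x"
    using norm_triangle_ineq[of "\<phi> d - y d" "y d"] by simp
qed

end

section \<open>Ultralimits along a sequence of tunnels\<close>

text \<open>Uses that the squared difference is at most the difference of squares; needed since the
  C*-identity delivers squared norms.\<close>

lemma abs_diff_le_sqrt:
  fixes s t c :: real
  assumes "0 \<le> s" "0 \<le> t" "s\<^sup>2 \<le> t\<^sup>2 + c" "t\<^sup>2 \<le> s\<^sup>2 + c"
  shows "\<bar>s - t\<bar> \<le> sqrt c"
proof (rule real_le_rsqrt)
  have "\<bar>s - t\<bar> * \<bar>s - t\<bar> \<le> \<bar>s - t\<bar> * (s + t)"
    using assms by (intro mult_left_mono) auto
  also have "\<dots> = \<bar>s\<^sup>2 - t\<^sup>2\<bar>"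
    using assms by (simp add: abs_mult power2_eq_square square_diff_square_factored mult.commute)
  also have "\<dots> \<le> c" using assms by (simp add: abs_le_iff)
  finally show "\<bar>s - t\<bar>\<^sup>2 \<le> c" by (simp add: power2_eq_square)
qed

context unital_cstar_algebra
begin

lemma cnorm_add_diff:
  assumes "a \<in> carrier A" "b \<in> carrier A" "c \<in> carrier A" "d \<in> carrier A"
  shows "cnorm A ((a \<oplus> b) \<ominus> (c \<oplus> d)) \<le> cnorm A (a \<ominus> c) + cnorm A (b \<ominus> d)"
proof -
  have "(a \<oplus> b) \<ominus> (c \<oplus> d) = (a \<ominus> c) \<oplus> (b \<ominus> d)" using assms by algebra
  then show ?thesis using cnorm_add[of "a \<ominus> c" "b \<ominus> d"] assms by simp
qed

lemma cnorm_smult_diff: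
  "\<lbrakk>a \<in> carrier A; b \<in> carrier A\<rbrakk> \<Longrightarrow> cnorm A (c \<odot> a \<ominus> c \<odot> b) = cmod c * cnorm A (a \<ominus> b)"
  by (simp add: cnorm_smult flip: smult_diff_r)

lemma cnorm_star_diff:
  "\<lbrakk>a \<in> carrier A; b \<in> carrier A\<rbrakk> \<Longrightarrow> cnorm A (star A a \<ominus> star A b) = cnorm A (a \<ominus> b)"
  using cnorm_star[of "a \<ominus> b"] by (simp add: star_diff)

end

context quasi_leibniz_qcms
begin

lemma lip_ball_dense:
  assumes a: "a \<in> sa M" and e: "0 < e"
  shows "\<exists>b l r. b \<in> lip_ball M l r \<and> 0 \<le> l \<and> cnorm M (b \<ominus> a) < e"
proof -
  have "a \<in> metric.mtopology closure_of ldom M" using ldom_dense a unfolding ctop_def by blast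
  then have "\<exists>b\<in>ldom M. b \<in> metric.mball a e" using e unfolding metric.metric_closure_of by simp
  then obtain b where b: "b \<in> ldom M" "cdist M a b < e" by auto
  have bs: "b \<in> sa M" using b(1) by (simp add: ldom_def)
  have "cnorm M (b \<ominus> a) < e"
    using b(2) sa_in[OF a] sa_in[OF bs] cnorm_diff_commute[of a b] by (simp add: cdist_def)
  moreover have "b \<in> lip_ball M (enn2real (lip M b)) (cnorm M b)"
    using b(1) by (simp add: lip_ball_def ldom_def less_top)
  ultimately show ?thesis using enn2real_nonneg by blast
qed

end

text \<open>Extents enter only through the norm estimate \<open>bound\<close>, with error l times
  \<open>\<eta> n\<close>, and only for almost all n, since a tunnel may have infinite extent at
  some n.\<close>

locale tunnel_sequence =
  fixes F :: "ennreal \<Rightarrow> ennreal \<Rightarrow> ennreal \<Rightarrow> ennreal \<Rightarrow> ennreal" and U :: "nat filter"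
    and As Ds :: "nat \<Rightarrow> 'a qcms" and A :: "'a qcms" and p q :: "nat \<Rightarrow> 'a \<Rightarrow> 'a"
    and \<eta> :: "nat \<Rightarrow> real"
  assumes U_bot: "U \<noteq> bot" and U_seq: "U \<le> sequentially"
    and ultra: "\<And>P. eventually P U \<or> eventually (\<lambda>n. \<not> P n) U"
    and As: "\<And>n. quasi_leibniz_qcms F (As n)" and Ds: "\<And>n. quasi_leibniz_qcms F (Ds n)"
    and A: "quasi_leibniz_qcms F A"
    and p: "\<And>n. quantum_isometry (Ds n) (As n) (p n)" and q: "\<And>n. quantum_isometry (Ds n) A (q n)"
    and \<eta>_lim: "(\<eta> \<longlongrightarrow> 0) U"
    and bound: "eventually (\<lambda>n. \<forall>l>0. \<forall>d\<in>sa (Ds n). lip (Ds n) d \<le> ennreal l \<longrightarrow>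
        cnorm (Ds n) d \<le> cnorm (As n) (p n d) + l * \<eta> n \<and>
        cnorm (Ds n) d \<le> cnorm A (q n d) + l * \<eta> n) U"
    and F_admissible: "admissible F"
    and F_finite: "\<And>x y l k. \<lbrakk>x < \<infinity>; y < \<infinity>; l < \<infinity>; k < \<infinity>\<rbrakk> \<Longrightarrow> F x y l k < \<infinity>"
begin

sublocale A: quasi_leibniz_qcms F A by (rule A)
sublocale An: quasi_leibniz_qcms F "As n" for n by (rule As)
sublocale Dn: quasi_leibniz_qcms F "Ds n" for n by (rule Ds)
sublocale P: quantum_isometry_pair F "Ds n" "As n" "p n" for n
  by (intro quantum_isometry_pair.intro quantum_isometry_pair_axioms.intro As Ds p)
sublocale Q: quantum_isometry_pair F "Ds n" A "q n" for n
  by (intro quantum_isometry_pair.intro quantum_isometry_pair_axioms.intro A Ds q)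

text \<open>The bounds \<open>l\<close> and \<open>r\<close> may depend on the precision but not on
  n. So elements of infinite seminorm can still be limits, while for each precision the tunnel error
  vanishes along \<open>U\<close>.\<close>

definition conv :: "(nat \<Rightarrow> 'a) \<Rightarrow> 'a \<Rightarrow> bool" where
  "conv x a \<longleftrightarrow> a \<in> carrier A \<and> (\<forall>n. x n \<in> carrier (As n)) \<and>
    (\<forall>e>0. \<exists>l\<ge>0. \<exists>r d. eventually (\<lambda>n. d n \<in> clip_ball (Ds n) l r \<and>
       cnorm (As n) (p n (d n) \<ominus>\<^bsub>As n\<^esub> x n) < e \<and> cnorm A (q n (d n) \<ominus>\<^bsub>A\<^esub> a) < e) U)"

lemma eventually_less: "0 < e \<Longrightarrow> eventually (\<lambda>n. c * \<eta> n < e) U"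
proof -
  assume e: "0 < e"
  have "((\<lambda>n. c * \<eta> n) \<longlongrightarrow> c * 0) U" by (intro tendsto_mult_left \<eta>_lim)
  then show ?thesis using e by (intro order_tendstoD(2)[of _ "c * 0"]) simp_all
qed

lemma eventually_Suc_less: "0 < e \<Longrightarrow> eventually (\<lambda>n. 1 / real (Suc n) < e) U"
proof -
  assume "0 < e"
  then have "eventually (\<lambda>n. 1 / real (Suc n) < e) sequentially"
    using order_tendstoD(2)[OF LIMSEQ_Suc[OF lim_1_over_n]] by simp
  then show ?thesis using U_seq by (rule filter_leD[rotated])
qed

text \<open>The estimate \<open>bound\<close> is applied to w = d*d. Both quotient maps are
  contractive, so the squared norms of the two images of \<open>d\<close> lie within L times
  \<open>\<eta> n\<close> below the norm of w.\<close>

lemma cnorm_gap: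
  assumes d: "eventually (\<lambda>n. d n \<in> clip_ball (Ds n) l r) U" and l: "0 \<le> l"
  shows "((\<lambda>n. cnorm (As n) (p n (d n)) - cnorm A (q n (d n))) \<longlongrightarrow> 0) U"
proof -
  \<comment> \<open>The added 1 makes the constant positive, as \<open>bound\<close> requires.
    \<open>A.leibniz_const\<close> may be used for \<open>Ds n\<close> because it involves
    \<open>F\<close> alone.\<close>
  define L where "L = 4 * A.leibniz_const l r + 1"
  have L: "0 < L" by (simp add: L_def A.leibniz_const_def add_nonneg_pos)
  have "eventually (\<lambda>n. norm (cnorm (As n) (p n (d n)) - cnorm A (q n (d n))) \<le> sqrt (L * \<eta> n)) U"
    using d bound
  proof eventually_elim
    case (elim n)
    note dc = Dn.clip_ball_in[OF elim(1)]
    define w where "w = star (Ds n) (d n) \<otimes>\<^bsub>Ds n\<^esub> d n"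
    have ws: "w \<in> sa (Ds n)" unfolding w_def by (rule Dn.star_mult_self_sa[OF dc])
    have "w \<in> clip_ball (Ds n) (4 * A.leibniz_const l r) (4 * (r * r))"
      unfolding w_def
      by (rule Dn.clip_ball_mult[OF F_admissible F_finite Dn.clip_ball_star[OF elim(1) l] elim(1) l])
    then have "w \<in> lip_ball (Ds n) (4 * A.leibniz_const l r) (4 * (r * r))"
      using ws by (rule Dn.clip_ball_sa)
    then have "lip (Ds n) w \<le> ennreal (4 * A.leibniz_const l r)" by (rule lip_ballD(2))
    also have "\<dots> \<le> ennreal L" by (rule ennreal_leI) (simp add: L_def)
    finally have b: "cnorm (Ds n) w \<le> cnorm (As n) (p n w) + L * \<eta> n"
      "cnorm (Ds n) w \<le> cnorm A (q n w) + L * \<eta> n"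
      using elim(2) L ws by blast+
    have pw: "cnorm (As n) (p n w) = (cnorm (As n) (p n (d n)))\<^sup>2"
      unfolding w_def P.hom_mult[OF Dn.star_in[OF dc] dc] P.hom_star[OF dc]
      by (rule An.cstar_identity[OF P.hom_in[OF dc]])
    have qw: "cnorm A (q n w) = (cnorm A (q n (d n)))\<^sup>2"
      unfolding w_def Q.hom_mult[OF Dn.star_in[OF dc] dc] Q.hom_star[OF dc]
      by (rule A.cstar_identity[OF Q.hom_in[OF dc]])
    have "cnorm (As n) (p n w) \<le> cnorm (Ds n) w" "cnorm A (q n w) \<le> cnorm (Ds n) w"
      by (rule P.cnorm_hom[OF Dn.sa_in[OF ws]], rule Q.cnorm_hom[OF Dn.sa_in[OF ws]])
    then show ?case
      unfolding real_norm_def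
      using b pw qw An.cnorm_nonneg[OF P.hom_in[OF dc]] A.cnorm_nonneg[OF Q.hom_in[OF dc]]
      by (intro abs_diff_le_sqrt) linarith+
  qed
  moreover have "((\<lambda>n. sqrt (L * \<eta> n)) \<longlongrightarrow> sqrt (L * 0)) U"
    by (intro tendsto_real_sqrt tendsto_mult_left \<eta>_lim)
  then have "((\<lambda>n. sqrt (L * \<eta> n)) \<longlongrightarrow> 0) U" by simp
  ultimately show ?thesis by (rule Lim_null_comparison)
qed

lemma convD: "conv x a \<Longrightarrow> a \<in> carrier A" "conv x a \<Longrightarrow> x n \<in> carrier (As n)"
  unfolding conv_def by blast+

lemma convE:
  assumes "conv x a" and "0 < e"
  obtains l r d where "0 \<le> l"
    "eventually (\<lambda>n. d n \<in> clip_ball (Ds n) l r \<and>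
       cnorm (As n) (p n (d n) \<ominus>\<^bsub>As n\<^esub> x n) < e \<and> cnorm A (q n (d n) \<ominus>\<^bsub>A\<^esub> a) < e) U"
  using assms unfolding conv_def by blast

lemma convI:
  assumes "a \<in> carrier A" "\<And>n. x n \<in> carrier (As n)"
    and "\<And>e. 0 < e \<Longrightarrow> \<exists>l\<ge>0. \<exists>r d. eventually (\<lambda>n. d n \<in> clip_ball (Ds n) l r \<and>
       cnorm (As n) (p n (d n) \<ominus>\<^bsub>As n\<^esub> x n) < e \<and> cnorm A (q n (d n) \<ominus>\<^bsub>A\<^esub> a) < e) U"
  shows "conv x a"
  using assms unfolding conv_def by blast

lemma conv_cnorm:
  assumes x: "conv x a"
  shows "((\<lambda>n. cnorm (As n) (x n)) \<longlongrightarrow> cnorm A a) U"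
proof (rule tendstoI)
  fix e :: real assume e: "0 < e"
  then have e3: "0 < e / 3" by simp
  obtain l r d where l: "0 \<le> l" and d: "eventually (\<lambda>n. d n \<in> clip_ball (Ds n) l r \<and>
       cnorm (As n) (p n (d n) \<ominus>\<^bsub>As n\<^esub> x n) < e / 3 \<and> cnorm A (q n (d n) \<ominus>\<^bsub>A\<^esub> a) < e / 3) U"
    using x e3 by (rule convE)
  have "eventually (\<lambda>n. d n \<in> clip_ball (Ds n) l r) U" using d by eventually_elim blast
  from tendstoD[OF cnorm_gap[OF this l] e3]
  have "eventually (\<lambda>n. \<bar>cnorm (As n) (p n (d n)) - cnorm A (q n (d n))\<bar> < e / 3) U" by simp
  with d show "eventually (\<lambda>n. dist (cnorm (As n) (x n)) (cnorm A a) < e) U"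
  proof eventually_elim
    case (elim n)
    have dc: "d n \<in> carrier (Ds n)" using elim(1) Dn.clip_ball_in by blast
    have "\<bar>cnorm (As n) (p n (d n)) - cnorm (As n) (x n)\<bar> \<le> cnorm (As n) (p n (d n) \<ominus>\<^bsub>As n\<^esub> x n)"
      by (intro An.cnorm_diff_bound P.hom_in dc convD[OF x])
    moreover have "\<bar>cnorm A (q n (d n)) - cnorm A a\<bar> \<le> cnorm A (q n (d n) \<ominus>\<^bsub>A\<^esub> a)"
      by (intro A.cnorm_diff_bound Q.hom_in dc convD[OF x])
    ultimately show ?case unfolding dist_real_def using elim by linarith
  qed
qed

lemma conv_add:
  assumes x: "conv x a" and y: "conv y b"
  shows "conv (\<lambda>n. x n \<oplus>\<^bsub>As n\<^esub> y n) (a \<oplus>\<^bsub>A\<^esub> b)"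
proof (rule convI)
  fix e :: real assume e: "0 < e"
  then have e2: "0 < e / 2" by simp
  obtain l r d where l: "0 \<le> l" and d: "eventually (\<lambda>n. d n \<in> clip_ball (Ds n) l r \<and>
       cnorm (As n) (p n (d n) \<ominus>\<^bsub>As n\<^esub> x n) < e / 2 \<and> cnorm A (q n (d n) \<ominus>\<^bsub>A\<^esub> a) < e / 2) U"
    using x e2 by (rule convE)
  obtain l' r' d' where l': "0 \<le> l'" and d': "eventually (\<lambda>n. d' n \<in> clip_ball (Ds n) l' r' \<and>
       cnorm (As n) (p n (d' n) \<ominus>\<^bsub>As n\<^esub> y n) < e / 2 \<and> cnorm A (q n (d' n) \<ominus>\<^bsub>A\<^esub> b) < e / 2) U"
    using y e2 by (rule convE)
  from d d' have "eventually (\<lambda>n. d n \<oplus>\<^bsub>Ds n\<^esub> d' n \<in> clip_ball (Ds n) (l + l') (r + r') \<and>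
     cnorm (As n) (p n (d n \<oplus>\<^bsub>Ds n\<^esub> d' n) \<ominus>\<^bsub>As n\<^esub> (x n \<oplus>\<^bsub>As n\<^esub> y n)) < e \<and>
     cnorm A (q n (d n \<oplus>\<^bsub>Ds n\<^esub> d' n) \<ominus>\<^bsub>A\<^esub> (a \<oplus>\<^bsub>A\<^esub> b)) < e) U"
  proof eventually_elim
    case (elim n)
    have c: "d n \<in> carrier (Ds n)" "d' n \<in> carrier (Ds n)" using elim Dn.clip_ball_in by blast+
    have "d n \<oplus>\<^bsub>Ds n\<^esub> d' n \<in> clip_ball (Ds n) (l + l') (r + r')"
      using elim l l' by (intro Dn.clip_ball_add) blast+
    moreover have "cnorm (As n) (p n (d n \<oplus>\<^bsub>Ds n\<^esub> d' n) \<ominus>\<^bsub>As n\<^esub> (x n \<oplus>\<^bsub>As n\<^esub> y n))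
      \<le> cnorm (As n) (p n (d n) \<ominus>\<^bsub>As n\<^esub> x n) + cnorm (As n) (p n (d' n) \<ominus>\<^bsub>As n\<^esub> y n)"
      unfolding P.hom_add[OF c] by (intro An.cnorm_add_diff P.hom_in c convD[OF x] convD[OF y])
    moreover have "cnorm A (q n (d n \<oplus>\<^bsub>Ds n\<^esub> d' n) \<ominus>\<^bsub>A\<^esub> (a \<oplus>\<^bsub>A\<^esub> b))
      \<le> cnorm A (q n (d n) \<ominus>\<^bsub>A\<^esub> a) + cnorm A (q n (d' n) \<ominus>\<^bsub>A\<^esub> b)"
      unfolding Q.hom_add[OF c] by (intro A.cnorm_add_diff Q.hom_in c convD[OF x] convD[OF y])
    ultimately show ?case using elim by auto
  qed
  moreover have "0 \<le> l + l'" using l l' by simp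
  ultimately show "\<exists>l\<ge>0. \<exists>r d. eventually (\<lambda>n. d n \<in> clip_ball (Ds n) l r \<and>
     cnorm (As n) (p n (d n) \<ominus>\<^bsub>As n\<^esub> (x n \<oplus>\<^bsub>As n\<^esub> y n)) < e \<and> cnorm A (q n (d n) \<ominus>\<^bsub>A\<^esub> (a \<oplus>\<^bsub>A\<^esub> b)) < e) U"
    by (intro exI[of _ "l + l'"] conjI exI[of _ "r + r'"] exI[of _ "\<lambda>n. d n \<oplus>\<^bsub>Ds n\<^esub> d' n"])
qed (intro A.a_closed An.a_closed convD[OF x] convD[OF y])+

lemma conv_smult:
  assumes x: "conv x a"
  shows "conv (\<lambda>n. c \<odot>\<^bsub>As n\<^esub> x n) (c \<odot>\<^bsub>A\<^esub> a)"
proof (rule convI)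
  fix e :: real assume e: "0 < e"
  have k0: "0 < cmod c + 1" by (simp add: add_nonneg_pos)
  then have e2: "0 < e / (cmod c + 1)" using e by simp
  obtain l r d where l: "0 \<le> l" and d: "eventually (\<lambda>n. d n \<in> clip_ball (Ds n) l r \<and>
       cnorm (As n) (p n (d n) \<ominus>\<^bsub>As n\<^esub> x n) < e / (cmod c + 1) \<and> cnorm A (q n (d n) \<ominus>\<^bsub>A\<^esub> a) < e / (cmod c + 1)) U"
    using x e2 by (rule convE)
  let ?k = "\<bar>Re c\<bar> + \<bar>Im c\<bar>"
  have le: "cmod c * t < e" if "0 \<le> t" "t < e / (cmod c + 1)" for t
  proof -
    have "cmod c * t \<le> (cmod c + 1) * t" using that by (intro mult_right_mono) auto
    also have "\<dots> < e" using that(2) k0 by (simp add: pos_less_divide_eq mult.commute)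
    finally show ?thesis .
  qed
  from d have "eventually (\<lambda>n. c \<odot>\<^bsub>Ds n\<^esub> d n \<in> clip_ball (Ds n) (?k * l) (?k * r) \<and>
     cnorm (As n) (p n (c \<odot>\<^bsub>Ds n\<^esub> d n) \<ominus>\<^bsub>As n\<^esub> c \<odot>\<^bsub>As n\<^esub> x n) < e \<and>
     cnorm A (q n (c \<odot>\<^bsub>Ds n\<^esub> d n) \<ominus>\<^bsub>A\<^esub> c \<odot>\<^bsub>A\<^esub> a) < e) U"
  proof eventually_elim
    case (elim n)
    have dc: "d n \<in> carrier (Ds n)" using elim Dn.clip_ball_in by blast
    note pc = P.hom_in[OF dc] and qc = Q.hom_in[OF dc]
    have 1: "c \<odot>\<^bsub>Ds n\<^esub> d n \<in> clip_ball (Ds n) (?k * l) (?k * r)"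
      using elim l by (intro Dn.clip_ball_smult) blast+
    have 2: "cnorm (As n) (p n (c \<odot>\<^bsub>Ds n\<^esub> d n) \<ominus>\<^bsub>As n\<^esub> c \<odot>\<^bsub>As n\<^esub> x n) < e"
      unfolding P.hom_smult[OF dc] An.cnorm_smult_diff[OF pc convD(2)[OF x]]
      by (rule le) (use elim An.cnorm_nonneg[OF An.minus_closed[OF pc convD(2)[OF x]]] in blast)+
    have 3: "cnorm A (q n (c \<odot>\<^bsub>Ds n\<^esub> d n) \<ominus>\<^bsub>A\<^esub> c \<odot>\<^bsub>A\<^esub> a) < e"
      unfolding Q.hom_smult[OF dc] A.cnorm_smult_diff[OF qc convD(1)[OF x]]
      by (rule le) (use elim A.cnorm_nonneg[OF A.minus_closed[OF qc convD(1)[OF x]]] in blast)+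
    from 1 2 3 show ?case by blast
  qed
  moreover have "0 \<le> ?k * l" using l by simp
  ultimately show "\<exists>l\<ge>0. \<exists>r d. eventually (\<lambda>n. d n \<in> clip_ball (Ds n) l r \<and>
     cnorm (As n) (p n (d n) \<ominus>\<^bsub>As n\<^esub> c \<odot>\<^bsub>As n\<^esub> x n) < e \<and> cnorm A (q n (d n) \<ominus>\<^bsub>A\<^esub> c \<odot>\<^bsub>A\<^esub> a) < e) U"
    by (intro exI[of _ "?k * l"] conjI exI[of _ "?k * r"] exI[of _ "\<lambda>n. c \<odot>\<^bsub>Ds n\<^esub> d n"])
qed (intro A.smult_in An.smult_in convD[OF x])+

lemma conv_diff:
  assumes x: "conv x a" and y: "conv y b"
  shows "conv (\<lambda>n. x n \<ominus>\<^bsub>As n\<^esub> y n) (a \<ominus>\<^bsub>A\<^esub> b)"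
proof -
  have 1: "(-1) \<odot>\<^bsub>As n\<^esub> y n = \<ominus>\<^bsub>As n\<^esub> y n" for n
    using An.smult_uminus_l[OF convD(2)[OF y, of n], of 1] An.smult_1[OF convD(2)[OF y, of n]] by simp
  have 2: "(-1) \<odot>\<^bsub>A\<^esub> b = \<ominus>\<^bsub>A\<^esub> b"
    using A.smult_uminus_l[OF convD(1)[OF y], of 1] A.smult_1[OF convD(1)[OF y]] by simp
  show ?thesis
    using conv_add[OF x conv_smult[OF y, of "-1"]] unfolding 1 2 A.minus_eq An.minus_eq .
qed

lemma conv_star:
  assumes x: "conv x a"
  shows "conv (\<lambda>n. star (As n) (x n)) (star A a)"
proof (rule convI)
  fix e :: real assume e: "0 < e"
  obtain l r d where l: "0 \<le> l" and d: "eventually (\<lambda>n. d n \<in> clip_ball (Ds n) l r \<and>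
       cnorm (As n) (p n (d n) \<ominus>\<^bsub>As n\<^esub> x n) < e \<and> cnorm A (q n (d n) \<ominus>\<^bsub>A\<^esub> a) < e) U"
    using x e by (rule convE)
  from d have "eventually (\<lambda>n. star (Ds n) (d n) \<in> clip_ball (Ds n) l r \<and>
     cnorm (As n) (p n (star (Ds n) (d n)) \<ominus>\<^bsub>As n\<^esub> star (As n) (x n)) < e \<and>
     cnorm A (q n (star (Ds n) (d n)) \<ominus>\<^bsub>A\<^esub> star A a) < e) U"
  proof eventually_elim
    case (elim n)
    have dc: "d n \<in> carrier (Ds n)" using elim Dn.clip_ball_in by blast
    have "star (Ds n) (d n) \<in> clip_ball (Ds n) l r"
      using elim l by (intro Dn.clip_ball_star) blast+
    then show ?case
      unfolding P.hom_star[OF dc] Q.hom_star[OF dc] An.cnorm_star_diff[OF P.hom_in[OF dc] convD(2)[OF x]]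
        A.cnorm_star_diff[OF Q.hom_in[OF dc] convD(1)[OF x]]
      using elim by blast
  qed
  with l show "\<exists>l\<ge>0. \<exists>r d. eventually (\<lambda>n. d n \<in> clip_ball (Ds n) l r \<and>
     cnorm (As n) (p n (d n) \<ominus>\<^bsub>As n\<^esub> star (As n) (x n)) < e \<and> cnorm A (q n (d n) \<ominus>\<^bsub>A\<^esub> star A a) < e) U"
    by (intro exI[of _ l] conjI exI[of _ r] exI[of _ "\<lambda>n. star (Ds n) (d n)"])
qed (intro A.star_in An.star_in convD[OF x])+

lemma conv_mult:
  assumes x: "conv x a" and y: "conv y b"
  shows "conv (\<lambda>n. x n \<otimes>\<^bsub>As n\<^esub> y n) (a \<otimes>\<^bsub>A\<^esub> b)"
proof (rule convI)
  fix e :: real assume e: "0 < e"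
  \<comment> \<open>B dominates the norms of \<open>a\<close> and \<open>b\<close> and, for almost
    all n, those of \<open>x n\<close> and \<open>y n\<close>. Each of the three terms in
    \<open>cnorm_mult_diff\<close> is then at most tB, and 3tB < 4tB <= e.\<close>
  define B where "B = cnorm A a + cnorm A b + 2"
  have B: "2 \<le> B" using A.cnorm_nonneg[OF convD(1)[OF x]] A.cnorm_nonneg[OF convD(1)[OF y]] by (simp add: B_def)
  define t where "t = min 1 (e / (4 * B))"
  have t: "0 < t" "t \<le> 1" "4 * B * t \<le> e"
    using e B by (auto simp: t_def min_def pos_le_divide_eq mult.commute)
  have small: "u * v + u * m + k * v < e"
    if "0 \<le> u" "u < t" "0 \<le> v" "v < t" "0 \<le> m" "m \<le> B" "0 \<le> k" "k \<le> B" for u v m k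
  proof -
    have "u * v \<le> t * 1" using that t by (intro mult_mono) auto
    moreover have "t * 1 \<le> t * B" using B t by (intro mult_left_mono) auto
    moreover have "u * m \<le> t * B" using that t B by (intro mult_mono) auto
    moreover have "k * v \<le> B * t" using that t B by (intro mult_mono) auto
    moreover have "0 < t * B" using B t by simp
    moreover have "B * t = t * B" "4 * B * t = 4 * (t * B)" by simp_all
    ultimately have "u * v + u * m + k * v < 4 * B * t" by linarith
    with t show ?thesis by simp
  qed
  obtain l r d where l: "0 \<le> l" and d: "eventually (\<lambda>n. d n \<in> clip_ball (Ds n) l r \<and>
       cnorm (As n) (p n (d n) \<ominus>\<^bsub>As n\<^esub> x n) < t \<and> cnorm A (q n (d n) \<ominus>\<^bsub>A\<^esub> a) < t) U"
    using x t(1) by (rule convE)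
  obtain l' r' d' where l': "0 \<le> l'" and d': "eventually (\<lambda>n. d' n \<in> clip_ball (Ds n) l' r' \<and>
       cnorm (As n) (p n (d' n) \<ominus>\<^bsub>As n\<^esub> y n) < t \<and> cnorm A (q n (d' n) \<ominus>\<^bsub>A\<^esub> b) < t) U"
    using y t(1) by (rule convE)
  define k s where "k = max l l'" and "s = max r r'"
  have k: "0 \<le> k" using l by (simp add: k_def)
  have "cnorm A a < cnorm A a + 1" "cnorm A b < cnorm A b + 1" by simp_all
  from order_tendstoD(2)[OF conv_cnorm[OF x] this(1)] order_tendstoD(2)[OF conv_cnorm[OF y] this(2)] d d'
  have "eventually (\<lambda>n. d n \<otimes>\<^bsub>Ds n\<^esub> d' n \<in> clip_ball (Ds n) (4 * A.leibniz_const k s) (4 * (s * s)) \<and>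
     cnorm (As n) (p n (d n \<otimes>\<^bsub>Ds n\<^esub> d' n) \<ominus>\<^bsub>As n\<^esub> (x n \<otimes>\<^bsub>As n\<^esub> y n)) < e \<and>
     cnorm A (q n (d n \<otimes>\<^bsub>Ds n\<^esub> d' n) \<ominus>\<^bsub>A\<^esub> (a \<otimes>\<^bsub>A\<^esub> b)) < e) U"
  proof eventually_elim
    case (elim n)
    have c: "d n \<in> carrier (Ds n)" "d' n \<in> carrier (Ds n)" using elim Dn.clip_ball_in by blast+
    have m: "d n \<in> clip_ball (Ds n) k s" "d' n \<in> clip_ball (Ds n) k s"
      using elim by (auto simp: k_def s_def intro: clip_ball_mono)
    have 1: "d n \<otimes>\<^bsub>Ds n\<^esub> d' n \<in> clip_ball (Ds n) (4 * A.leibniz_const k s) (4 * (s * s))"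
      by (rule Dn.clip_ball_mult[OF F_admissible F_finite m k])
    note pc = P.hom_in[OF c(1)] P.hom_in[OF c(2)] convD(2)[OF x, of n] convD(2)[OF y, of n]
    note qc = Q.hom_in[OF c(1)] Q.hom_in[OF c(2)] convD(1)[OF x] convD(1)[OF y]
    have n: "cnorm (As n) (x n) \<le> B" "cnorm (As n) (y n) \<le> B" "cnorm A a \<le> B" "cnorm A b \<le> B"
      using elim A.cnorm_nonneg[OF convD(1)[OF x]] A.cnorm_nonneg[OF convD(1)[OF y]] by (auto simp: B_def)
    have 2: "cnorm (As n) (p n (d n \<otimes>\<^bsub>Ds n\<^esub> d' n) \<ominus>\<^bsub>As n\<^esub> (x n \<otimes>\<^bsub>As n\<^esub> y n)) < e"
      unfolding P.hom_mult[OF c]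
      by (rule le_less_trans[OF An.cnorm_mult_diff[OF pc] small])
        (use elim n pc in \<open>simp_all add: An.cnorm_nonneg\<close>)
    have 3: "cnorm A (q n (d n \<otimes>\<^bsub>Ds n\<^esub> d' n) \<ominus>\<^bsub>A\<^esub> (a \<otimes>\<^bsub>A\<^esub> b)) < e"
      unfolding Q.hom_mult[OF c]
      by (rule le_less_trans[OF A.cnorm_mult_diff[OF qc] small])
        (use elim n qc in \<open>simp_all add: A.cnorm_nonneg\<close>)
    from 1 2 3 show ?case by blast
  qed
  moreover have "0 \<le> 4 * A.leibniz_const k s" by (simp add: A.leibniz_const_def)
  ultimately show "\<exists>l\<ge>0. \<exists>r d. eventually (\<lambda>n. d n \<in> clip_ball (Ds n) l r \<and>
     cnorm (As n) (p n (d n) \<ominus>\<^bsub>As n\<^esub> (x n \<otimes>\<^bsub>As n\<^esub> y n)) < e \<and> cnorm A (q n (d n) \<ominus>\<^bsub>A\<^esub> (a \<otimes>\<^bsub>A\<^esub> b)) < e) U"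
    by (intro exI[of _ "4 * A.leibniz_const k s"] conjI exI[of _ "4 * (s * s)"] exI[of _ "\<lambda>n. d n \<otimes>\<^bsub>Ds n\<^esub> d' n"])
qed (intro A.m_closed An.m_closed convD[OF x] convD[OF y])+

text \<open>The relation is closed under uniform approximation. Diagonal and density arguments end
  here, since they only produce nearby convergent sequences.\<close>

lemma conv_approx:
  assumes a: "a \<in> carrier A" and x: "\<And>n. x n \<in> carrier (As n)"
    and *: "\<And>e. 0 < e \<Longrightarrow> \<exists>y b. conv y b \<and> cnorm A (b \<ominus>\<^bsub>A\<^esub> a) < e \<and>
      eventually (\<lambda>n. cnorm (As n) (y n \<ominus>\<^bsub>As n\<^esub> x n) < e) U"
  shows "conv x a"
proof (rule convI[OF a x])
  fix e :: real assume "0 < e"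
  then have e2: "0 < e / 2" by simp
  from *[OF this] obtain y b where y: "conv y b" and b: "cnorm A (b \<ominus>\<^bsub>A\<^esub> a) < e / 2"
    and xy: "eventually (\<lambda>n. cnorm (As n) (y n \<ominus>\<^bsub>As n\<^esub> x n) < e / 2) U" by blast
  obtain l r d where l: "0 \<le> l" and d: "eventually (\<lambda>n. d n \<in> clip_ball (Ds n) l r \<and>
       cnorm (As n) (p n (d n) \<ominus>\<^bsub>As n\<^esub> y n) < e / 2 \<and> cnorm A (q n (d n) \<ominus>\<^bsub>A\<^esub> b) < e / 2) U"
    using y e2 by (rule convE)
  from d xy have "eventually (\<lambda>n. d n \<in> clip_ball (Ds n) l r \<and>
       cnorm (As n) (p n (d n) \<ominus>\<^bsub>As n\<^esub> x n) < e \<and> cnorm A (q n (d n) \<ominus>\<^bsub>A\<^esub> a) < e) U"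
  proof eventually_elim
    case (elim n)
    have dc: "d n \<in> carrier (Ds n)" using elim Dn.clip_ball_in by blast
    have "cnorm (As n) (p n (d n) \<ominus>\<^bsub>As n\<^esub> x n)
        \<le> cnorm (As n) (p n (d n) \<ominus>\<^bsub>As n\<^esub> y n) + cnorm (As n) (y n \<ominus>\<^bsub>As n\<^esub> x n)"
      by (intro An.cnorm_diff_triangle P.hom_in dc convD[OF y] x)
    moreover have "cnorm A (q n (d n) \<ominus>\<^bsub>A\<^esub> a) \<le> cnorm A (q n (d n) \<ominus>\<^bsub>A\<^esub> b) + cnorm A (b \<ominus>\<^bsub>A\<^esub> a)"
      by (intro A.cnorm_diff_triangle Q.hom_in dc convD[OF y] a)
    ultimately show ?case using elim b by auto
  qed
  with l show "\<exists>l\<ge>0. \<exists>r d. eventually (\<lambda>n. d n \<in> clip_ball (Ds n) l r \<and>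
     cnorm (As n) (p n (d n) \<ominus>\<^bsub>As n\<^esub> x n) < e \<and> cnorm A (q n (d n) \<ominus>\<^bsub>A\<^esub> a) < e) U"
    by blast
qed

text \<open>Norms converge along the relation, so the norm of the difference of the limits is the
  limit of the norms of the differences.\<close>

lemma conv_diff_unique:
  assumes x: "conv x a" and y: "conv y b"
    and lim: "((\<lambda>n. cnorm (As n) (x n \<ominus>\<^bsub>As n\<^esub> y n)) \<longlongrightarrow> 0) U"
  shows "a = b"
proof -
  have "cnorm A (a \<ominus>\<^bsub>A\<^esub> b) = 0"
    using tendsto_unique[OF U_bot conv_cnorm[OF conv_diff[OF x y]] lim] .
  then show ?thesis by (intro A.cnorm_diff_zero convD[OF x] convD[OF y]) simp
qed

lemma conv_unique:
  assumes x: "conv x a" and "conv x b"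
  shows "a = b"
  using assms by (rule conv_diff_unique) (simp add: An.diff_self[OF convD(2)[OF x]])

lemma conv_one: "conv (\<lambda>n. \<one>\<^bsub>As n\<^esub>) \<one>\<^bsub>A\<^esub>"
proof (rule convI)
  fix e :: real assume e: "0 < e"
  have "\<one>\<^bsub>Ds n\<^esub> \<in> clip_ball (Ds n) 0 1" for n
    by (intro Dn.lip_clip_ball Dn.lip_ball_one) simp_all
  then have "eventually (\<lambda>n. \<one>\<^bsub>Ds n\<^esub> \<in> clip_ball (Ds n) 0 1 \<and>
     cnorm (As n) (p n \<one>\<^bsub>Ds n\<^esub> \<ominus>\<^bsub>As n\<^esub> \<one>\<^bsub>As n\<^esub>) < e \<and> cnorm A (q n \<one>\<^bsub>Ds n\<^esub> \<ominus>\<^bsub>A\<^esub> \<one>\<^bsub>A\<^esub>) < e) U"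
    using e by (intro always_eventually) (simp add: P.unital Q.unital)
  then show "\<exists>l\<ge>0. \<exists>r d. eventually (\<lambda>n. d n \<in> clip_ball (Ds n) l r \<and>
     cnorm (As n) (p n (d n) \<ominus>\<^bsub>As n\<^esub> \<one>\<^bsub>As n\<^esub>) < e \<and> cnorm A (q n (d n) \<ominus>\<^bsub>A\<^esub> \<one>\<^bsub>A\<^esub>) < e) U"
    by (intro exI[of _ 0] conjI exI[of _ 1] exI[of _ "\<lambda>n. \<one>\<^bsub>Ds n\<^esub>"]) simp_all
qed (rule A.one_closed, rule An.one_closed)

text \<open>Each term is lifted to its tunnel at an extra seminorm cost of 1/(n+1);
  \<open>bound\<close> keeps the lifts bounded in norm, and their images in \<open>A\<close> have an
  ultralimit by compactness.\<close>

lemma lip_ball_conv: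
  assumes xc: "\<And>n. x n \<in> carrier (As n)"
    and x: "eventually (\<lambda>n. x n \<in> lip_ball (As n) l r) U" and l: "0 \<le> l"
  obtains b where "b \<in> lip_ball A l r" "conv x b"
proof -
  have ex: "\<exists>d. d \<in> sa (Ds n) \<and> p n d = x n \<and> lip (Ds n) d < ennreal (l + 1 / Suc n)"
    if xn: "x n \<in> lip_ball (As n) l r" for n
  proof -
    have "0 < l + 1 / Suc n" using l by (intro add_nonneg_pos) simp_all
    have "lip (As n) (x n) \<le> ennreal l" by (rule lip_ballD(2)[OF xn])
    also have "\<dots> < ennreal (l + 1 / Suc n)" using \<open>0 < l + 1 / Suc n\<close> by (rule ennreal_lessI) simp
    finally have "lip (As n) (x n) < ennreal (l + 1 / Suc n)" .
    from P.lip_lift[OF lip_ballD(1)[OF xn] this] show ?thesis by (simp only: Bex_def)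
  qed
  define d where "d n = (SOME d. d \<in> sa (Ds n) \<and> p n d = x n \<and> lip (Ds n) d < ennreal (l + 1 / Suc n))" for n
  have d: "d n \<in> sa (Ds n) \<and> p n (d n) = x n \<and> lip (Ds n) (d n) < ennreal (l + 1 / Suc n)"
    if "x n \<in> lip_ball (As n) l r" for n
    unfolding d_def by (rule someI_ex[OF ex[OF that]])
  have ev: "eventually (\<lambda>n. d n \<in> lip_ball (Ds n) (l + e) (r + 1) \<and> p n (d n) = x n) U"
    if e: "0 < e" for e
    using x bound eventually_less[OF zero_less_one, of "l + e"] eventually_Suc_less[OF e]
  proof eventually_elim
    case (elim n)
    note dn = d[OF elim(1)]
    have "lip (Ds n) (d n) < ennreal (l + 1 / Suc n)" using dn by blast
    also have "\<dots> \<le> ennreal (l + e)" using elim(4) by (intro ennreal_leI) simp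
    finally have lip: "lip (Ds n) (d n) \<le> ennreal (l + e)" by simp
    have "0 < l + e" using l e by simp
    from elim(2)[rule_format, OF this conjunct1[OF dn] lip]
    have "cnorm (Ds n) (d n) \<le> cnorm (As n) (p n (d n)) + (l + e) * \<eta> n" by (rule conjunct1)
    then have "cnorm (Ds n) (d n) \<le> r + 1" using elim(3) lip_ballD(3)[OF elim(1)] dn by simp
    with lip dn show ?case by (simp add: lip_ball_def)
  qed
  have "eventually (\<lambda>n. q n (d n) \<in> lip_ball A (l + 1) (r + 1)) U"
    using ev[OF zero_less_one] by eventually_elim (blast intro: Q.lip_ball_hom)
  moreover have "0 < l + 1" using l by simp
  ultimately obtain b where b: "b \<in> lip_ball A (l + 1) (r + 1)"
    and lim: "((\<lambda>n. cnorm A (q n (d n) \<ominus>\<^bsub>A\<^esub> b)) \<longlongrightarrow> 0) U"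
    by (rule A.lip_ball_ultralimit[OF U_bot ultra])
  have bc: "b \<in> carrier A" using A.sa_in[OF lip_ballD(1)[OF b]] .
  have conv: "conv x b"
  proof (rule convI[OF bc xc])
    fix e :: real assume e: "0 < e"
    have "eventually (\<lambda>n. d n \<in> clip_ball (Ds n) (l + 1) (r + 1) \<and>
       cnorm (As n) (p n (d n) \<ominus>\<^bsub>As n\<^esub> x n) < e \<and> cnorm A (q n (d n) \<ominus>\<^bsub>A\<^esub> b) < e) U"
      using ev[OF zero_less_one] order_tendstoD(2)[OF lim e]
    proof eventually_elim
      case (elim n)
      have "d n \<in> clip_ball (Ds n) (l + 1) (r + 1)"
        using elim(1) l by (intro Dn.lip_clip_ball) auto
      moreover have "cnorm (As n) (p n (d n) \<ominus>\<^bsub>As n\<^esub> x n) < e"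
        using elim(1) e by (simp add: An.diff_self[OF xc])
      ultimately show ?case using elim(2) by blast
    qed
    then show "\<exists>l\<ge>0. \<exists>r d. eventually (\<lambda>n. d n \<in> clip_ball (Ds n) l r \<and>
       cnorm (As n) (p n (d n) \<ominus>\<^bsub>As n\<^esub> x n) < e \<and> cnorm A (q n (d n) \<ominus>\<^bsub>A\<^esub> b) < e) U"
      using \<open>0 < l + 1\<close> less_imp_le by blast
  qed
  \<comment> \<open>The lifts are eventually in the ball of seminorm l + e for each e > 0;
    closedness of these balls and e tending to 0 restore the exact bound l.\<close>
  have "lip A b \<le> ennreal l + ennreal e" if e: "0 < e" for e
  proof -
    have "b \<in> lip_ball A (l + e) (r + 1)"
    proof (rule A.lip_ball_closed[OF bc])
      fix t :: real assume t: "0 < t"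
      have "eventually (\<lambda>n. q n (d n) \<in> lip_ball A (l + e) (r + 1) \<and> cnorm A (q n (d n) \<ominus>\<^bsub>A\<^esub> b) < t) U"
        using ev[OF e] order_tendstoD(2)[OF lim t] by eventually_elim (blast intro: Q.lip_ball_hom)
      from eventually_happens'[OF U_bot this] show "\<exists>a\<in>lip_ball A (l + e) (r + 1). cnorm A (a \<ominus>\<^bsub>A\<^esub> b) < t"
        by blast
    qed
    then show ?thesis using l e by (simp add: lip_ball_def)
  qed
  then have "lip A b \<le> ennreal l" by (rule ennreal_le_epsilon)
  moreover have "cnorm A b \<le> r"
  proof (rule tendsto_upperbound[OF conv_cnorm[OF conv] _ U_bot])
    show "eventually (\<lambda>n. cnorm (As n) (x n) \<le> r) U"
      using x by eventually_elim (rule lip_ballD(3))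
  qed
  ultimately have "b \<in> lip_ball A l r" using lip_ballD(1)[OF b] by (simp add: lip_ball_def)
  with conv that show thesis by blast
qed

text \<open>The converse passage, by lifting the single element \<open>a\<close> to every tunnel.
  The gap between \<open>l\<close> and \<open>l'\<close> pays for the unattained infimum, the 1 for
  the tunnel error in the norm.\<close>

lemma lip_ball_seq:
  assumes a: "a \<in> lip_ball A l r" and l: "0 \<le> l" "l < l'"
  obtains x where "conv x a" "eventually (\<lambda>n. x n \<in> lip_ball (As n) l' (r + 1)) U"
proof -
  have "lip A a \<le> ennreal l" by (rule lip_ballD(2)[OF a])
  also have "\<dots> < ennreal l'" using l by (intro ennreal_lessI) simp_all
  finally have al: "lip A a < ennreal l'" .
  define d where "d n = (SOME d. d \<in> sa (Ds n) \<and> q n d = a \<and> lip (Ds n) d < ennreal l')" for n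
  have "\<exists>d. d \<in> sa (Ds n) \<and> q n d = a \<and> lip (Ds n) d < ennreal l'" for n
    using Q.lip_lift[OF lip_ballD(1)[OF a] al, of n] by (simp only: Bex_def)
  then have "d n \<in> sa (Ds n) \<and> q n (d n) = a \<and> lip (Ds n) (d n) < ennreal l'" for n
    unfolding d_def by (rule someI_ex)
  then have d: "d n \<in> sa (Ds n)" "q n (d n) = a" "lip (Ds n) (d n) < ennreal l'" for n
    by simp_all
  have dc: "d n \<in> carrier (Ds n)" for n by (rule Dn.sa_in[OF d(1)])
  have dl: "lip (Ds n) (d n) \<le> ennreal l'" for n using d(3) by (rule less_imp_le)
  have l': "0 < l'" using l by simp
  have ev: "eventually (\<lambda>n. d n \<in> lip_ball (Ds n) l' (r + 1)) U"
    using bound eventually_less[OF zero_less_one, of l']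
  proof eventually_elim
    case (elim n)
    have "cnorm (Ds n) (d n) \<le> cnorm A (q n (d n)) + l' * \<eta> n"
      by (rule elim(1)[rule_format, OF l' d(1) dl, THEN conjunct2])
    then have "cnorm (Ds n) (d n) \<le> r + 1" using elim(2) lip_ballD(3)[OF a] d(2) by simp
    then show ?case using d(1) dl by (simp add: lip_ball_def)
  qed
  have ac: "a \<in> carrier A" by (rule A.sa_in[OF lip_ballD(1)[OF a]])
  have "conv (\<lambda>n. p n (d n)) a"
  proof (rule convI[OF ac P.hom_in[OF dc]])
    fix e :: real assume e: "0 < e"
    have "eventually (\<lambda>n. d n \<in> clip_ball (Ds n) l' (r + 1) \<and>
       cnorm (As n) (p n (d n) \<ominus>\<^bsub>As n\<^esub> p n (d n)) < e \<and> cnorm A (q n (d n) \<ominus>\<^bsub>A\<^esub> a) < e) U"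
      using ev
    proof eventually_elim
      case (elim n)
      have "d n \<in> clip_ball (Ds n) l' (r + 1)" using elim l' by (intro Dn.lip_clip_ball) auto
      then show ?case using e by (simp add: d(2) An.diff_self[OF P.hom_in[OF dc]] A.diff_self[OF ac])
    qed
    then show "\<exists>l\<ge>0. \<exists>r da. eventually (\<lambda>n. da n \<in> clip_ball (Ds n) l r \<and>
       cnorm (As n) (p n (da n) \<ominus>\<^bsub>As n\<^esub> p n (d n)) < e \<and> cnorm A (q n (da n) \<ominus>\<^bsub>A\<^esub> a) < e) U"
      using less_imp_le[OF l'] by blast
  qed
  moreover have "eventually (\<lambda>n. p n (d n) \<in> lip_ball (As n) l' (r + 1)) U"
    using ev by eventually_elim (rule P.lip_ball_hom)
  ultimately show thesis by (rule that)
qed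

lemma approx_conv:
  assumes a: "a \<in> carrier A" and e: "0 < e"
  shows "\<exists>x b. conv x b \<and> cnorm A (b \<ominus>\<^bsub>A\<^esub> a) < e"
proof -
  have *: "\<exists>x b. conv x b \<and> cnorm A (b \<ominus>\<^bsub>A\<^esub> u) < e / 2" if u: "u \<in> sa A" for u
  proof -
    have "0 < e / 2" using e by simp
    from A.lip_ball_dense[OF u this] obtain b l r where b: "b \<in> lip_ball A l r" "0 \<le> l" "cnorm A (b \<ominus>\<^bsub>A\<^esub> u) < e / 2"
      by blast
    obtain x where "conv x b" by (rule lip_ball_seq[OF b(1,2), of "l + 1"]) simp_all
    with b(3) show ?thesis by blast
  qed
  from *[OF A.re_sa[OF a]] obtain x b where x: "conv x b" "cnorm A (b \<ominus>\<^bsub>A\<^esub> A.re a) < e / 2" by blast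
  from *[OF A.im_sa[OF a]] obtain y c where y: "conv y c" "cnorm A (c \<ominus>\<^bsub>A\<^esub> A.im a) < e / 2" by blast
  have cc: "b \<in> carrier A" "c \<in> carrier A" "A.re a \<in> carrier A" "A.im a \<in> carrier A"
    by (rule convD(1)[OF x(1)], rule convD(1)[OF y(1)], rule A.re_im_in[OF a], rule A.re_im_in[OF a])
  have "cnorm A ((b \<oplus>\<^bsub>A\<^esub> \<i> \<odot>\<^bsub>A\<^esub> c) \<ominus>\<^bsub>A\<^esub> (A.re a \<oplus>\<^bsub>A\<^esub> \<i> \<odot>\<^bsub>A\<^esub> A.im a))
      \<le> cnorm A (b \<ominus>\<^bsub>A\<^esub> A.re a) + cnorm A (\<i> \<odot>\<^bsub>A\<^esub> c \<ominus>\<^bsub>A\<^esub> \<i> \<odot>\<^bsub>A\<^esub> A.im a)"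
    by (intro A.cnorm_add_diff A.smult_in cc)
  also have "cnorm A (\<i> \<odot>\<^bsub>A\<^esub> c \<ominus>\<^bsub>A\<^esub> \<i> \<odot>\<^bsub>A\<^esub> A.im a) = cnorm A (c \<ominus>\<^bsub>A\<^esub> A.im a)"
    using A.cnorm_smult_diff[OF cc(2,4), of \<i>] by simp
  finally have "cnorm A ((b \<oplus>\<^bsub>A\<^esub> \<i> \<odot>\<^bsub>A\<^esub> c) \<ominus>\<^bsub>A\<^esub> a) < e"
    unfolding A.re_im[OF a] using x(2) y(2) by linarith
  with conv_add[OF x(1) conv_smult[OF y(1), of \<i>]] show ?thesis by blast
qed

text \<open>A diagonal sequence: at \<open>n\<close> the best approximant is used whose index is at most \<open>n\<close> and which
  is already compatible at \<open>n\<close> with all coarser ones.\<close>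

lemma conv_total:
  assumes a: "a \<in> carrier A"
  obtains x where "conv x a"
proof -
  define e :: "nat \<Rightarrow> real" where "e k = 1 / Suc k" for k
  have e0: "0 < e k" for k by (simp add: e_def)
  have e_mono: "e k \<le> e j" if "j \<le> k" for j k using that by (simp add: e_def frac_le)
  have "\<exists>f. conv (fst f) (snd f) \<and> cnorm A (snd f \<ominus>\<^bsub>A\<^esub> a) < e k" for k
    using approx_conv[OF a e0[of k]] by (simp only: split_paired_Ex fst_conv snd_conv)
  then have "\<exists>f. \<forall>k. conv (fst (f k)) (snd (f k)) \<and> cnorm A (snd (f k) \<ominus>\<^bsub>A\<^esub> a) < e k"
    by (intro choice allI)
  then obtain f where f: "\<forall>k. conv (fst (f k)) (snd (f k)) \<and> cnorm A (snd (f k) \<ominus>\<^bsub>A\<^esub> a) < e k"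
    by (rule exE)
  define Z B where "Z k = fst (f k)" and "B k = snd (f k)" for k
  have Z: "conv (Z k) (B k)" and B: "cnorm A (B k \<ominus>\<^bsub>A\<^esub> a) < e k" for k
    using f by (simp_all add: Z_def B_def)
  have BB: "cnorm A (B j \<ominus>\<^bsub>A\<^esub> B k) < 2 * e j" if "j \<le> k" for j k
    using A.cnorm_diff_triangle[OF convD(1)[OF Z[of j]] a convD(1)[OF Z[of k]]]
      A.cnorm_diff_commute[OF a convD(1)[OF Z[of k]]] B[of j] B[of k] e_mono[OF that] by linarith
  define good where "good n k \<longleftrightarrow> (\<forall>j\<le>k. cnorm (As n) (Z j n \<ominus>\<^bsub>As n\<^esub> Z k n) \<le> 2 * e j)" for n k
  define m where "m n = Max {k. k \<le> n \<and> good n k}" for n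
  have "good n 0" for n by (simp add: good_def An.diff_self[OF convD(2)[OF Z]] e_def)
  then have "{k. k \<le> n \<and> good n k} \<noteq> {}" for n by blast
  moreover have fin: "finite {k. k \<le> n \<and> good n k}" for n by simp
  ultimately have "m n \<in> {k. k \<le> n \<and> good n k}" for n unfolding m_def by (rule Max_in[rotated])
  then have m: "good n (m n)" for n by simp
  have "conv (\<lambda>n. Z (m n) n) a"
  proof (rule conv_approx[OF a convD(2)[OF Z]])
    fix t :: real assume "0 < t"
    then have "0 < t / 3" by simp
    then obtain K where "inverse (real (Suc K)) < t / 3" using reals_Archimedean by blast
    then have "e K < t / 3" by (simp add: e_def inverse_eq_divide)
    then have K: "2 * e K < t" "e K < t" using e0[of K] by linarith+
    \<comment> \<open>By \<open>BB\<close> the limits are strictly closer than the threshold, so for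
      almost all n each of the finitely many j <= K is compatible with K; then K competes in the
      maximum and \<open>m n\<close> is at least K.\<close>
    have "eventually (\<lambda>n. cnorm (As n) (Z j n \<ominus>\<^bsub>As n\<^esub> Z K n) < 2 * e j) U" if "j \<le> K" for j
      by (rule order_tendstoD(2)[OF conv_cnorm[OF conv_diff[OF Z Z]] BB[OF that]])
    then have "eventually (\<lambda>n. \<forall>j\<in>{..K}. cnorm (As n) (Z j n \<ominus>\<^bsub>As n\<^esub> Z K n) < 2 * e j) U"
      by (intro eventually_ball_finite) auto
    moreover have "eventually (\<lambda>n. K \<le> n) U"
      by (rule filter_leD[OF U_seq eventually_ge_at_top])
    ultimately have "eventually (\<lambda>n. cnorm (As n) (Z K n \<ominus>\<^bsub>As n\<^esub> Z (m n) n) < t) U"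
    proof eventually_elim
      case (elim n)
      then have "K \<in> {k. k \<le> n \<and> good n k}" by (auto simp: good_def intro: less_imp_le)
      then have "K \<le> m n" unfolding m_def using fin by (intro Max_ge)
      then have "cnorm (As n) (Z K n \<ominus>\<^bsub>As n\<^esub> Z (m n) n) \<le> 2 * e K" using m[of n] by (simp add: good_def)
      with K show ?case by linarith
    qed
    then show "\<exists>y b. conv y b \<and> cnorm A (b \<ominus>\<^bsub>A\<^esub> a) < t \<and>
      eventually (\<lambda>n. cnorm (As n) (y n \<ominus>\<^bsub>As n\<^esub> Z (m n) n) < t) U"
      using Z B[of K] K(2) less_trans by blast
  qed
  with that show thesis by blast
qed

text \<open>Approximants with Lipschitz bounds are mapped into Lipschitz balls, where ultralimits
  exist. The limits form a Cauchy sequence because the maps are uniformly bounded, and its limit is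
  the one sought.\<close>

lemma conv_op:
  assumes lin: "\<And>n. linear_map (As n) (As n) (S n)" and C: "0 \<le> C"
    and norm: "\<And>n x. x \<in> carrier (As n) \<Longrightarrow> cnorm (As n) (S n x) \<le> C * cnorm (As n) x"
    and lip: "\<And>n l r a. \<lbrakk>a \<in> lip_ball (As n) l r; 0 \<le> l\<rbrakk> \<Longrightarrow> S n a \<in> lip_ball (As n) (C * l) (C * r)"
    and x: "conv x a"
  shows "\<exists>b. conv (\<lambda>n. S n (x n)) b"
proof -
  have Sc: "S n y \<in> carrier (As n)" if "y \<in> carrier (As n)" for n y
    using lin[of n] that unfolding linear_map_def by blast
  have Sadd: "S n (y \<oplus>\<^bsub>As n\<^esub> z) = S n y \<oplus>\<^bsub>As n\<^esub> S n z" if "y \<in> carrier (As n)" "z \<in> carrier (As n)" for n y z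
    using lin[of n] that unfolding linear_map_def by blast
  have Ssmult: "S n (c \<odot>\<^bsub>As n\<^esub> y) = c \<odot>\<^bsub>As n\<^esub> S n y" if "y \<in> carrier (As n)" for n y c
    using lin[of n] that unfolding linear_map_def by blast
  have Sdiff: "S n (y \<ominus>\<^bsub>As n\<^esub> z) = S n y \<ominus>\<^bsub>As n\<^esub> S n z" if "y \<in> carrier (As n)" "z \<in> carrier (As n)" for n y z
  proof -
    have "\<ominus>\<^bsub>As n\<^esub> w = (-1) \<odot>\<^bsub>As n\<^esub> w" if "w \<in> carrier (As n)" for w
      using An.smult_uminus_l[OF that, of 1] An.smult_1[OF that] by simp
    then show ?thesis
      using that Sadd[OF that(1) An.smult_in[OF that(2), of "-1"]] Ssmult[OF that(2), of "-1"] Sc[OF that(2)]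
      by (simp add: An.minus_eq)
  qed
  define e :: "nat \<Rightarrow> real" where "e k = 1 / Suc k" for k
  have e0: "0 < e k" for k by (simp add: e_def)
  have e_mono: "e k \<le> e j" if "j \<le> k" for j k using that by (simp add: e_def frac_le)
  have elim_e: "\<exists>k. c * e k < t" if "0 < t" "0 \<le> c" for c t
  proof -
    obtain k where "inverse (real (Suc k)) < t / (c + 1)"
      using reals_Archimedean[of "t / (c + 1)"] \<open>0 < t\<close> \<open>0 \<le> c\<close> by auto
    then have "(c + 1) * e k < t"
      using \<open>0 \<le> c\<close> by (simp add: e_def inverse_eq_divide pos_less_divide_eq mult.commute)
    moreover have "c * e k \<le> (c + 1) * e k" using e0[of k] by (intro mult_right_mono) auto
    ultimately show ?thesis by (intro exI[of _ k]) linarith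
  qed
  have "\<exists>f. conv (\<lambda>n. S n (fst f n)) (snd f) \<and> (\<forall>n. fst f n \<in> carrier (As n)) \<and>
      eventually (\<lambda>n. cnorm (As n) (fst f n \<ominus>\<^bsub>As n\<^esub> x n) < e k) U" for k
  proof -
    obtain l r d where l: "0 \<le> l" and d: "eventually (\<lambda>n. d n \<in> clip_ball (Ds n) l r \<and>
         cnorm (As n) (p n (d n) \<ominus>\<^bsub>As n\<^esub> x n) < e k \<and> cnorm A (q n (d n) \<ominus>\<^bsub>A\<^esub> a) < e k) U"
      using x e0 by (rule convE)
    \<comment> \<open>The value zero off the good indices keeps the sequence in the carriers for all
      n, as the convergence lemmas demand.\<close>
    define y where "y n = (if d n \<in> clip_ball (Ds n) l r then p n (d n) else \<zero>\<^bsub>As n\<^esub>)" for n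
    have yc: "y n \<in> carrier (As n)" for n
      using P.hom_in[OF Dn.clip_ball_in] by (simp add: y_def)
    let ?u = "\<lambda>n. unital_cstar_algebra.re (As n) (y n)" and ?v = "\<lambda>n. unital_cstar_algebra.im (As n) (y n)"
    have uv: "eventually (\<lambda>n. ?u n \<in> lip_ball (As n) l r \<and> ?v n \<in> lip_ball (As n) l r) U"
      using d
    proof eventually_elim
      case (elim n)
      then have "y n \<in> clip_ball (As n) l r" using P.clip_ball_hom by (simp add: y_def)
      then obtain u v where uv: "u \<in> lip_ball (As n) l r" "v \<in> lip_ball (As n) l r" "y n = u \<oplus>\<^bsub>As n\<^esub> \<i> \<odot>\<^bsub>As n\<^esub> v"
        by (rule clip_ballE)
      show ?case unfolding uv(3) An.re_im_unique[OF lip_ballD(1)[OF uv(1)] lip_ballD(1)[OF uv(2)]]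
        using uv by blast
    qed
    have Cl: "0 \<le> C * l" using C l by (rule mult_nonneg_nonneg)
    have "eventually (\<lambda>n. S n (?u n) \<in> lip_ball (As n) (C * l) (C * r)) U"
      using uv by eventually_elim (rule lip[OF conjunct1 l])
    then obtain b1 where b1: "conv (\<lambda>n. S n (?u n)) b1"
      by (rule lip_ball_conv[OF Sc[OF An.re_im_in(1)[OF yc]] _ Cl]) (rule that)
    have "eventually (\<lambda>n. S n (?v n) \<in> lip_ball (As n) (C * l) (C * r)) U"
      using uv by eventually_elim (rule lip[OF conjunct2 l])
    then obtain b2 where b2: "conv (\<lambda>n. S n (?v n)) b2"
      by (rule lip_ball_conv[OF Sc[OF An.re_im_in(2)[OF yc]] _ Cl]) (rule that)
    have "S n (?u n) \<oplus>\<^bsub>As n\<^esub> \<i> \<odot>\<^bsub>As n\<^esub> S n (?v n) = S n (y n)" for n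
      using Sadd[OF An.re_im_in(1)[OF yc] An.smult_in[OF An.re_im_in(2)[OF yc], of n \<i>]]
        Ssmult[OF An.re_im_in(2)[OF yc], of n \<i>] An.re_im[OF yc, of n] by simp
    with conv_add[OF b1 conv_smult[OF b2, of \<i>]] have "conv (\<lambda>n. S n (y n)) (b1 \<oplus>\<^bsub>A\<^esub> \<i> \<odot>\<^bsub>A\<^esub> b2)" by simp
    moreover have "eventually (\<lambda>n. cnorm (As n) (y n \<ominus>\<^bsub>As n\<^esub> x n) < e k) U"
      using d by eventually_elim (simp add: y_def)
    ultimately show ?thesis using yc by (intro exI[of _ "(y, b1 \<oplus>\<^bsub>A\<^esub> \<i> \<odot>\<^bsub>A\<^esub> b2)"]) simp
  qed
  then have "\<exists>f. \<forall>k. conv (\<lambda>n. S n (fst (f k) n)) (snd (f k)) \<and> (\<forall>n. fst (f k) n \<in> carrier (As n)) \<and>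
      eventually (\<lambda>n. cnorm (As n) (fst (f k) n \<ominus>\<^bsub>As n\<^esub> x n) < e k) U"
    by (intro choice allI)
  then obtain f where f: "\<forall>k. conv (\<lambda>n. S n (fst (f k) n)) (snd (f k)) \<and> (\<forall>n. fst (f k) n \<in> carrier (As n)) \<and>
      eventually (\<lambda>n. cnorm (As n) (fst (f k) n \<ominus>\<^bsub>As n\<^esub> x n) < e k) U"
    by (rule exE)
  define Y B where "Y k = fst (f k)" and "B k = snd (f k)" for k
  have Y: "conv (\<lambda>n. S n (Y k n)) (B k)" and Yc: "Y k n \<in> carrier (As n)"
    and Yx: "eventually (\<lambda>n. cnorm (As n) (Y k n \<ominus>\<^bsub>As n\<^esub> x n) < e k) U" for k n
    using f by (simp_all add: Y_def B_def)
  \<comment> \<open>Both approximants are near \<open>x\<close>, and the maps enlarge norms at most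
    by C; convergence of norms carries the estimate to the limits.\<close>
  have BB: "cnorm A (B j \<ominus>\<^bsub>A\<^esub> B k) \<le> C * (e j + e k)" for j k
  proof (rule tendsto_upperbound[OF conv_cnorm[OF conv_diff[OF Y Y]] _ U_bot])
    show "eventually (\<lambda>n. cnorm (As n) (S n (Y j n) \<ominus>\<^bsub>As n\<^esub> S n (Y k n)) \<le> C * (e j + e k)) U"
      using Yx[of j] Yx[of k]
    proof eventually_elim
      case (elim n)
      have "cnorm (As n) (S n (Y j n) \<ominus>\<^bsub>As n\<^esub> S n (Y k n)) \<le> C * cnorm (As n) (Y j n \<ominus>\<^bsub>As n\<^esub> Y k n)"
        unfolding Sdiff[OF Yc Yc, symmetric] by (rule norm[OF An.minus_closed[OF Yc Yc]])
      also have "cnorm (As n) (Y j n \<ominus>\<^bsub>As n\<^esub> Y k n) \<le> e j + e k"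
        using An.cnorm_diff_triangle[OF Yc convD(2)[OF x] Yc, of n j k]
          An.cnorm_diff_commute[OF convD(2)[OF x] Yc, of n k] elim by linarith
      finally show ?case using C by (simp add: mult_left_mono)
    qed
  qed
  have "\<exists>N. \<forall>m\<ge>N. \<forall>n\<ge>N. cnorm A (B m \<ominus>\<^bsub>A\<^esub> B n) < t" if t: "0 < t" for t
  proof -
    obtain N where N: "(2 * C) * e N < t" using elim_e[OF t, of "2 * C"] C by auto
    have "cnorm A (B m \<ominus>\<^bsub>A\<^esub> B n) < t" if "N \<le> m" "N \<le> n" for m n
    proof -
      have "C * (e m + e n) \<le> C * (e N + e N)"
        using e_mono[OF that(1)] e_mono[OF that(2)] C by (intro mult_left_mono) auto
      then show ?thesis using BB[of m n] N by (simp add: algebra_simps)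
    qed
    then show ?thesis by blast
  qed
  then obtain b where b: "b \<in> carrier A" and lim: "(\<lambda>n. cnorm A (B n \<ominus>\<^bsub>A\<^esub> b)) \<longlonglongrightarrow> 0"
    using A.complete_sequence[of B] convD(1)[OF Y] by blast
  have "conv (\<lambda>n. S n (x n)) b"
  proof (rule conv_approx[OF b Sc[OF convD(2)[OF x]]])
    fix t :: real assume t: "0 < t"
    obtain k0 where k0: "C * e k0 < t" using elim_e[OF t C] by blast
    have "eventually (\<lambda>k. cnorm A (B k \<ominus>\<^bsub>A\<^esub> b) < t) sequentially" using order_tendstoD(2)[OF lim t] .
    with eventually_ge_at_top[of k0] have "eventually (\<lambda>k. k0 \<le> k \<and> cnorm A (B k \<ominus>\<^bsub>A\<^esub> b) < t) sequentially"
      by eventually_elim blast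
    from eventually_happens'[OF sequentially_bot this] obtain k where k: "k0 \<le> k" "cnorm A (B k \<ominus>\<^bsub>A\<^esub> b) < t" by blast
    have "eventually (\<lambda>n. cnorm (As n) (S n (Y k n) \<ominus>\<^bsub>As n\<^esub> S n (x n)) < t) U"
      using Yx[of k]
    proof eventually_elim
      case (elim n)
      have "cnorm (As n) (S n (Y k n) \<ominus>\<^bsub>As n\<^esub> S n (x n)) \<le> C * cnorm (As n) (Y k n \<ominus>\<^bsub>As n\<^esub> x n)"
        unfolding Sdiff[OF Yc convD(2)[OF x], symmetric] by (rule norm[OF An.minus_closed[OF Yc convD(2)[OF x]]])
      also have "\<dots> \<le> C * e k0" using elim e_mono[OF k(1)] C by (intro mult_left_mono) auto
      finally show ?case using k0 by linarith
    qed
    then show "\<exists>y b'. conv y b' \<and> cnorm A (b' \<ominus>\<^bsub>A\<^esub> b) < t \<and>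
      eventually (\<lambda>n. cnorm (As n) (y n \<ominus>\<^bsub>As n\<^esub> S n (x n)) < t) U"
      using Y[of k] k(2) by blast
  qed
  then show ?thesis by blast
qed

end

section \<open>Limits of linear maps\<close>

lemma linear_mapD:
  assumes "linear_map A B f"
  shows "x \<in> carrier A \<Longrightarrow> f x \<in> carrier B"
    and "\<lbrakk>x \<in> carrier A; y \<in> carrier A\<rbrakk> \<Longrightarrow> f (x \<oplus>\<^bsub>A\<^esub> y) = f x \<oplus>\<^bsub>B\<^esub> f y"
    and "x \<in> carrier A \<Longrightarrow> f (c \<odot>\<^bsub>A\<^esub> x) = c \<odot>\<^bsub>B\<^esub> f x"
  using assms unfolding linear_map_def by blast+

lemma linear_map_diff:
  assumes A: "unital_cstar_algebra A" and B: "unital_cstar_algebra B" and f: "linear_map A B f"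
    and x: "x \<in> carrier A" and y: "y \<in> carrier A"
  shows "f (x \<ominus>\<^bsub>A\<^esub> y) = f x \<ominus>\<^bsub>B\<^esub> f y"
proof -
  interpret A: unital_cstar_algebra A by (rule A)
  interpret B: unital_cstar_algebra B by (rule B)
  note fy = linear_mapD(1)[OF f y]
  have 1: "\<ominus>\<^bsub>A\<^esub> y = (-1) \<odot>\<^bsub>A\<^esub> y" using A.smult_uminus_l[OF y, of 1] y by simp
  have 2: "\<ominus>\<^bsub>B\<^esub> f y = (-1) \<odot>\<^bsub>B\<^esub> f y" using B.smult_uminus_l[OF fy, of 1] fy by simp
  show ?thesis
    unfolding A.minus_eq B.minus_eq 1 2 linear_mapD(2)[OF f x A.smult_in[OF y]] linear_mapD(3)[OF f y] ..
qed

lemma (in unital_cstar_algebra) op_norm_le_iff: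
  assumes f: "linear_map A A f" and C: "0 \<le> C"
  shows "op_norm A f \<le> ennreal C \<longleftrightarrow> (\<forall>x\<in>carrier A. cnorm A (f x) \<le> C * cnorm A x)"
proof
  assume le: "op_norm A f \<le> ennreal C"
  show "\<forall>x\<in>carrier A. cnorm A (f x) \<le> C * cnorm A x"
  proof
    fix x assume x: "x \<in> carrier A"
    note fx = linear_mapD(1)[OF f x]
    show "cnorm A (f x) \<le> C * cnorm A x"
    proof (cases "x = \<zero>")
      case True
      have "f \<zero> = \<zero>" using linear_mapD(3)[OF f x, of 0] x fx by simp
      then show ?thesis by (simp add: True)
    next
      case False
      then have n: "0 < cnorm A x" using cnorm_nonneg[OF x] cnorm_eq_zero[OF x] by simp
      let ?y = "complex_of_real (1 / cnorm A x) \<odot> x"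
      have "?y \<in> {a \<in> carrier A. cnorm A a \<le> 1}" using n x by (simp add: cnorm_smult norm_divide)
      then have "ennreal (cnorm A (f ?y)) \<le> op_norm A f" unfolding op_norm_def by (rule SUP_upper)
      then have "ennreal (cnorm A (f ?y)) \<le> ennreal C" using le by (rule order_trans)
      then have "cnorm A (f ?y) \<le> C" using C by simp
      moreover have "cnorm A (f ?y) = cnorm A (f x) / cnorm A x"
        unfolding linear_mapD(3)[OF f x] using fx n by (simp add: cnorm_smult norm_divide)
      ultimately show ?thesis using n by (simp add: pos_divide_le_eq)
    qed
  qed
next
  assume le: "\<forall>x\<in>carrier A. cnorm A (f x) \<le> C * cnorm A x"
  show "op_norm A f \<le> ennreal C"
    unfolding op_norm_def
  proof (rule SUP_least)
    fix x assume "x \<in> {a \<in> carrier A. cnorm A a \<le> 1}"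
    then have x: "x \<in> carrier A" "cnorm A x \<le> 1" by simp_all
    have "cnorm A (f x) \<le> C * cnorm A x" using le x by blast
    also have "\<dots> \<le> C * 1" using x C by (intro mult_left_mono)
    finally show "ennreal (cnorm A (f x)) \<le> ennreal C" by (simp add: ennreal_leI)
  qed
qed

text \<open>Removes slack from both factors at once, also when \<open>x\<close> could a priori be
  infinite.\<close>

lemma le_limit_product:
  fixes x :: ennreal
  assumes "\<And>e. 0 < e \<Longrightarrow> x \<le> ennreal ((c + e) * (l + e))"
  shows "x \<le> ennreal (c * l)"
proof (rule tendsto_lowerbound)
  have "(\<lambda>n. (c + 1 / Suc n) * (l + 1 / Suc n)) \<longlonglongrightarrow> (c + 0) * (l + 0)"
    by (intro tendsto_mult tendsto_add tendsto_const LIMSEQ_Suc[OF lim_1_over_n])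
  then show "(\<lambda>n. ennreal ((c + 1 / Suc n) * (l + 1 / Suc n))) \<longlonglongrightarrow> ennreal (c * l)"
    by (intro tendsto_ennrealI) simp
  show "eventually (\<lambda>n. x \<le> ennreal ((c + 1 / Suc n) * (l + 1 / Suc n))) sequentially"
    by (intro always_eventually allI assms) simp
qed simp

context tunnel_sequence
begin

text \<open>One constant for all n serves to make limits exist. Sharper bounds varying with n are
  treated separately and pass to the limit.\<close>

definition equi :: "(nat \<Rightarrow> 'a \<Rightarrow> 'a) \<Rightarrow> real \<Rightarrow> bool" where
  "equi S C \<longleftrightarrow> 0 \<le> C \<and> (\<forall>n. linear_map (As n) (As n) (S n)) \<and>
     (\<forall>n. \<forall>x\<in>carrier (As n). cnorm (As n) (S n x) \<le> C * cnorm (As n) x) \<and>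
     (\<forall>n l r a. a \<in> lip_ball (As n) l r \<longrightarrow> 0 \<le> l \<longrightarrow> S n a \<in> lip_ball (As n) (C * l) (C * r))"

lemma equiD:
  assumes "equi S C"
  shows "0 \<le> C" and "linear_map (As n) (As n) (S n)"
    and "x \<in> carrier (As n) \<Longrightarrow> cnorm (As n) (S n x) \<le> C * cnorm (As n) x"
    and "\<lbrakk>a \<in> lip_ball (As n) l r; 0 \<le> l\<rbrakk> \<Longrightarrow> S n a \<in> lip_ball (As n) (C * l) (C * r)"
  using assms unfolding equi_def by blast+

lemma equi_in: "\<lbrakk>equi S C; x \<in> carrier (As n)\<rbrakk> \<Longrightarrow> S n x \<in> carrier (As n)"
  by (rule linear_mapD(1)[OF equiD(2)])

lemma equi_diff: "\<lbrakk>equi S C; x \<in> carrier (As n); y \<in> carrier (As n)\<rbrakk> \<Longrightarrow>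
    S n (x \<ominus>\<^bsub>As n\<^esub> y) = S n x \<ominus>\<^bsub>As n\<^esub> S n y"
  by (rule linear_map_diff[OF An.unital_cstar_algebra_axioms An.unital_cstar_algebra_axioms equiD(2)])

lemma equi_conv:
  assumes S: "equi S C" and x: "conv x a" and y: "conv y a"
  shows "((\<lambda>n. cnorm (As n) (S n (x n) \<ominus>\<^bsub>As n\<^esub> S n (y n))) \<longlongrightarrow> 0) U"
proof (rule Lim_null_comparison)
  have "((\<lambda>n. cnorm (As n) (x n \<ominus>\<^bsub>As n\<^esub> y n)) \<longlongrightarrow> cnorm A (a \<ominus>\<^bsub>A\<^esub> a)) U"
    by (rule conv_cnorm[OF conv_diff[OF x y]])
  then have "((\<lambda>n. cnorm (As n) (x n \<ominus>\<^bsub>As n\<^esub> y n)) \<longlongrightarrow> 0) U"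
    by (simp add: A.diff_self[OF convD(1)[OF x]])
  then show "((\<lambda>n. C * cnorm (As n) (x n \<ominus>\<^bsub>As n\<^esub> y n)) \<longlongrightarrow> 0) U"
    by (rule tendsto_mult_right_zero)
  show "eventually (\<lambda>n. norm (cnorm (As n) (S n (x n) \<ominus>\<^bsub>As n\<^esub> S n (y n))) \<le> C * cnorm (As n) (x n \<ominus>\<^bsub>As n\<^esub> y n)) U"
  proof (intro always_eventually allI)
    fix n
    note c = convD(2)[OF x, of n] convD(2)[OF y, of n]
    have "cnorm (As n) (S n (x n) \<ominus>\<^bsub>As n\<^esub> S n (y n)) \<le> C * cnorm (As n) (x n \<ominus>\<^bsub>As n\<^esub> y n)"
      unfolding equi_diff[OF S c, symmetric] by (rule equiD(3)[OF S An.minus_closed[OF c]])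
    moreover have "0 \<le> cnorm (As n) (S n (x n) \<ominus>\<^bsub>As n\<^esub> S n (y n))"
      by (intro An.cnorm_nonneg An.minus_closed equi_in[OF S] c)
    ultimately show "norm (cnorm (As n) (S n (x n) \<ominus>\<^bsub>As n\<^esub> S n (y n))) \<le> C * cnorm (As n) (x n \<ominus>\<^bsub>As n\<^esub> y n)"
      by simp
  qed
qed

text \<open>Independence of the representing sequence is \<open>equi_conv\<close>; existence is
  \<open>conv_total\<close> with \<open>conv_op\<close>.\<close>

definition lim_op :: "(nat \<Rightarrow> 'a \<Rightarrow> 'a) \<Rightarrow> 'a \<Rightarrow> 'a" where
  "lim_op S a = (THE b. \<exists>x. conv x a \<and> conv (\<lambda>n. S n (x n)) b)"

lemma lim_op:
  assumes S: "equi S C" and x: "conv x a"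
  shows "conv (\<lambda>n. S n (x n)) (lim_op S a)"
proof -
  obtain b where b: "conv (\<lambda>n. S n (x n)) b"
    using conv_op[OF equiD(2)[OF S] equiD(1)[OF S] equiD(3)[OF S] equiD(4)[OF S] x] by (rule exE)
  have "lim_op S a = b"
    unfolding lim_op_def
  proof (rule the_equality)
    show "\<exists>x. conv x a \<and> conv (\<lambda>n. S n (x n)) b" using x b by (intro exI[of _ x] conjI)
    fix b' assume "\<exists>x. conv x a \<and> conv (\<lambda>n. S n (x n)) b'"
    then obtain y where y: "conv y a" "conv (\<lambda>n. S n (y n)) b'" by (elim exE conjE)
    show "b' = b" by (rule conv_diff_unique[OF y(2) b equi_conv[OF S y(1) x]])
  qed
  with b show ?thesis by simp
qed

lemma lim_op_in: "\<lbrakk>equi S C; a \<in> carrier A\<rbrakk> \<Longrightarrow> lim_op S a \<in> carrier A"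
proof -
  assume S: "equi S C" and a: "a \<in> carrier A"
  obtain x where "conv x a" using a by (rule conv_total)
  from convD(1)[OF lim_op[OF S this]] show ?thesis .
qed

lemma lim_op_eqI:
  assumes S: "equi S C" and x: "conv x a" and b: "conv (\<lambda>n. S n (x n)) b"
  shows "lim_op S a = b"
  by (rule conv_unique[OF lim_op[OF S x] b])

lemma lim_op_linear:
  assumes S: "equi S C"
  shows "linear_map A A (lim_op S)"
  unfolding linear_map_def
proof (intro conjI ballI allI)
  show "lim_op S \<in> carrier A \<rightarrow> carrier A" using lim_op_in[OF S] by (rule funcsetI)
next
  fix a b assume a: "a \<in> carrier A" and b: "b \<in> carrier A"
  obtain x where x: "conv x a" using a by (rule conv_total)
  obtain y where y: "conv y b" using b by (rule conv_total)
  show "lim_op S (a \<oplus>\<^bsub>A\<^esub> b) = lim_op S a \<oplus>\<^bsub>A\<^esub> lim_op S b"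
  proof (rule lim_op_eqI[OF S conv_add[OF x y]])
    show "conv (\<lambda>n. S n (x n \<oplus>\<^bsub>As n\<^esub> y n)) (lim_op S a \<oplus>\<^bsub>A\<^esub> lim_op S b)"
      unfolding linear_mapD(2)[OF equiD(2)[OF S] convD(2)[OF x] convD(2)[OF y]]
      by (rule conv_add[OF lim_op[OF S x] lim_op[OF S y]])
  qed
next
  fix c a assume a: "a \<in> carrier A"
  obtain x where x: "conv x a" using a by (rule conv_total)
  show "lim_op S (c \<odot>\<^bsub>A\<^esub> a) = c \<odot>\<^bsub>A\<^esub> lim_op S a"
  proof (rule lim_op_eqI[OF S conv_smult[OF x]])
    show "conv (\<lambda>n. S n (c \<odot>\<^bsub>As n\<^esub> x n)) (c \<odot>\<^bsub>A\<^esub> lim_op S a)"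
      unfolding linear_mapD(3)[OF equiD(2)[OF S] convD(2)[OF x]]
      by (rule conv_smult[OF lim_op[OF S x]])
  qed
qed

lemma lim_op_one:
  assumes S: "equi S C" and one: "\<And>n. S n \<one>\<^bsub>As n\<^esub> = \<one>\<^bsub>As n\<^esub>"
  shows "lim_op S \<one>\<^bsub>A\<^esub> = \<one>\<^bsub>A\<^esub>"
  by (rule lim_op_eqI[OF S conv_one]) (simp only: one conv_one)

text \<open>The limit inherits the limit of the individual bounds, not the coarse constant
  \<open>C\<close>. This is how D(g) itself, rather than its maximum, reappears.\<close>

lemma lim_op_cnorm:
  assumes S: "equi S C" and c: "(c \<longlongrightarrow> c0) U"
    and le: "\<And>n x. x \<in> carrier (As n) \<Longrightarrow> cnorm (As n) (S n x) \<le> c n * cnorm (As n) x"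
    and a: "a \<in> carrier A"
  shows "cnorm A (lim_op S a) \<le> c0 * cnorm A a"
proof -
  obtain x where x: "conv x a" using a by (rule conv_total)
  show ?thesis
  proof (rule tendsto_le[OF U_bot tendsto_mult[OF c conv_cnorm[OF x]] conv_cnorm[OF lim_op[OF S x]]])
    show "eventually (\<lambda>n. cnorm (As n) (S n (x n)) \<le> c n * cnorm (As n) (x n)) U"
      by (intro always_eventually allI le convD(2)[OF x])
  qed
qed

text \<open>Representing sequences have seminorm at most l + e, and c n is eventually below c0 + e;
  the product of the two slacks is removed at the end.\<close>

lemma lim_op_lip:
  assumes S: "equi S C" and c: "(c \<longlongrightarrow> c0) U" and c0: "0 \<le> c0"
    and le: "\<And>n y. y \<in> ldom (As n) \<Longrightarrow> lip (As n) (S n y) \<le> ennreal (c n) * lip (As n) y"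
    and a: "a \<in> lip_ball A l r" and l: "0 \<le> l"
  shows "lim_op S a \<in> sa A" and "lip A (lim_op S a) \<le> ennreal (c0 * l)"
proof -
  have *: "lim_op S a \<in> lip_ball A ((c0 + e) * (l + e)) (C * (r + 1))" if e: "0 < e" for e
  proof -
    have "l < l + e" using e by simp
    then obtain x where x: "conv x a" and xl: "eventually (\<lambda>n. x n \<in> lip_ball (As n) (l + e) (r + 1)) U"
      by (rule lip_ball_seq[OF a l]) (rule that)
    have pos: "0 \<le> (c0 + e) * (l + e)" using c0 l e by simp
    have "c0 < c0 + e" using e by simp
    from order_tendstoD(2)[OF c this] xl
    have ev: "eventually (\<lambda>n. S n (x n) \<in> lip_ball (As n) ((c0 + e) * (l + e)) (C * (r + 1))) U"
    proof eventually_elim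
      case (elim n)
      have le0: "0 \<le> l + e" using l e by simp
      have s: "S n (x n) \<in> lip_ball (As n) (C * (l + e)) (C * (r + 1))"
        by (rule equiD(4)[OF S elim(2) le0])
      have "lip (As n) (S n (x n)) \<le> ennreal (c n) * lip (As n) (x n)"
        by (rule le[OF lip_ballD(4)[OF elim(2)]])
      also have "\<dots> \<le> ennreal (c0 + e) * ennreal (l + e)"
        using elim(1) lip_ballD(2)[OF elim(2)] by (intro mult_mono ennreal_leI) simp_all
      also have "\<dots> = ennreal ((c0 + e) * (l + e))" using c0 l e by (simp add: ennreal_mult)
      finally show ?case using lip_ballD(1,3)[OF s] by (simp add: lip_ball_def)
    qed
    obtain b where b: "b \<in> lip_ball A ((c0 + e) * (l + e)) (C * (r + 1))" "conv (\<lambda>n. S n (x n)) b"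
      by (rule lip_ball_conv[OF equi_in[OF S convD(2)[OF x]] ev pos])
    have "lim_op S a = b" by (rule lim_op_eqI[OF S x b(2)])
    with b(1) show ?thesis by simp
  qed
  show "lim_op S a \<in> sa A" by (rule lip_ballD(1)[OF *[OF zero_less_one]])
  show "lip A (lim_op S a) \<le> ennreal (c0 * l)"
    by (rule le_limit_product) (rule lip_ballD(2)[OF *])
qed

lemma lim_op_cnorm_diff:
  assumes S: "equi S C" and T: "equi T C'" and x: "conv x a"
  shows "((\<lambda>n. cnorm (As n) (S n (x n) \<ominus>\<^bsub>As n\<^esub> T n (x n))) \<longlongrightarrow>
      cnorm A (lim_op S a \<ominus>\<^bsub>A\<^esub> lim_op T a)) U"
  by (rule conv_cnorm[OF conv_diff[OF lim_op[OF S x] lim_op[OF T x]]])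

lemma lim_op_dist:
  assumes S: "equi S C" and T: "equi T C'" and k: "(k \<longlongrightarrow> k0) U" and k0: "0 \<le> k0"
    and le: "\<And>n l r y. \<lbrakk>y \<in> lip_ball (As n) l r; 0 \<le> l\<rbrakk> \<Longrightarrow>
      cnorm (As n) (S n y \<ominus>\<^bsub>As n\<^esub> T n y) \<le> k n * l"
    and a: "a \<in> lip_ball A l r" and l: "0 \<le> l"
  shows "cnorm A (lim_op S a \<ominus>\<^bsub>A\<^esub> lim_op T a) \<le> k0 * l"
proof -
  have *: "cnorm A (lim_op S a \<ominus>\<^bsub>A\<^esub> lim_op T a) \<le> k0 * (l + e)" if e: "0 < e" for e
  proof -
    have "l < l + e" using e by simp
    then obtain x where x: "conv x a" and xl: "eventually (\<lambda>n. x n \<in> lip_ball (As n) (l + e) (r + 1)) U"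
      by (rule lip_ball_seq[OF a l]) (rule that)
    show ?thesis
    proof (rule tendsto_le[OF U_bot tendsto_mult[OF k tendsto_const] lim_op_cnorm_diff[OF S T x]])
      show "eventually (\<lambda>n. cnorm (As n) (S n (x n) \<ominus>\<^bsub>As n\<^esub> T n (x n)) \<le> k n * (l + e)) U"
        using xl by eventually_elim (rule le, assumption, use l e in simp)
    qed
  qed
  show ?thesis
  proof (rule field_le_epsilon)
    fix t :: real assume t: "0 < t"
    have k1: "0 < k0 + 1" using k0 by simp
    \<comment> \<open>The slack t/(k0 + 1) contributes at most t, including when k0 = 0.\<close>
    have "cnorm A (lim_op S a \<ominus>\<^bsub>A\<^esub> lim_op T a) \<le> k0 * (l + t / (k0 + 1))"
      using t k1 by (intro *) simp
    also have "\<dots> = k0 * l + t * (k0 / (k0 + 1))" by (simp add: distrib_left)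
    also have "\<dots> \<le> k0 * l + t * 1"
      using t k1 by (intro add_left_mono mult_left_mono) (simp_all add: pos_divide_le_eq)
    finally show "cnorm A (lim_op S a \<ominus>\<^bsub>A\<^esub> lim_op T a) \<le> k0 * l + t" by simp
  qed
qed

lemma lim_op_Lipschitz:
  assumes S: "equi S C" and a: "a \<in> carrier A" and b: "b \<in> carrier A"
  shows "cnorm A (lim_op S a \<ominus>\<^bsub>A\<^esub> lim_op S b) \<le> C * cnorm A (a \<ominus>\<^bsub>A\<^esub> b)"
  using lim_op_cnorm[OF S tendsto_const equiD(3)[OF S] A.minus_closed[OF a b]]
  unfolding linear_map_diff[OF A.unital_cstar_algebra_axioms A.unital_cstar_algebra_axioms lim_op_linear[OF S] a b] .

text \<open>A vanishing modulus gives equality on elements of finite seminorm; density and the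
  bounds \<open>C\<close> and \<open>C'\<close> extend it to self-adjoint elements, linearity to
  all. It turns approximate action laws into exact ones.\<close>

lemma lim_op_eq:
  assumes S: "equi S C" and T: "equi T C'" and k: "(k \<longlongrightarrow> 0) U"
    and le: "\<And>n l r y. \<lbrakk>y \<in> lip_ball (As n) l r; 0 \<le> l\<rbrakk> \<Longrightarrow>
      cnorm (As n) (S n y \<ominus>\<^bsub>As n\<^esub> T n y) \<le> k n * l"
    and a: "a \<in> carrier A"
  shows "lim_op S a = lim_op T a"
proof -
  have sa: "lim_op S u = lim_op T u" if u: "u \<in> sa A" for u
  proof -
    note uc = A.sa_in[OF u]
    have "cnorm A (lim_op S u \<ominus>\<^bsub>A\<^esub> lim_op T u) \<le> 0 + e" if e: "0 < e" for e
    proof -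
      have CC: "0 < C + C' + 1" using equiD(1)[OF S] equiD(1)[OF T] by simp
      then have "0 < e / (C + C' + 1)" using e by simp
      from A.lip_ball_dense[OF u this] obtain b l r where b: "b \<in> lip_ball A l r" and l: "0 \<le> l"
        and bu: "cnorm A (b \<ominus>\<^bsub>A\<^esub> u) < e / (C + C' + 1)" by blast
      have bc: "b \<in> carrier A" by (rule A.sa_in[OF lip_ballD(1)[OF b]])
      note c = lim_op_in[OF S uc] lim_op_in[OF T uc] lim_op_in[OF S bc] lim_op_in[OF T bc]
      have "cnorm A (lim_op S b \<ominus>\<^bsub>A\<^esub> lim_op T b) \<le> 0 * l"
        by (rule lim_op_dist[OF S T k order_refl le b l])
      moreover have "cnorm A (lim_op S u \<ominus>\<^bsub>A\<^esub> lim_op T u)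
          \<le> cnorm A (lim_op S u \<ominus>\<^bsub>A\<^esub> lim_op S b) + cnorm A (lim_op S b \<ominus>\<^bsub>A\<^esub> lim_op T u)"
        by (rule A.cnorm_diff_triangle[OF c(1) c(3) c(2)])
      moreover have "cnorm A (lim_op S b \<ominus>\<^bsub>A\<^esub> lim_op T u)
          \<le> cnorm A (lim_op S b \<ominus>\<^bsub>A\<^esub> lim_op T b) + cnorm A (lim_op T b \<ominus>\<^bsub>A\<^esub> lim_op T u)"
        by (rule A.cnorm_diff_triangle[OF c(3) c(4) c(2)])
      moreover have "cnorm A (lim_op S u \<ominus>\<^bsub>A\<^esub> lim_op S b) \<le> C * cnorm A (b \<ominus>\<^bsub>A\<^esub> u)"
        using lim_op_Lipschitz[OF S uc bc] A.cnorm_diff_commute[OF uc bc] by simp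
      moreover have "cnorm A (lim_op T b \<ominus>\<^bsub>A\<^esub> lim_op T u) \<le> C' * cnorm A (b \<ominus>\<^bsub>A\<^esub> u)"
        by (rule lim_op_Lipschitz[OF T bc uc])
      ultimately have "cnorm A (lim_op S u \<ominus>\<^bsub>A\<^esub> lim_op T u) \<le> (C + C') * cnorm A (b \<ominus>\<^bsub>A\<^esub> u)"
        by (simp add: distrib_right)
      also have "\<dots> \<le> (C + C' + 1) * cnorm A (b \<ominus>\<^bsub>A\<^esub> u)"
        using A.cnorm_nonneg[OF A.minus_closed[OF bc uc]] by (intro mult_right_mono) simp_all
      also have "\<dots> \<le> e" using bu CC by (simp add: pos_less_divide_eq mult.commute less_imp_le)
      finally show ?thesis by simp
    qed
    then have "cnorm A (lim_op S u \<ominus>\<^bsub>A\<^esub> lim_op T u) \<le> 0" by (rule field_le_epsilon)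
    then show ?thesis by (rule A.cnorm_diff_zero[OF lim_op_in[OF S uc] lim_op_in[OF T uc]])
  qed
  note L = lim_op_linear[OF S] lim_op_linear[OF T]
  note c = A.re_im_in[OF a]
  have "lim_op S (A.re a \<oplus>\<^bsub>A\<^esub> \<i> \<odot>\<^bsub>A\<^esub> A.im a) = lim_op T (A.re a \<oplus>\<^bsub>A\<^esub> \<i> \<odot>\<^bsub>A\<^esub> A.im a)"
    unfolding linear_mapD(2)[OF L(1) c(1) A.smult_in[OF c(2)]] linear_mapD(2)[OF L(2) c(1) A.smult_in[OF c(2)]]
      linear_mapD(3)[OF L(1) c(2)] linear_mapD(3)[OF L(2) c(2)] sa[OF A.re_sa[OF a]] sa[OF A.im_sa[OF a]] ..
  then show ?thesis unfolding A.re_im[OF a] .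
qed

lemma equi_comp:
  assumes S: "equi S C" and T: "equi T C'"
  shows "equi (\<lambda>n x. S n (T n x)) (C * C')"
  unfolding equi_def
proof (intro conjI allI ballI impI)
  show "0 \<le> C * C'" using equiD(1)[OF S] equiD(1)[OF T] by simp
  fix n
  show "linear_map (As n) (As n) (\<lambda>x. S n (T n x))"
    using equi_in[OF S] equi_in[OF T] linear_mapD(2,3)[OF equiD(2)[OF S]] linear_mapD(2,3)[OF equiD(2)[OF T]]
    by (simp add: linear_map_def)
  show "cnorm (As n) (S n (T n x)) \<le> C * C' * cnorm (As n) x" if x: "x \<in> carrier (As n)" for x
  proof -
    have "cnorm (As n) (S n (T n x)) \<le> C * cnorm (As n) (T n x)" by (rule equiD(3)[OF S equi_in[OF T x]])
    also have "\<dots> \<le> C * (C' * cnorm (As n) x)" by (rule mult_left_mono[OF equiD(3)[OF T x] equiD(1)[OF S]])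
    finally show ?thesis by (simp add: mult.assoc)
  qed
  show "S n (T n a) \<in> lip_ball (As n) (C * C' * l) (C * C' * r)" if "a \<in> lip_ball (As n) l r" "0 \<le> l" for a l r
    using equiD(4)[OF S equiD(4)[OF T that] mult_nonneg_nonneg[OF equiD(1)[OF T] that(2)]]
    by (simp add: mult.assoc)
qed

text \<open>The image sequence under \<open>T\<close> is itself a valid representative, so
  \<open>S\<close> can be applied to it; using the same ultrafilter for both limits is what makes
  this work.\<close>

lemma lim_op_comp:
  assumes S: "equi S C" and T: "equi T C'" and a: "a \<in> carrier A"
  shows "lim_op (\<lambda>n x. S n (T n x)) a = lim_op S (lim_op T a)"
proof -
  obtain x where x: "conv x a" using a by (rule conv_total)
  show ?thesis by (rule lim_op_eqI[OF equi_comp[OF S T] x lim_op[OF S lim_op[OF T x]]])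
qed

lemma equi_id: "equi (\<lambda>n x. x) 1"
  by (simp add: equi_def linear_map_def)

lemma lim_op_id: "a \<in> carrier A \<Longrightarrow> lim_op (\<lambda>n x. x) a = a"
proof -
  assume a: "a \<in> carrier A"
  obtain x where x: "conv x a" using a by (rule conv_total)
  show ?thesis by (rule lim_op_eqI[OF equi_id x x])
qed

lemma lim_op_star_hom:
  assumes S: "equi S C" and hom: "\<And>n. star_hom (As n) (As n) (S n)"
  shows "star_hom A A (lim_op S)"
  unfolding star_hom_def
proof (intro conjI ballI lim_op_linear[OF S])
  fix a b assume a: "a \<in> carrier A" and b: "b \<in> carrier A"
  obtain x where x: "conv x a" using a by (rule conv_total)
  obtain y where y: "conv y b" using b by (rule conv_total)
  have m: "S n (x n \<otimes>\<^bsub>As n\<^esub> y n) = S n (x n) \<otimes>\<^bsub>As n\<^esub> S n (y n)" for n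
    using hom[of n] convD(2)[OF x] convD(2)[OF y] unfolding star_hom_def by blast
  show "lim_op S (a \<otimes>\<^bsub>A\<^esub> b) = lim_op S a \<otimes>\<^bsub>A\<^esub> lim_op S b"
    by (rule lim_op_eqI[OF S conv_mult[OF x y]])
      (simp only: m conv_mult[OF lim_op[OF S x] lim_op[OF S y]])
next
  fix a assume a: "a \<in> carrier A"
  obtain x where x: "conv x a" using a by (rule conv_total)
  have m: "S n (star (As n) (x n)) = star (As n) (S n (x n))" for n
    using hom[of n] convD(2)[OF x] unfolding star_hom_def by blast
  show "lim_op S (star A a) = star A (lim_op S a)"
    by (rule lim_op_eqI[OF S conv_star[OF x]]) (simp only: m conv_star[OF lim_op[OF S x]])
qed

text \<open>Positivity is a norm condition, and norms pass to the limit. The radius exceeds the norm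
  of \<open>a\<close> by 1 so as to dominate almost all norms of \<open>x n\<close>.\<close>

lemma conv_pos:
  assumes x: "conv x a" and pos: "\<And>n. unital_cstar_algebra.pos (As n) (x n)"
  shows "A.pos a"
proof -
  have "star (As n) (x n) = x n" for n using An.pos_sa[OF pos] by (simp only: An.sa_iff)
  then have "conv x (star A a)" using conv_star[OF x] by simp
  then have "star A a = a" using x by (rule conv_unique)
  then have sa: "a \<in> sa A" using convD(1)[OF x] by (simp only: A.sa_iff)
  let ?s = "cnorm A a + 1"
  have "cnorm A (A.sc ?s \<ominus>\<^bsub>A\<^esub> a) \<le> ?s"
  proof (rule tendsto_upperbound[OF conv_cnorm[OF conv_diff[OF conv_smult[OF conv_one] x]] _ U_bot])
    have "cnorm A a < ?s" by simp
    from order_tendstoD(2)[OF conv_cnorm[OF x] this]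
    show "eventually (\<lambda>n. cnorm (As n) (complex_of_real ?s \<odot>\<^bsub>As n\<^esub> \<one>\<^bsub>As n\<^esub> \<ominus>\<^bsub>As n\<^esub> x n) \<le> ?s) U"
      by eventually_elim (rule An.pos_ball[OF pos less_imp_le])
  qed
  moreover have "0 \<le> ?s" using A.cnorm_nonneg[OF convD(1)[OF x]] by simp
  ultimately show ?thesis unfolding A.pos_def using sa by blast
qed

lemma lim_op_positive:
  assumes S: "equi S C" and positive: "\<And>n. positive_map (As n) (As n) (S n)"
  shows "positive_map A A (lim_op S)"
  unfolding positive_map_def
proof (intro subsetI, elim imageE, simp only:)
  fix a assume "a \<in> positive_cone A"
  then obtain b where b: "b \<in> carrier A" "a = star A b \<otimes>\<^bsub>A\<^esub> b" unfolding positive_cone_def by blast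
  obtain x where x: "conv x b" using b(1) by (rule conv_total)
  let ?w = "\<lambda>n. S n (star (As n) (x n) \<otimes>\<^bsub>As n\<^esub> x n)"
  have "?w n \<in> positive_cone (As n)" for n
    using positive[of n] convD(2)[OF x, of n] unfolding positive_map_def positive_cone_def by blast
  then have "unital_cstar_algebra.pos (As n) (?w n)" for n by (simp only: An.positive_cone_iff)
  from conv_pos[OF lim_op[OF S conv_mult[OF conv_star[OF x] x]] this]
  show "lim_op S a \<in> positive_cone A" by (simp only: b(2) A.positive_cone_iff)
qed

end

section \<open>Radius of the state space and estimates on a single space\<close>

context quasi_leibniz_qcms
begin

text \<open>A totally bounded state space has finite diameter. Subtracting the value of one fixed
  state leaves an element on which every state is at most \<open>l\<close> times that
  diameter.\<close>

lemma radius_bound: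
  "\<exists>R\<ge>0. \<forall>a\<in>sa M. \<forall>l>0. lip M a \<le> ennreal l \<longrightarrow> (\<exists>t. cnorm M (a \<ominus> sc t) \<le> l * R)"
proof (cases "states M = {}")
  case True
  have *: "\<exists>t. cnorm M (a \<ominus> sc t) \<le> l * 0" if a: "a \<in> sa M" for a and l :: real
  proof (rule exI)
    show "cnorm M (a \<ominus> sc 0) \<le> l * 0" using True by (intro cnorm_le_states sa_diff a sc_sa) simp_all
  qed
  show ?thesis by (intro exI[of _ 0] conjI ballI allI impI order_refl *)
next
  case False
  then obtain \<psi> where \<psi>: "\<psi> \<in> states M" by blast
  from states_finite_net[OF zero_less_one] obtain K where K: "finite K" "K \<subseteq> states M"
    "\<forall>\<phi>\<in>states M. \<exists>\<theta>\<in>K. enn2real (mk M \<theta> \<phi>) < 1" by (elim exE conjE)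
  define R where "R = (\<Sum>\<theta>\<in>K. enn2real (mk M \<psi> \<theta>)) + 1"
  have R0: "0 \<le> R" by (simp add: R_def sum_nonneg)
  have R: "enn2real (mk M \<psi> \<phi>) \<le> R" if \<phi>: "\<phi> \<in> states M" for \<phi>
  proof -
    from K(3)[THEN bspec, OF \<phi>] obtain \<theta> where \<theta>: "\<theta> \<in> K" "enn2real (mk M \<theta> \<phi>) < 1" by (rule bexE)
    have "enn2real (mk M \<psi> \<phi>) \<le> enn2real (mk M \<psi> \<theta>) + enn2real (mk M \<theta> \<phi>)"
      by (rule mkm.triangle[OF \<psi> subsetD[OF K(2) \<theta>(1)] \<phi>])
    also have "enn2real (mk M \<psi> \<theta>) \<le> (\<Sum>\<theta>\<in>K. enn2real (mk M \<psi> \<theta>))"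
      by (rule member_le_sum[OF \<theta>(1) _ K(1)]) simp
    finally show ?thesis using \<theta>(2) by (simp add: R_def)
  qed
  show ?thesis
  proof (rule exI[of _ R], intro conjI ballI allI impI R0)
    fix a and l :: real assume as: "a \<in> sa M" and l: "0 < l" and la: "lip M a \<le> ennreal l"
    note a = as la
    have r: "complex_of_real (Re (\<psi> a)) = \<psi> a" using states_sa(1)[OF \<psi> a(1)] by (rule of_real_Re)
    have "cnorm M (a \<ominus> sc (Re (\<psi> a))) \<le> l * R"
    proof (rule cnorm_le_states)
      show "a \<ominus> sc (Re (\<psi> a)) \<in> sa M" by (intro sa_diff a sc_sa)
      show "0 \<le> l * R" using l R0 by simp
      fix \<phi> assume \<phi>: "\<phi> \<in> states M"
      have "\<phi> (a \<ominus> sc (Re (\<psi> a))) = \<phi> a - \<psi> a"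
        using a(1) by (simp add: states_diff[OF \<phi>] statesD(2,4)[OF \<phi>] r)
      then have "cmod (\<phi> (a \<ominus> sc (Re (\<psi> a)))) = cmod (\<psi> a - \<phi> a)" by (simp add: norm_minus_commute)
      also have "\<dots> \<le> l * enn2real (mk M \<psi> \<phi>)" by (rule mk_bound_states[OF \<psi> \<phi> a l])
      also have "\<dots> \<le> l * R" using R[OF \<phi>] l by (intro mult_left_mono) simp_all
      finally show "cmod (\<phi> (a \<ominus> sc (Re (\<psi> a)))) \<le> l * R" .
    qed
    then show "\<exists>t. cnorm M (a \<ominus> sc t) \<le> l * R" by (rule exI)
  qed
qed

lemma lip_diff_scalar:
  assumes a: "a \<in> ldom M"
  shows "a \<ominus> sc t \<in> ldom M" and "lip M (a \<ominus> sc t) \<le> lip M a"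
proof -
  have e: "a \<ominus> sc t = a \<oplus> sc (- t)" by (simp add: minus_eq smult_uminus_l)
  show "a \<ominus> sc t \<in> ldom M" unfolding e by (rule ldom_add[OF a scalar_ldom])
  show "lip M (a \<ominus> sc t) \<le> lip M a"
    unfolding e using lip_add[OF a scalar_ldom[of "- t"]] by (simp only: lip_scalar add_0_right)
qed

lemma mkD_bound:
  assumes f: "linear_map M M f" and g: "linear_map M M g"
    and mk: "mkD M M f g \<le> ennreal c" and c: "0 \<le> c" and y: "y \<in> lip_ball M l r" and l: "0 < l"
  shows "cnorm M (f y \<ominus> g y) \<le> l * c"
proof -
  note yc = sa_in[OF lip_ballD(1)[OF y]]
  let ?b = "rs (1 / l) y"
  have "lip M ?b \<le> ennreal (1 / l) * ennreal l"
    using lip_smult[OF lip_ballD(4)[OF y], of "1 / l"] l lip_ballD(2)[OF y] by (simp add: mult_left_mono)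
  also have "\<dots> = 1" using l by (simp flip: ennreal_mult)
  finally have "?b \<in> {a \<in> ldom M. lip M a \<le> 1}" using ldom_smult[OF lip_ballD(4)[OF y], of "1 / l"] by simp
  then have "ennreal (cnorm M (f ?b \<ominus> g ?b)) \<le> mkD M M f g" unfolding mkD_def by (rule SUP_upper)
  then have "ennreal (cnorm M (f ?b \<ominus> g ?b)) \<le> ennreal c" using mk by (rule order_trans)
  then have "cnorm M (f ?b \<ominus> g ?b) \<le> c" using c by simp
  moreover have "cnorm M (f ?b \<ominus> g ?b) = cnorm M (f y \<ominus> g y) / l"
    unfolding linear_mapD(3)[OF f yc] linear_mapD(3)[OF g yc]
      cnorm_smult_diff[OF linear_mapD(1)[OF f yc] linear_mapD(1)[OF g yc]]
    using l by (simp add: norm_divide)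
  ultimately show ?thesis using l by (simp add: pos_divide_le_eq mult.commute)
qed

lemma mkD_upper: "\<lbrakk>a \<in> ldom M; lip M a \<le> 1\<rbrakk> \<Longrightarrow> ennreal (cnorm M (f a \<ominus> g a)) \<le> mkD M M f g"
  unfolding mkD_def by (intro SUP_upper CollectI conjI)

lemma ldom_lip_ball: "a \<in> ldom M \<Longrightarrow> a \<in> lip_ball M (enn2real (lip M a)) (cnorm M a)"
  by (simp add: lip_ball_def ldom_def less_top)

lemma bounded_linear_continuous:
  assumes f: "linear_map M M f" and C: "0 \<le> C" and le: "\<And>x. x \<in> carrier M \<Longrightarrow> cnorm M (f x) \<le> C * cnorm M x"
  shows "continuous_map (ctop M) (ctop M) f"
  unfolding ctop_def metric.metric_continuous_map[OF metric.Metric_space_axioms]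
proof (intro conjI ballI allI impI)
  show "f ` carrier M \<subseteq> carrier M" using linear_mapD(1)[OF f] by blast
  fix a and e :: real assume a: "a \<in> carrier M" and e: "0 < e"
  have C1: "0 < C + 1" using C by simp
  show "\<exists>d>0. \<forall>x. x \<in> carrier M \<and> cdist M a x < d \<longrightarrow> cdist M (f a) (f x) < e"
  proof (intro exI[of _ "e / (C + 1)"] conjI allI impI)
    show "0 < e / (C + 1)" using e C1 by simp
    fix x assume x: "x \<in> carrier M \<and> cdist M a x < e / (C + 1)"
    then have xc: "x \<in> carrier M" by (rule conjunct1)
    have d: "cnorm M (a \<ominus> x) < e / (C + 1)" using conjunct2[OF x] a xc by (simp add: cdist_def)
    have "cnorm M (f a \<ominus> f x) \<le> C * cnorm M (a \<ominus> x)"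
      using le[OF minus_closed[OF a xc]]
      unfolding linear_map_diff[OF unital_cstar_algebra_axioms unital_cstar_algebra_axioms f a xc] .
    also have "\<dots> \<le> (C + 1) * cnorm M (a \<ominus> x)"
      using cnorm_nonneg[OF minus_closed[OF a xc]] by (intro mult_right_mono) simp_all
    also have "\<dots> < e" using d C1 by (simp add: pos_less_divide_eq mult.commute)
    finally show "cdist M (f a) (f x) < e" using linear_mapD(1)[OF f a] linear_mapD(1)[OF f xc] by (simp add: cdist_def)
  qed
qed

lemma clip_ball_dense:
  assumes a: "a \<in> carrier M" and e: "0 < e"
  shows "\<exists>b l r. b \<in> clip_ball M l r \<and> 0 \<le> l \<and> cnorm M (b \<ominus> a) < e"
proof -
  have e2: "0 < e / 2" using e by simp
  from lip_ball_dense[OF re_sa[OF a] e2] obtain b l r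
    where b: "b \<in> lip_ball M l r" "0 \<le> l" "cnorm M (b \<ominus> re a) < e / 2" by (elim exE conjE)
  from lip_ball_dense[OF im_sa[OF a] e2] obtain c l' r'
    where c: "c \<in> lip_ball M l' r'" "0 \<le> l'" "cnorm M (c \<ominus> im a) < e / 2" by (elim exE conjE)
  have "b \<in> lip_ball M (max l l') (max r r')" "c \<in> lip_ball M (max l l') (max r r')"
    by (rule lip_ball_mono[OF b(1)], simp_all, rule lip_ball_mono[OF c(1)], simp_all)
  then have clip: "b \<oplus> \<i> \<odot> c \<in> clip_ball M (max l l') (max r r')" by (rule clip_ballI)
  note cc = sa_in[OF lip_ballD(1)[OF b(1)]] sa_in[OF lip_ballD(1)[OF c(1)]] re_im_in[OF a]
  have "cnorm M ((b \<oplus> \<i> \<odot> c) \<ominus> (re a \<oplus> \<i> \<odot> im a)) \<le> cnorm M (b \<ominus> re a) + cnorm M (\<i> \<odot> c \<ominus> \<i> \<odot> im a)"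
    by (intro cnorm_add_diff smult_in cc)
  also have "cnorm M (\<i> \<odot> c \<ominus> \<i> \<odot> im a) = cnorm M (c \<ominus> im a)"
    using cnorm_smult_diff[OF cc(2,4), of \<i>] by simp
  finally have "cnorm M ((b \<oplus> \<i> \<odot> c) \<ominus> a) < e" unfolding re_im[OF a] using b(3) c(3) by linarith
  moreover have "0 \<le> max l l'" using b(2) by simp
  ultimately show ?thesis using clip by (intro exI conjI)
qed

end

section \<open>Monge-Kantorovich distances of limit operators\<close>

context tunnel_sequence
begin

text \<open>Carries the radius of \<open>A\<close> through the tunnels, giving one bound for almost
  all n. Lifts have seminorm below 2, which costs 2R in \<open>A\<close>, and the tunnel error 2
  times \<open>\<eta> n\<close> is below 1.\<close>

lemma eventually_radius:
  obtains R where "eventually (\<lambda>n. \<forall>x\<in>ldom (As n). lip (As n) x \<le> 1 \<longrightarrow>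
    (\<exists>t. cnorm (As n) (x \<ominus>\<^bsub>As n\<^esub> complex_of_real t \<odot>\<^bsub>As n\<^esub> \<one>\<^bsub>As n\<^esub>) \<le> R)) U"
proof -
  obtain R where R: "\<forall>a\<in>sa A. \<forall>l>0. lip A a \<le> ennreal l \<longrightarrow> (\<exists>t. cnorm A (a \<ominus>\<^bsub>A\<^esub> A.sc t) \<le> l * R)"
    using A.radius_bound by - (elim exE conjE, rule that)
  have "eventually (\<lambda>n. \<forall>x\<in>ldom (As n). lip (As n) x \<le> 1 \<longrightarrow>
    (\<exists>t. cnorm (As n) (x \<ominus>\<^bsub>As n\<^esub> complex_of_real t \<odot>\<^bsub>As n\<^esub> \<one>\<^bsub>As n\<^esub>) \<le> 2 * R + 1)) U"
    using bound eventually_less[OF zero_less_one, of 2]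
  proof (eventually_elim, intro ballI impI)
    fix n x
    assume bd: "\<forall>l>0. \<forall>d\<in>sa (Ds n). lip (Ds n) d \<le> ennreal l \<longrightarrow>
        cnorm (Ds n) d \<le> cnorm (As n) (p n d) + l * \<eta> n \<and> cnorm (Ds n) d \<le> cnorm A (q n d) + l * \<eta> n"
      and \<eta>: "2 * \<eta> n < 1" and x: "x \<in> ldom (As n)" and lx: "lip (As n) x \<le> 1"
    have xs: "x \<in> sa (As n)" using x by (simp add: ldom_def)
    have "lip (As n) x < ennreal 2" using lx by (rule order.strict_trans1) simp
    from P.lip_lift[OF xs this] obtain d where d: "d \<in> sa (Ds n)" "p n d = x" "lip (Ds n) d < ennreal 2"
      by (elim bexE conjE)
    have dl: "lip (Ds n) d \<le> ennreal 2" by (rule less_imp_le[OF d(3)])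
    then have dd: "d \<in> ldom (Ds n)" using d(1) by (auto simp: ldom_def intro: order.strict_trans1)
    note dc = Dn.sa_in[OF d(1)]
    have "lip A (q n d) \<le> ennreal 2" using Q.lip_hom[OF d(1)] dl by (rule order_trans)
    from R[rule_format, OF Q.hom_sa[OF d(1)] zero_less_numeral this]
    obtain t where t: "cnorm A (q n d \<ominus>\<^bsub>A\<^esub> A.sc t) \<le> 2 * R" by (rule exE)
    define s where "s = complex_of_real t \<odot>\<^bsub>Ds n\<^esub> \<one>\<^bsub>Ds n\<^esub>"
    have sc: "s \<in> carrier (Ds n)" unfolding s_def by (intro Dn.smult_in Dn.one_closed)
    have ps: "p n s = complex_of_real t \<odot>\<^bsub>As n\<^esub> \<one>\<^bsub>As n\<^esub>" "q n s = A.sc t"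
      unfolding s_def P.hom_smult[OF Dn.one_closed] Q.hom_smult[OF Dn.one_closed] P.unital Q.unital by (rule refl)+
    have e: "d \<ominus>\<^bsub>Ds n\<^esub> s \<in> ldom (Ds n)" "lip (Ds n) (d \<ominus>\<^bsub>Ds n\<^esub> s) \<le> lip (Ds n) d"
      unfolding s_def by (rule Dn.lip_diff_scalar[OF dd])+
    have es: "d \<ominus>\<^bsub>Ds n\<^esub> s \<in> sa (Ds n)" using e(1) by (simp add: ldom_def)
    have "cnorm (As n) (p n (d \<ominus>\<^bsub>Ds n\<^esub> s)) \<le> cnorm (Ds n) (d \<ominus>\<^bsub>Ds n\<^esub> s)"
      by (rule P.cnorm_hom[OF Dn.sa_in[OF es]])
    also have "\<dots> \<le> cnorm A (q n (d \<ominus>\<^bsub>Ds n\<^esub> s)) + 2 * \<eta> n"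
      by (rule bd[rule_format, OF zero_less_numeral es order_trans[OF e(2) dl], THEN conjunct2])
    also have "\<dots> \<le> 2 * R + 1" unfolding Q.hom_diff[OF dc sc] ps using t \<eta> by linarith
    finally have "cnorm (As n) (x \<ominus>\<^bsub>As n\<^esub> complex_of_real t \<odot>\<^bsub>As n\<^esub> \<one>\<^bsub>As n\<^esub>) \<le> 2 * R + 1"
      unfolding P.hom_diff[OF dc sc] ps d(2) .
    then show "\<exists>t. cnorm (As n) (x \<ominus>\<^bsub>As n\<^esub> complex_of_real t \<odot>\<^bsub>As n\<^esub> \<one>\<^bsub>As n\<^esub>) \<le> 2 * R + 1" by (rule exI)
  qed
  then show thesis by (rule that)
qed

text \<open>A test element of \<open>A\<close> is represented by elements of seminorm at most 1 + e,
  on which any bound above the limsup holds for almost all n.\<close>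

lemma mkD_lim_op_le_limsup:
  assumes S: "equi S C" and T: "equi T C'"
  shows "mkD A A (lim_op S) (lim_op T) \<le> limsup (\<lambda>n. mkD (As n) (As n) (S n) (T n))"
  unfolding mkD_def[of A A]
proof (rule SUP_least)
  fix a assume "a \<in> {a \<in> ldom A. lip A a \<le> 1}"
  then have a: "a \<in> lip_ball A 1 (cnorm A a)" by (simp add: lip_ball_def ldom_def)
  let ?L = "limsup (\<lambda>n. mkD (As n) (As n) (S n) (T n))"
  show "ennreal (cnorm A (lim_op S a \<ominus>\<^bsub>A\<^esub> lim_op T a)) \<le> ?L"
  proof (rule dense_ge)
    fix y assume y: "?L < y"
    show "ennreal (cnorm A (lim_op S a \<ominus>\<^bsub>A\<^esub> lim_op T a)) \<le> y"
    proof (cases y rule: ennreal_cases)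
      case (real c)
      have "eventually (\<lambda>n. mkD (As n) (As n) (S n) (T n) < y) sequentially" using y by (rule Limsup_lessD)
      then have ev: "eventually (\<lambda>n. mkD (As n) (As n) (S n) (T n) < y) U" using U_seq by (rule filter_leD[rotated])
      have "ennreal (cnorm A (lim_op S a \<ominus>\<^bsub>A\<^esub> lim_op T a)) \<le> ennreal (c * 1)"
      proof (rule le_limit_product, rule ennreal_leI)
        fix e :: real assume e: "0 < e"
        have "1 < 1 + e" using e by simp
        then obtain x where x: "conv x a" and xl: "eventually (\<lambda>n. x n \<in> lip_ball (As n) (1 + e) (cnorm A a + 1)) U"
          by (rule lip_ball_seq[OF a zero_le_one]) (rule that)
        show "cnorm A (lim_op S a \<ominus>\<^bsub>A\<^esub> lim_op T a) \<le> (c + e) * (1 + e)"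
        proof (rule tendsto_upperbound[OF lim_op_cnorm_diff[OF S T x] _ U_bot])
          show "eventually (\<lambda>n. cnorm (As n) (S n (x n) \<ominus>\<^bsub>As n\<^esub> T n (x n)) \<le> (c + e) * (1 + e)) U"
            using ev xl
          proof eventually_elim
            case (elim n)
            have "mkD (As n) (As n) (S n) (T n) \<le> ennreal c" using elim(1) real by simp
            moreover have "0 < 1 + e" using e by simp
            ultimately have "cnorm (As n) (S n (x n) \<ominus>\<^bsub>As n\<^esub> T n (x n)) \<le> (1 + e) * c"
              by (intro An.mkD_bound[OF equiD(2)[OF S] equiD(2)[OF T] _ real(1) elim(2)])
            also have "\<dots> \<le> (c + e) * (1 + e)" using e by (simp add: mult.commute mult_left_mono)
            finally show ?case .
          qed
        qed
      qed
      then show ?thesis using real by simp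
    qed simp
  qed
qed

text \<open>Near-maximizers for each n would converge to a test element of \<open>A\<close>
  witnessing the bound, but their norms may be unbounded. Since both maps fix the unit, scalars can
  be subtracted until \<open>eventually_radius\<close> applies.\<close>

lemma liminf_le_mkD_lim_op:
  assumes S: "equi S C" and T: "equi T C'"
    and one: "\<And>n. S n \<one>\<^bsub>As n\<^esub> = \<one>\<^bsub>As n\<^esub>" "\<And>n. T n \<one>\<^bsub>As n\<^esub> = \<one>\<^bsub>As n\<^esub>"
  shows "liminf (\<lambda>n. mkD (As n) (As n) (S n) (T n)) \<le> mkD A A (lim_op S) (lim_op T)"
proof (rule ccontr)
  assume "\<not> ?thesis"
  then have "mkD A A (lim_op S) (lim_op T) < liminf (\<lambda>n. mkD (As n) (As n) (S n) (T n))" by simp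
  then obtain y where y: "mkD A A (lim_op S) (lim_op T) < y" "y < liminf (\<lambda>n. mkD (As n) (As n) (S n) (T n))"
    using dense by blast
  then obtain v where v: "y = ennreal v" "0 \<le> v" by (cases y rule: ennreal_cases) auto
  have "eventually (\<lambda>n. y < mkD (As n) (As n) (S n) (T n)) sequentially" using y(2) by (rule less_LiminfD)
  then have ev: "eventually (\<lambda>n. y < mkD (As n) (As n) (S n) (T n)) U" using U_seq by (rule filter_leD[rotated])
  obtain R where R: "eventually (\<lambda>n. \<forall>x\<in>ldom (As n). lip (As n) x \<le> 1 \<longrightarrow>
    (\<exists>t. cnorm (As n) (x \<ominus>\<^bsub>As n\<^esub> complex_of_real t \<odot>\<^bsub>As n\<^esub> \<one>\<^bsub>As n\<^esub>) \<le> R)) U"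
    by (rule eventually_radius)
  \<comment> \<open>Normalized witnesses whose value stays at least \<open>v\<close>, a level chosen
    strictly between the two sides of the claimed inequality.\<close>
  define Q where "Q n z \<longleftrightarrow> z \<in> lip_ball (As n) 1 R \<and> v \<le> cnorm (As n) (S n z \<ominus>\<^bsub>As n\<^esub> T n z)" for n z
  define w where "w n = (if \<exists>z. Q n z then SOME z. Q n z else \<zero>\<^bsub>As n\<^esub>)" for n
  have wc: "w n \<in> carrier (As n)" for n
  proof (cases "\<exists>z. Q n z")
    case True
    then have "Q n (SOME z. Q n z)" by (rule someI_ex)
    then have "Q n (w n)" using True by (simp only: w_def if_True)
    then have "w n \<in> lip_ball (As n) 1 R" unfolding Q_def by (rule conjunct1)
    then show ?thesis by (intro An.sa_in lip_ballD(1))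
  qed (simp add: w_def)
  have Qw: "eventually (\<lambda>n. Q n (w n)) U"
    using ev R
  proof eventually_elim
    case (elim n)
    from elim(1) obtain x where x: "x \<in> ldom (As n)" "lip (As n) x \<le> 1"
      and vx: "y < ennreal (cnorm (As n) (S n x \<ominus>\<^bsub>As n\<^esub> T n x))"
      unfolding mkD_def less_SUP_iff by blast
    obtain t where t: "cnorm (As n) (x \<ominus>\<^bsub>As n\<^esub> complex_of_real t \<odot>\<^bsub>As n\<^esub> \<one>\<^bsub>As n\<^esub>) \<le> R"
      using elim(2) x by blast
    let ?s = "complex_of_real t \<odot>\<^bsub>As n\<^esub> \<one>\<^bsub>As n\<^esub>"
    have xc: "x \<in> carrier (As n)" using x(1) An.sa_in by (simp add: ldom_def)
    have sc: "?s \<in> carrier (As n)" by (intro An.smult_in An.one_closed)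
    note z = An.lip_diff_scalar[OF x(1), of t]
    have zl: "x \<ominus>\<^bsub>As n\<^esub> ?s \<in> lip_ball (As n) 1 R"
      using z x(2) t by (auto simp: lip_ball_def ldom_def intro: order_trans)
    have f: "f (x \<ominus>\<^bsub>As n\<^esub> ?s) = f x \<ominus>\<^bsub>As n\<^esub> ?s"
      if "linear_map (As n) (As n) f" "f \<one>\<^bsub>As n\<^esub> = \<one>\<^bsub>As n\<^esub>" for f
      unfolding linear_map_diff[OF An.unital_cstar_algebra_axioms An.unital_cstar_algebra_axioms that(1) xc sc]
        linear_mapD(3)[OF that(1) An.one_closed] that(2) ..
    have cancel: "(a \<ominus>\<^bsub>As n\<^esub> s) \<ominus>\<^bsub>As n\<^esub> (b \<ominus>\<^bsub>As n\<^esub> s) = a \<ominus>\<^bsub>As n\<^esub> b"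
      if "a \<in> carrier (As n)" "b \<in> carrier (As n)" "s \<in> carrier (As n)" for a b s
    proof -
      interpret B: unital_cstar_algebra "As n" by (rule An.unital_cstar_algebra_axioms)
      show ?thesis using that by algebra
    qed
    have "S n (x \<ominus>\<^bsub>As n\<^esub> ?s) \<ominus>\<^bsub>As n\<^esub> T n (x \<ominus>\<^bsub>As n\<^esub> ?s) = S n x \<ominus>\<^bsub>As n\<^esub> T n x"
      unfolding f[OF equiD(2)[OF S] one(1)] f[OF equiD(2)[OF T] one(2)]
      by (rule cancel[OF equi_in[OF S xc] equi_in[OF T xc] sc])
    moreover have "v \<le> cnorm (As n) (S n x \<ominus>\<^bsub>As n\<^esub> T n x)"
      using vx v An.cnorm_nonneg[OF An.minus_closed[OF equi_in[OF S xc] equi_in[OF T xc]]]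
      by (simp add: ennreal_less_iff less_imp_le)
    ultimately have "Q n (x \<ominus>\<^bsub>As n\<^esub> ?s)" using zl by (simp add: Q_def)
    then have "\<exists>z. Q n z" by (rule exI)
    then show ?case by (simp add: w_def someI_ex)
  qed
  have "eventually (\<lambda>n. w n \<in> lip_ball (As n) 1 R) U" using Qw by eventually_elim (simp add: Q_def)
  then obtain b where b: "b \<in> lip_ball A 1 R" "conv w b" by (rule lip_ball_conv[OF wc _ zero_le_one])
  have "v \<le> cnorm A (lim_op S b \<ominus>\<^bsub>A\<^esub> lim_op T b)"
  proof (rule tendsto_lowerbound[OF lim_op_cnorm_diff[OF S T b(2)] _ U_bot])
    show "eventually (\<lambda>n. v \<le> cnorm (As n) (S n (w n) \<ominus>\<^bsub>As n\<^esub> T n (w n))) U"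
      using Qw by eventually_elim (simp add: Q_def)
  qed
  then have "y \<le> ennreal (cnorm A (lim_op S b \<ominus>\<^bsub>A\<^esub> lim_op T b))" unfolding v(1) by (rule ennreal_leI)
  also have "\<dots> \<le> mkD A A (lim_op S) (lim_op T)"
    using lip_ballD(2,4)[OF b(1)] by (intro A.mkD_upper) simp_all
  finally show False using y(1) by simp
qed

text \<open>The factor 2 counts real and imaginary parts; this version is needed for continuity at
  elements that are not self-adjoint.\<close>

lemma lim_op_dist_clip:
  assumes S: "equi S C" and T: "equi T C'" and k: "(k \<longlongrightarrow> k0) U" and k0: "0 \<le> k0"
    and le: "\<And>n l r y. \<lbrakk>y \<in> lip_ball (As n) l r; 0 \<le> l\<rbrakk> \<Longrightarrow>
      cnorm (As n) (S n y \<ominus>\<^bsub>As n\<^esub> T n y) \<le> k n * l"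
    and b: "b \<in> clip_ball A l r" and l: "0 \<le> l"
  shows "cnorm A (lim_op S b \<ominus>\<^bsub>A\<^esub> lim_op T b) \<le> 2 * (k0 * l)"
proof -
  obtain u v where u: "u \<in> lip_ball A l r" and v: "v \<in> lip_ball A l r" and bu: "b = u \<oplus>\<^bsub>A\<^esub> \<i> \<odot>\<^bsub>A\<^esub> v"
    using b by (rule clip_ballE)
  note uc = A.sa_in[OF lip_ballD(1)[OF u]] and vc = A.sa_in[OF lip_ballD(1)[OF v]]
  note L = lim_op_linear[OF S] lim_op_linear[OF T]
  have e: "lim_op S b = lim_op S u \<oplus>\<^bsub>A\<^esub> \<i> \<odot>\<^bsub>A\<^esub> lim_op S v" "lim_op T b = lim_op T u \<oplus>\<^bsub>A\<^esub> \<i> \<odot>\<^bsub>A\<^esub> lim_op T v"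
    unfolding bu linear_mapD(2)[OF L(1) uc A.smult_in[OF vc]] linear_mapD(2)[OF L(2) uc A.smult_in[OF vc]]
      linear_mapD(3)[OF L(1) vc] linear_mapD(3)[OF L(2) vc] by (rule refl)+
  have "cnorm A (lim_op S b \<ominus>\<^bsub>A\<^esub> lim_op T b) \<le> cnorm A (lim_op S u \<ominus>\<^bsub>A\<^esub> lim_op T u)
      + cnorm A (\<i> \<odot>\<^bsub>A\<^esub> lim_op S v \<ominus>\<^bsub>A\<^esub> \<i> \<odot>\<^bsub>A\<^esub> lim_op T v)"
    unfolding e by (intro A.cnorm_add_diff A.smult_in lim_op_in[OF S] lim_op_in[OF T] uc vc)
  also have "cnorm A (\<i> \<odot>\<^bsub>A\<^esub> lim_op S v \<ominus>\<^bsub>A\<^esub> \<i> \<odot>\<^bsub>A\<^esub> lim_op T v) = cnorm A (lim_op S v \<ominus>\<^bsub>A\<^esub> lim_op T v)"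
    using A.cnorm_smult_diff[OF lim_op_in[OF S vc] lim_op_in[OF T vc], of \<i>] by simp
  also have "cnorm A (lim_op S u \<ominus>\<^bsub>A\<^esub> lim_op T u) \<le> k0 * l"
    by (rule lim_op_dist[OF S T k k0 le u l])
  also have "cnorm A (lim_op S v \<ominus>\<^bsub>A\<^esub> lim_op T v) \<le> k0 * l"
    by (rule lim_op_dist[OF S T k k0 le v l])
  finally show ?thesis by simp
qed

end

section \<open>Limits of monoid actions\<close>

lemma near_isometricD:
  assumes near: "near_isometric_isomorphism e G dG H dH s t"
  shows "g \<in> carrier G \<Longrightarrow> s g \<in> carrier H" and "h \<in> carrier H \<Longrightarrow> t h \<in> carrier G"
    and "h \<in> carrier H \<Longrightarrow> dH (s (t h)) h \<le> e"
    and "\<lbrakk>h \<in> carrier H; h' \<in> carrier H\<rbrakk> \<Longrightarrow> dG (t h \<otimes>\<^bsub>G\<^esub> t h') (t (h \<otimes>\<^bsub>H\<^esub> h')) \<le> e"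
    and "\<lbrakk>h \<in> carrier H; h' \<in> carrier H\<rbrakk> \<Longrightarrow> \<bar>dG (t h) (t h') - dH h h'\<bar> \<le> e"
    and "dG (t \<one>\<^bsub>H\<^esub>) \<one>\<^bsub>G\<^esub> \<le> e"
  using near unfolding near_isometric_isomorphism_def near_morphism_def by blast+

text \<open>The estimate is conditional because an infinite propinquity leaves no room for a strict
  inequality; a tunnel is nevertheless wanted at every n.\<close>

lemma (in appropriate_tunnels) tunnel_near_propinquity:
  assumes M: "M \<in> \<C>" and N: "N \<in> \<C>" and e: "0 < e"
  shows "\<exists>\<tau>\<in>\<T>. tdom \<tau> = M \<and> tcod \<tau> = N \<and>
    (propinquity \<T> M N < \<infinity> \<longrightarrow> extent \<tau> < propinquity \<T> M N + ennreal e)"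
proof (cases "propinquity \<T> M N < \<infinity>")
  case True
  then have "propinquity \<T> M N < propinquity \<T> M N + ennreal e"
    using e by (cases "propinquity \<T> M N" rule: ennreal_cases) (simp_all add: ennreal_less_iff flip: ennreal_plus)
  then have "\<exists>\<tau>\<in>{\<tau> \<in> \<T>. tdom \<tau> = M \<and> tcod \<tau> = N}. extent \<tau> < propinquity \<T> M N + ennreal e"
    unfolding propinquity_def INF_less_iff .
  then show ?thesis by auto
next
  case False
  with connected[OF M N] show ?thesis by auto
qed

lemma tunnel_bound:
  assumes \<tau>: "is_tunnel F \<tau>" and x: "extent \<tau> < ennreal x" "0 \<le> x"
    and d: "d \<in> sa (tspace \<tau>)" "lip (tspace \<tau>) d \<le> ennreal l" and l: "0 < l"
  shows "cnorm (tspace \<tau>) d \<le> cnorm (tdom \<tau>) (to_dom \<tau> d) + l * x"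
    and "cnorm (tspace \<tau>) d \<le> cnorm (tcod \<tau>) (to_cod \<tau> d) + l * x"
proof -
  have h: "hausdorff (mk (tspace \<tau>)) (states (tspace \<tau>)) (pullback_states (tspace \<tau>) (tdom \<tau>) (to_dom \<tau>)) < ennreal x"
    "hausdorff (mk (tspace \<tau>)) (states (tspace \<tau>)) (pullback_states (tspace \<tau>) (tcod \<tau>) (to_cod \<tau>)) < ennreal x"
    using x(1) unfolding extent_def by simp_all
  have 1: "quantum_isometry_pair F (tspace \<tau>) (tdom \<tau>) (to_dom \<tau>)"
    and 2: "quantum_isometry_pair F (tspace \<tau>) (tcod \<tau>) (to_cod \<tau>)"
    using \<tau> unfolding is_tunnel_def quantum_isometry_pair_def quantum_isometry_pair_axioms_def by blast+
  show "cnorm (tspace \<tau>) d \<le> cnorm (tdom \<tau>) (to_dom \<tau> d) + l * x"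
    by (rule quantum_isometry_pair.cnorm_le_hausdorff[OF 1 h(1) x(2) d l])
  show "cnorm (tspace \<tau>) d \<le> cnorm (tcod \<tau>) (to_cod \<tau> d) + l * x"
    by (rule quantum_isometry_pair.cnorm_le_hausdorff[OF 2 h(2) x(2) d l])
qed

theorem theorem3p7:
  fixes G :: "'g monoid" and \<delta> :: "'g \<Rightarrow> 'g \<Rightarrow> real"
    and Gs :: "nat \<Rightarrow> 'h monoid" and \<delta>s :: "nat \<Rightarrow> 'h \<Rightarrow> 'h \<Rightarrow> real"
    and \<epsilon> :: "nat \<Rightarrow> real"
    and \<sigma> :: "nat \<Rightarrow> 'h \<Rightarrow> 'g" and \<kappa> :: "nat \<Rightarrow> 'g \<Rightarrow> 'h"
    and D :: "'g \<Rightarrow> real" and K :: "real \<Rightarrow> real"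
    and F :: "ennreal \<Rightarrow> ennreal \<Rightarrow> ennreal \<Rightarrow> ennreal \<Rightarrow> ennreal"
    and \<C> :: "'a qcms set" and \<T> :: "'a tunnel set"
    and As :: "nat \<Rightarrow> 'a qcms" and A :: "'a qcms"
    and \<alpha>s :: "nat \<Rightarrow> 'h \<Rightarrow> 'a \<Rightarrow> 'a"
  assumes G: "compact_metric_monoid G \<delta>"
    and Gs: "\<And>n. compact_metric_monoid (Gs n) (\<delta>s n)"
    and Gs_convergent: "covariant_GH_convergent Gs \<delta>s G \<delta>"
    and \<epsilon>_pos: "\<And>n. \<epsilon> n > 0"
    and \<epsilon>_lim: "\<epsilon> \<longlonglongrightarrow> 0"
    and near: "\<And>n. near_isometric_isomorphism (\<epsilon> n) (Gs n) (\<delta>s n) G \<delta> (\<sigma> n) (\<kappa> n)"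
    and D_continuous:
      "continuous_map (Metric_space.mtopology (carrier G) \<delta>) euclideanreal D"
    and D_nonneg: "\<And>g. g \<in> carrier G \<Longrightarrow> 0 \<le> D g"
    and K_continuous: "continuous_on {0..} K"
    and K_nonneg: "\<And>t. 0 \<le> t \<Longrightarrow> 0 \<le> K t"
    and K_zero: "K 0 = 0"
    and F_admissible: "admissible F"
    and F_finite: "\<And>x y l k. \<lbrakk>x < \<infinity>; y < \<infinity>; l < \<infinity>; k < \<infinity>\<rbrakk> \<Longrightarrow> F x y l k < \<infinity>"
    and appropriate: "appropriate_tunnels F \<C> \<T>"
    and As: "\<And>n. As n \<in> \<C>"
    and action: "\<And>n. lipschitz_linear_action (Gs n) (As n) (\<alpha>s n)"
    and action_norm:
      "\<And>n g. g \<in> carrier (Gs n) \<Longrightarrow> op_norm (As n) (\<alpha>s n g) \<le> ennreal (D (\<sigma> n g))"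
    and action_lip:
      "\<And>n g a. \<lbrakk>g \<in> carrier (Gs n); a \<in> sa (As n)\<rbrakk> \<Longrightarrow>
         lip (As n) (\<alpha>s n g a) \<le> ennreal (D (\<sigma> n g)) * lip (As n) a"
    and action_equicontinuous:
      "\<And>n g g' a. \<lbrakk>g \<in> carrier (Gs n); g' \<in> carrier (Gs n); a \<in> sa (As n)\<rbrakk> \<Longrightarrow>
         ennreal (cnorm (As n) (\<alpha>s n g a \<ominus>\<^bsub>As n\<^esub> \<alpha>s n g' a))
           \<le> ennreal (K (\<delta>s n g g')) * lip (As n) a"
    and A: "A \<in> \<C>"
    and convergent: "(\<lambda>n. propinquity \<T> (As n) A) \<longlonglongrightarrow> 0"
  shows "\<exists>\<alpha>.
      lipschitz_linear_action G A \<alpha> \<and>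
      strongly_continuous G \<delta> A \<alpha> \<and>
      (\<forall>g\<in>carrier G.
         op_norm A (\<alpha> g) \<le> ennreal (D g) \<and>
         (\<forall>a\<in>sa A. lip A (\<alpha> g a) \<le> ennreal (D g) * lip A a)) \<and>
      (\<forall>g\<in>carrier G. \<forall>h\<in>carrier G.
         liminf (\<lambda>n. mkD (As n) (As n) (\<alpha>s n (\<kappa> n g)) (\<alpha>s n (\<kappa> n h))) \<le> mkD A A (\<alpha> g) (\<alpha> h) \<and>
         mkD A A (\<alpha> g) (\<alpha> h) \<le> limsup (\<lambda>n. mkD (As n) (As n) (\<alpha>s n (\<kappa> n g)) (\<alpha>s n (\<kappa> n h)))) \<and>
      (\<forall>g\<in>carrier G. \<forall>h\<in>carrier G. \<forall>a\<in>ldom A.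
         ennreal (cnorm A (\<alpha> g a \<ominus>\<^bsub>A\<^esub> \<alpha> h a)) \<le> lip A a * ennreal (K (\<delta> g h))) \<and>
      ((\<forall>n. \<forall>g\<in>carrier (Gs n). positive_map (As n) (As n) (\<alpha>s n g)) \<longrightarrow>
         (\<forall>g\<in>carrier G. positive_map A A (\<alpha> g))) \<and>
      ((\<forall>n. \<forall>g\<in>carrier (Gs n). lipschitz_morphism (As n) (As n) (\<alpha>s n g)) \<longrightarrow>
         (\<forall>g\<in>carrier G. lipschitz_morphism A A (\<alpha> g)))"
proof -
  interpret G: compact_metric_monoid G \<delta> by (rule G)
  interpret T: appropriate_tunnels F \<C> \<T> by (rule appropriate)
  obtain U :: "nat filter" where U: "U \<le> sequentially" "U \<noteq> bot"
    and ultra: "\<And>P. eventually P U \<or> eventually (\<lambda>n. \<not> P n) U"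
    by (rule ultrafilter_exists) (rule that)
  define \<tau> where "\<tau> n = (SOME \<tau>. \<tau> \<in> \<T> \<and> tdom \<tau> = As n \<and> tcod \<tau> = A \<and>
    (propinquity \<T> (As n) A < \<infinity> \<longrightarrow> extent \<tau> < propinquity \<T> (As n) A + ennreal (1 / Suc n)))" for n
  have "\<exists>\<tau>. \<tau> \<in> \<T> \<and> tdom \<tau> = As n \<and> tcod \<tau> = A \<and>
    (propinquity \<T> (As n) A < \<infinity> \<longrightarrow> extent \<tau> < propinquity \<T> (As n) A + ennreal (1 / Suc n))" for n
    using T.tunnel_near_propinquity[OF As A, of "1 / Suc n" n] by (simp add: Bex_def)
  then have \<tau>': "\<tau> n \<in> \<T> \<and> tdom (\<tau> n) = As n \<and> tcod (\<tau> n) = A \<and>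
    (propinquity \<T> (As n) A < \<infinity> \<longrightarrow> extent (\<tau> n) < propinquity \<T> (As n) A + ennreal (1 / Suc n))" for n
    unfolding \<tau>_def by (rule someI_ex)
  then have \<tau>: "tdom (\<tau> n) = As n" "tcod (\<tau> n) = A" "is_tunnel F (\<tau> n)" for n
    using T.tunnels by blast+
  \<comment> \<open>A real number above the extent of the chosen tunnel whenever the propinquity is
    finite; the summand 1/(n+1) is the slack of the choice.\<close>
  define \<eta> where "\<eta> n = enn2real (propinquity \<T> (As n) A) + 1 / Suc n" for n
  have "((\<lambda>n. enn2real (propinquity \<T> (As n) A)) \<longlongrightarrow> 0) sequentially"
    using tendsto_enn2real[of "\<lambda>n. propinquity \<T> (As n) A" 0 sequentially] convergent by simp
  then have "(\<eta> \<longlongrightarrow> 0 + 0) sequentially"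
    unfolding \<eta>_def by (intro tendsto_add LIMSEQ_Suc[OF lim_1_over_n])
  then have \<eta>: "(\<eta> \<longlongrightarrow> 0) U" using tendsto_mono[OF U(1)] by simp
  have "eventually (\<lambda>n. propinquity \<T> (As n) A < 1) sequentially"
    using order_tendstoD(2)[OF convergent] by simp
  then have ev: "eventually (\<lambda>n. propinquity \<T> (As n) A < 1) U" using U(1) by (rule filter_leD[rotated])
  have bound: "eventually (\<lambda>n. \<forall>l>0. \<forall>d\<in>sa (tspace (\<tau> n)). lip (tspace (\<tau> n)) d \<le> ennreal l \<longrightarrow>
        cnorm (tspace (\<tau> n)) d \<le> cnorm (As n) (to_dom (\<tau> n) d) + l * \<eta> n \<and>
        cnorm (tspace (\<tau> n)) d \<le> cnorm A (to_cod (\<tau> n) d) + l * \<eta> n) U"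
    using ev
  proof eventually_elim
    case (elim n)
    then have fin: "propinquity \<T> (As n) A < \<infinity>" by (rule order.strict_trans) simp
    have "0 \<le> \<eta> n" by (simp add: \<eta>_def)
    have "extent (\<tau> n) < propinquity \<T> (As n) A + ennreal (1 / Suc n)" using \<tau>' fin by blast
    also have "propinquity \<T> (As n) A = ennreal (enn2real (propinquity \<T> (As n) A))" using fin by simp
    also have "ennreal (enn2real (propinquity \<T> (As n) A)) + ennreal (1 / Suc n) = ennreal (\<eta> n)"
      unfolding \<eta>_def by (rule ennreal_plus[symmetric]) simp_all
    finally have "extent (\<tau> n) < ennreal (\<eta> n)" .
    then show ?case
      using tunnel_bound[OF \<tau>(3) _ \<open>0 \<le> \<eta> n\<close>, of n] unfolding \<tau>(1,2) by blast
  qed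
  have isom: "quasi_leibniz_qcms F (tspace (\<tau> n))" "quantum_isometry (tspace (\<tau> n)) (As n) (to_dom (\<tau> n))"
    "quantum_isometry (tspace (\<tau> n)) A (to_cod (\<tau> n))" for n
    using \<tau>(3)[of n] unfolding is_tunnel_def \<tau>(1,2) by blast+
  interpret L: tunnel_sequence F U As "\<lambda>n. tspace (\<tau> n)" A "\<lambda>n. to_dom (\<tau> n)" "\<lambda>n. to_cod (\<tau> n)" \<eta>
    by (rule tunnel_sequence.intro[OF U(2,1) ultra T.spaces[OF As] isom(1) T.spaces[OF A] isom(2,3) \<eta> bound
          F_admissible F_finite])
  have \<epsilon>_U: "(\<epsilon> \<longlongrightarrow> 0) U" by (rule tendsto_mono[OF U(1) \<epsilon>_lim])
  have \<kappa>: "\<kappa> n g \<in> carrier (Gs n)" if "g \<in> carrier G" for n g by (rule near_isometricD(2)[OF near that])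
  have \<sigma>: "\<sigma> n h \<in> carrier G" if "h \<in> carrier (Gs n)" for n h by (rule near_isometricD(1)[OF near that])
  have act: "lipschitz_linear (As n) (As n) (\<alpha>s n h)" if "h \<in> carrier (Gs n)" for n h
    using action[of n] that unfolding lipschitz_linear_action_def by blast
  have act_mult: "\<alpha>s n (h \<otimes>\<^bsub>Gs n\<^esub> h') a = \<alpha>s n h (\<alpha>s n h' a)"
    if "h \<in> carrier (Gs n)" "h' \<in> carrier (Gs n)" "a \<in> carrier (As n)" for n h h' a
    using action[of n] that unfolding lipschitz_linear_action_def by blast
  have act_id: "\<alpha>s n \<one>\<^bsub>Gs n\<^esub> a = a" if "a \<in> carrier (As n)" for n a
    using action[of n] that unfolding lipschitz_linear_action_def by blast
  have act_lin: "linear_map (As n) (As n) (\<alpha>s n h)" and act_one: "\<alpha>s n h \<one>\<^bsub>As n\<^esub> = \<one>\<^bsub>As n\<^esub>"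
    and act_ldom: "a \<in> ldom (As n) \<Longrightarrow> \<alpha>s n h a \<in> ldom (As n)" if "h \<in> carrier (Gs n)" for n h a
    using act[OF that] unfolding lipschitz_linear_def by blast+
  have act_norm: "cnorm (As n) (\<alpha>s n h x) \<le> D (\<sigma> n h) * cnorm (As n) x"
    if h: "h \<in> carrier (Gs n)" and x: "x \<in> carrier (As n)" for n h x
    using action_norm[OF h] L.An.op_norm_le_iff[OF act_lin[OF h] D_nonneg[OF \<sigma>[OF h]]] x by blast
  have act_lip: "lip (As n) (\<alpha>s n h y) \<le> ennreal (D (\<sigma> n h)) * lip (As n) y"
    if "h \<in> carrier (Gs n)" "y \<in> ldom (As n)" for n h y
    using action_lip[OF that(1)] that(2) by (simp add: ldom_def)

  \<comment> \<open>The bounds along \<open>\<sigma> n\<close> vary with n, whereas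
    \<open>equi\<close> needs one constant; it comes from compactness of \<open>G\<close>.\<close>
  have "compactin euclideanreal (D ` carrier G)"
    using image_compactin[OF _ D_continuous] G.compact by (simp add: compact_space_def)
  then have "bounded (D ` carrier G)" by (simp add: compact_imp_bounded)
  then obtain B where B: "\<And>g. g \<in> carrier G \<Longrightarrow> D g \<le> B"
    unfolding bounded_real by (auto simp: abs_le_iff)
  have B0: "0 \<le> B" using D_nonneg[OF G.one_closed] B[OF G.one_closed] by simp
  have equi: "L.equi (\<lambda>n. \<alpha>s n (h n)) B" if h: "\<And>n. h n \<in> carrier (Gs n)" for h
    unfolding L.equi_def
  proof (intro conjI allI ballI impI B0 act_lin h)
    show "cnorm (As n) (\<alpha>s n (h n) x) \<le> B * cnorm (As n) x" if "x \<in> carrier (As n)" for n x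
      using act_norm[OF h that] mult_right_mono[OF B[OF \<sigma>[OF h]] L.An.cnorm_nonneg[OF that]] by (rule order_trans)
    fix n l r a assume a: "a \<in> lip_ball (As n) l r" and l: "(0 :: real) \<le> l"
    have "lip (As n) (\<alpha>s n (h n) a) \<le> ennreal (D (\<sigma> n (h n))) * lip (As n) a"
      by (rule act_lip[OF h lip_ballD(4)[OF a]])
    also have "\<dots> \<le> ennreal B * ennreal l"
      using B[OF \<sigma>[OF h]] lip_ballD(2)[OF a] by (intro mult_mono ennreal_leI) simp_all
    also have "\<dots> = ennreal (B * l)" using B0 l by (simp add: ennreal_mult)
    finally have lip: "lip (As n) (\<alpha>s n (h n) a) \<le> ennreal (B * l)" .
    note ac = L.An.sa_in[OF lip_ballD(1)[OF a]]
    have "cnorm (As n) (\<alpha>s n (h n) a) \<le> B * cnorm (As n) a"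
      using act_norm[OF h ac] mult_right_mono[OF B[OF \<sigma>[OF h]] L.An.cnorm_nonneg[OF ac]] by (rule order_trans)
    also have "\<dots> \<le> B * r" using lip_ballD(3)[OF a] B0 by (rule mult_left_mono)
    finally show "\<alpha>s n (h n) a \<in> lip_ball (As n) (B * l) (B * r)"
      using lip act_ldom[OF h lip_ballD(4)[OF a]] by (simp add: lip_ball_def ldom_def)
  qed
  \<comment> \<open>The two near-inverse maps return within \<open>\<epsilon> n\<close> of
    \<open>g\<close>, and continuity of \<open>D\<close> turns the bounds at finite stages into
    D(g).\<close>
  have D_lim: "((\<lambda>n. D (\<sigma> n (\<kappa> n g))) \<longlongrightarrow> D g) U" if g: "g \<in> carrier G" for g
  proof -
    have "((\<lambda>n. \<delta> (\<sigma> n (\<kappa> n g)) g) \<longlongrightarrow> 0) U"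
      by (rule Lim_null_comparison[OF _ \<epsilon>_U]) (simp add: near_isometricD(3)[OF near g])
    then have "limitin G.mtopology (\<lambda>n. \<sigma> n (\<kappa> n g)) g U"
      unfolding G.limitin_metric_dist_null using g \<sigma>[OF \<kappa>[OF g]] by simp
    from continuous_map_limit[OF D_continuous this] show ?thesis by (simp add: o_def)
  qed
  have Gs_nonneg: "0 \<le> \<delta>s n h h'" for n h h'
    using Metric_space.nonneg[of "carrier (Gs n)" "\<delta>s n"] Gs[of n] by (simp add: compact_metric_monoid_def)
  have K_lim: "((\<lambda>n. K (\<delta>s n (h n) (h' n))) \<longlongrightarrow> K t) U"
    if "((\<lambda>n. \<delta>s n (h n) (h' n)) \<longlongrightarrow> t) U" "0 \<le> t" for h h' t
    using continuous_on_tendsto_compose[OF K_continuous that(1)] that(2) Gs_nonneg by simp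
  have K_dist: "cnorm (As n) (\<alpha>s n h y \<ominus>\<^bsub>As n\<^esub> \<alpha>s n h' y) \<le> K (\<delta>s n h h') * l"
    if h: "h \<in> carrier (Gs n)" "h' \<in> carrier (Gs n)" and y: "y \<in> lip_ball (As n) l r" and l: "0 \<le> l" for n h h' y l r
  proof -
    have "ennreal (cnorm (As n) (\<alpha>s n h y \<ominus>\<^bsub>As n\<^esub> \<alpha>s n h' y)) \<le> ennreal (K (\<delta>s n h h')) * lip (As n) y"
      by (rule action_equicontinuous[OF h lip_ballD(1)[OF y]])
    also have "\<dots> \<le> ennreal (K (\<delta>s n h h')) * ennreal l" using lip_ballD(2)[OF y] by (intro mult_left_mono) simp_all
    also have "\<dots> = ennreal (K (\<delta>s n h h') * l)" using K_nonneg[OF Gs_nonneg] l by (simp add: ennreal_mult)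
    finally show ?thesis using K_nonneg[OF Gs_nonneg] l by simp
  qed
  define \<alpha> where "\<alpha> g = L.lim_op (\<lambda>n. \<alpha>s n (\<kappa> n g))" for g
  have E: "L.equi (\<lambda>n. \<alpha>s n (\<kappa> n g)) B" if "g \<in> carrier G" for g by (rule equi[OF \<kappa>[OF that]])
  have \<alpha>_lin: "linear_map A A (\<alpha> g)" if "g \<in> carrier G" for g
    unfolding \<alpha>_def by (rule L.lim_op_linear[OF E[OF that]])
  have \<alpha>_one: "\<alpha> g \<one>\<^bsub>A\<^esub> = \<one>\<^bsub>A\<^esub>" if "g \<in> carrier G" for g
    unfolding \<alpha>_def by (rule L.lim_op_one[OF E[OF that] act_one[OF \<kappa>[OF that]]])
  have \<alpha>_norm: "cnorm A (\<alpha> g a) \<le> D g * cnorm A a" if g: "g \<in> carrier G" and a: "a \<in> carrier A" for g a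
    unfolding \<alpha>_def by (rule L.lim_op_cnorm[OF E[OF g] D_lim[OF g] act_norm[OF \<kappa>[OF g]] a])
  have \<alpha>_ball: "\<alpha> g a \<in> sa A" "lip A (\<alpha> g a) \<le> ennreal (D g) * lip A a"
    if g: "g \<in> carrier G" and a: "a \<in> ldom A" for g a
  proof -
    note l = L.lim_op_lip[OF E[OF g] D_lim[OF g] D_nonneg[OF g] act_lip[OF \<kappa>[OF g]] L.A.ldom_lip_ball[OF a] enn2real_nonneg]
    show "\<alpha> g a \<in> sa A" unfolding \<alpha>_def by (rule l(1))
    have "lip A (\<alpha> g a) \<le> ennreal (D g * enn2real (lip A a))" unfolding \<alpha>_def by (rule l(2))
    also have "\<dots> = ennreal (D g) * ennreal (enn2real (lip A a))" using D_nonneg[OF g] by (simp add: ennreal_mult)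
    also have "ennreal (enn2real (lip A a)) = lip A a" using a by (simp add: ldom_def)
    finally show "lip A (\<alpha> g a) \<le> ennreal (D g) * lip A a" .
  qed
  have \<alpha>_ldom: "\<alpha> g a \<in> ldom A" if g: "g \<in> carrier G" and a: "a \<in> ldom A" for g a
  proof -
    have "ennreal (D g) * lip A a < \<infinity>" using a by (simp add: ldom_def ennreal_mult_less_top)
    then show ?thesis using \<alpha>_ball[OF g a] unfolding ldom_def by (simp add: order.strict_trans1)
  qed
  have dist_lim: "((\<lambda>n. \<delta>s n (\<kappa> n g) (\<kappa> n h)) \<longlongrightarrow> \<delta> g h) U" if "g \<in> carrier G" "h \<in> carrier G" for g h
  proof (rule LIM_zero_cancel)
    show "((\<lambda>n. \<delta>s n (\<kappa> n g) (\<kappa> n h) - \<delta> g h) \<longlongrightarrow> 0) U"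
      by (rule Lim_null_comparison[OF _ \<epsilon>_U]) (simp add: near_isometricD(5)[OF near that])
  qed
  note K_lim' = K_lim[OF dist_lim G.nonneg]
  have \<alpha>_mult: "\<alpha> (g \<otimes>\<^bsub>G\<^esub> h) a = \<alpha> g (\<alpha> h a)"
    if g: "g \<in> carrier G" and h: "h \<in> carrier G" and a: "a \<in> carrier A" for g h a
  proof -
    note gh = G.m_closed[OF g h]
    have m: "\<kappa> n g \<otimes>\<^bsub>Gs n\<^esub> \<kappa> n h \<in> carrier (Gs n)" for n
      using Gs[of n] \<kappa>[OF g, of n] \<kappa>[OF h, of n] by (simp add: compact_metric_monoid_def monoid.m_closed)
    \<comment> \<open>The multiplicative defect of \<open>\<kappa> n\<close> is at most
      \<open>\<epsilon> n\<close>. Continuity of \<open>K\<close> at 0 and K(0) = 0 make it a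
      vanishing modulus, so the two limit operators agree.\<close>
    have "((\<lambda>n. \<delta>s n (\<kappa> n g \<otimes>\<^bsub>Gs n\<^esub> \<kappa> n h) (\<kappa> n (g \<otimes>\<^bsub>G\<^esub> h))) \<longlongrightarrow> 0) U"
      by (rule Lim_null_comparison[OF _ \<epsilon>_U]) (simp add: Gs_nonneg near_isometricD(4)[OF near g h])
    from K_lim[OF this order_refl]
    have k: "((\<lambda>n. K (\<delta>s n (\<kappa> n g \<otimes>\<^bsub>Gs n\<^esub> \<kappa> n h) (\<kappa> n (g \<otimes>\<^bsub>G\<^esub> h)))) \<longlongrightarrow> 0) U" by (simp only: K_zero)
    have "L.lim_op (\<lambda>n x. \<alpha>s n (\<kappa> n g) (\<alpha>s n (\<kappa> n h) x)) a = L.lim_op (\<lambda>n. \<alpha>s n (\<kappa> n (g \<otimes>\<^bsub>G\<^esub> h))) a"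
    proof (rule L.lim_op_eq[OF L.equi_comp[OF E[OF g] E[OF h]] E[OF gh] k _ a])
      fix n l r y assume y: "y \<in> lip_ball (As n) l r" and l: "(0 :: real) \<le> l"
      show "cnorm (As n) (\<alpha>s n (\<kappa> n g) (\<alpha>s n (\<kappa> n h) y) \<ominus>\<^bsub>As n\<^esub> \<alpha>s n (\<kappa> n (g \<otimes>\<^bsub>G\<^esub> h)) y)
        \<le> K (\<delta>s n (\<kappa> n g \<otimes>\<^bsub>Gs n\<^esub> \<kappa> n h) (\<kappa> n (g \<otimes>\<^bsub>G\<^esub> h))) * l"
        using K_dist[OF m \<kappa>[OF gh] y l]
        unfolding act_mult[OF \<kappa>[OF g] \<kappa>[OF h] L.An.sa_in[OF lip_ballD(1)[OF y]]] .
    qed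
    then show ?thesis unfolding \<alpha>_def L.lim_op_comp[OF E[OF g] E[OF h] a] ..
  qed
  have \<alpha>_id: "\<alpha> \<one>\<^bsub>G\<^esub> a = a" if a: "a \<in> carrier A" for a
  proof -
    have one: "\<one>\<^bsub>Gs n\<^esub> \<in> carrier (Gs n)" for n
      using Gs[of n] by (simp add: compact_metric_monoid_def)
    have "((\<lambda>n. \<delta>s n (\<kappa> n \<one>\<^bsub>G\<^esub>) \<one>\<^bsub>Gs n\<^esub>) \<longlongrightarrow> 0) U"
      by (rule Lim_null_comparison[OF _ \<epsilon>_U]) (simp add: Gs_nonneg near_isometricD(6)[OF near])
    from K_lim[OF this order_refl]
    have k: "((\<lambda>n. K (\<delta>s n (\<kappa> n \<one>\<^bsub>G\<^esub>) \<one>\<^bsub>Gs n\<^esub>)) \<longlongrightarrow> 0) U" by (simp only: K_zero)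
    have "\<alpha> \<one>\<^bsub>G\<^esub> a = L.lim_op (\<lambda>n x. x) a"
      unfolding \<alpha>_def
    proof (rule L.lim_op_eq[OF E[OF G.one_closed] L.equi_id k _ a])
      fix n l r y assume y: "y \<in> lip_ball (As n) l r" and l: "(0 :: real) \<le> l"
      show "cnorm (As n) (\<alpha>s n (\<kappa> n \<one>\<^bsub>G\<^esub>) y \<ominus>\<^bsub>As n\<^esub> y) \<le> K (\<delta>s n (\<kappa> n \<one>\<^bsub>G\<^esub>) \<one>\<^bsub>Gs n\<^esub>) * l"
        using K_dist[OF \<kappa>[OF G.one_closed] one y l] unfolding act_id[OF L.An.sa_in[OF lip_ballD(1)[OF y]]] .
    qed
    then show ?thesis using L.lim_op_id[OF a] by simp
  qed
  have linear: "lipschitz_linear A A (\<alpha> g)" if g: "g \<in> carrier G" for g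
    unfolding lipschitz_linear_def
  proof (intro conjI \<alpha>_lin[OF g] \<alpha>_one[OF g])
    show "continuous_map (ctop A) (ctop A) (\<alpha> g)"
      by (rule L.A.bounded_linear_continuous[OF \<alpha>_lin[OF g] D_nonneg[OF g] \<alpha>_norm[OF g]])
    show "\<alpha> g ` ldom A \<subseteq> ldom A" using \<alpha>_ldom[OF g] by (rule image_subsetI)
  qed
  have main: "lipschitz_linear_action G A \<alpha>"
    unfolding lipschitz_linear_action_def by (intro conjI ballI linear \<alpha>_mult \<alpha>_id)

  have strong: "strongly_continuous G \<delta> A \<alpha>"
    unfolding strongly_continuous_def ctop_def
  proof
    fix a assume a: "a \<in> carrier A"
    show "continuous_map G.mtopology L.A.metric.mtopology (\<lambda>g. \<alpha> g a)"
      unfolding G.metric_continuous_map[OF L.A.metric.Metric_space_axioms]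
    proof (intro conjI ballI allI impI)
      show "(\<lambda>g. \<alpha> g a) ` carrier G \<subseteq> carrier A" using linear_mapD(1)[OF \<alpha>_lin a] by (rule image_subsetI)
      fix g and e :: real assume g: "g \<in> carrier G" and e: "0 < e"
      \<comment> \<open>Replacing \<open>a\<close> by the Lipschitz element \<open>b\<close> costs
        less than e/4 for each of the two operators, which leaves e/2 for the modulus
        \<open>K\<close> on \<open>b\<close>; adding 1 to B and to l avoids division by
        zero.\<close>
      have "0 < e / (4 * (B + 1))" using e B0 by simp
      from L.A.clip_ball_dense[OF a this] obtain b l r where b: "b \<in> clip_ball A l r" and l: "0 \<le> l"
        and ba: "cnorm A (b \<ominus>\<^bsub>A\<^esub> a) < e / (4 * (B + 1))" by (elim exE conjE)
      note bc = L.A.clip_ball_in[OF b]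
      have "0 < e / (4 * (l + 1))" using e l by simp
      then have "\<exists>d>0. \<forall>t\<in>{0..}. dist t 0 < d \<longrightarrow> dist (K t) (K 0) < e / (4 * (l + 1))"
        using K_continuous unfolding continuous_on_iff by (meson atLeast_iff order_refl)
      then obtain d where d: "0 < d" "\<And>t. 0 \<le> t \<Longrightarrow> t < d \<Longrightarrow> K t < e / (4 * (l + 1))"
        using K_zero K_nonneg by (auto simp: dist_real_def)
      show "\<exists>d>0. \<forall>h. h \<in> carrier G \<and> \<delta> g h < d \<longrightarrow> cdist A (\<alpha> g a) (\<alpha> h a) < e"
      proof (intro exI[of _ d] conjI allI impI d(1))
        fix h assume h': "h \<in> carrier G \<and> \<delta> g h < d"
        then have h: "h \<in> carrier G" by (rule conjunct1)
        note c = linear_mapD(1)[OF \<alpha>_lin[OF g] a] linear_mapD(1)[OF \<alpha>_lin[OF h] a]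
          linear_mapD(1)[OF \<alpha>_lin[OF g] bc] linear_mapD(1)[OF \<alpha>_lin[OF h] bc]
        have Kd: "K (\<delta> g h) < e / (4 * (l + 1))" using h' by (intro d(2)) simp_all
        have "cnorm A (\<alpha> g b \<ominus>\<^bsub>A\<^esub> \<alpha> h b) \<le> 2 * (K (\<delta> g h) * l)"
          unfolding \<alpha>_def
          by (rule L.lim_op_dist_clip[OF E[OF g] E[OF h] K_lim'[OF g h] K_nonneg[OF G.nonneg] K_dist[OF \<kappa>[OF g] \<kappa>[OF h]] b l])
        also have "\<dots> \<le> 2 * (K (\<delta> g h) * (l + 1))" using K_nonneg[OF G.nonneg] by (simp add: mult_left_mono)
        also have "\<dots> < 2 * (e / (4 * (l + 1)) * (l + 1))" using Kd l by (intro mult_strict_left_mono mult_strict_right_mono) simp_all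
        also have "\<dots> = e / 2" using l by (simp add: field_simps)
        finally have 1: "cnorm A (\<alpha> g b \<ominus>\<^bsub>A\<^esub> \<alpha> h b) < e / 2" .
        have "(B + 1) * cnorm A (b \<ominus>\<^bsub>A\<^esub> a) < (B + 1) * (e / (4 * (B + 1)))"
          using ba B0 by (intro mult_strict_left_mono) simp_all
        also have "\<dots> = e / 4" using B0 by (simp add: field_simps)
        finally have "(B + 1) * cnorm A (b \<ominus>\<^bsub>A\<^esub> a) < e / 4" .
        moreover have "B * cnorm A (b \<ominus>\<^bsub>A\<^esub> a) \<le> (B + 1) * cnorm A (b \<ominus>\<^bsub>A\<^esub> a)"
          using L.A.cnorm_nonneg[OF L.A.minus_closed[OF bc a]] by (intro mult_right_mono) simp_all
        moreover have "cnorm A (\<alpha> g' b \<ominus>\<^bsub>A\<^esub> \<alpha> g' a) \<le> B * cnorm A (b \<ominus>\<^bsub>A\<^esub> a)" if "g' \<in> carrier G" for g'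
          unfolding \<alpha>_def by (rule L.lim_op_Lipschitz[OF E[OF that] bc a])
        ultimately have 2: "cnorm A (\<alpha> g' b \<ominus>\<^bsub>A\<^esub> \<alpha> g' a) < e / 4" if "g' \<in> carrier G" for g'
          using that by (meson le_less_trans)
        have "cnorm A (\<alpha> g a \<ominus>\<^bsub>A\<^esub> \<alpha> h a) < e"
          using L.A.cnorm_diff_triangle[OF c(1,3,2)] L.A.cnorm_diff_triangle[OF c(3,4,2)]
            L.A.cnorm_diff_commute[OF c(1,3)] 1 2[OF g] 2[OF h] by linarith
        then show "cdist A (\<alpha> g a) (\<alpha> h a) < e" using c by (simp add: cdist_def)
      qed
    qed
  qed

  have norms: "op_norm A (\<alpha> g) \<le> ennreal (D g) \<and> (\<forall>a\<in>sa A. lip A (\<alpha> g a) \<le> ennreal (D g) * lip A a)"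
    if g: "g \<in> carrier G" for g
  proof (intro conjI ballI)
    show "op_norm A (\<alpha> g) \<le> ennreal (D g)"
      unfolding L.A.op_norm_le_iff[OF \<alpha>_lin[OF g] D_nonneg[OF g]] using \<alpha>_norm[OF g] by (rule ballI)
    fix a assume a: "a \<in> sa A"
    show "lip A (\<alpha> g a) \<le> ennreal (D g) * lip A a"
    proof (cases "a \<in> ldom A")
      case True
      then show ?thesis by (rule \<alpha>_ball(2)[OF g])
    next
      case False
      then have top: "lip A a = \<infinity>" using a by (simp add: ldom_def not_less top_unique)
      show ?thesis
      \<comment> \<open>In \<open>ennreal\<close> zero times infinity is zero, so for D(g) = 0 the
        right-hand side gives no room; the norm bound then shows that the image of \<open>a\<close>
        is zero.\<close>
      proof (cases "D g = 0")
        case True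
        have ac: "a \<in> carrier A" by (rule L.A.sa_in[OF a])
        have "cnorm A (\<alpha> g a) \<le> 0" using \<alpha>_norm[OF g ac] by (simp add: True)
        then have "\<alpha> g a = \<zero>\<^bsub>A\<^esub>"
          using L.A.cnorm_nonneg L.A.cnorm_eq_zero linear_mapD(1)[OF \<alpha>_lin[OF g] ac] by (meson order_antisym)
        then show ?thesis by (simp add: L.A.lip_zero)
      next
        case False
        then have "ennreal (D g) \<noteq> 0" using D_nonneg[OF g] by simp
        then show ?thesis unfolding top infinity_ennreal_def by (simp only: ennreal_mult_top if_False top_greatest)
      qed
    qed
  qed

  have distances: "liminf (\<lambda>n. mkD (As n) (As n) (\<alpha>s n (\<kappa> n g)) (\<alpha>s n (\<kappa> n h))) \<le> mkD A A (\<alpha> g) (\<alpha> h) \<and>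
      mkD A A (\<alpha> g) (\<alpha> h) \<le> limsup (\<lambda>n. mkD (As n) (As n) (\<alpha>s n (\<kappa> n g)) (\<alpha>s n (\<kappa> n h)))"
    if g: "g \<in> carrier G" and h: "h \<in> carrier G" for g h
    unfolding \<alpha>_def
    by (intro conjI L.liminf_le_mkD_lim_op[OF E[OF g] E[OF h] act_one[OF \<kappa>[OF g]] act_one[OF \<kappa>[OF h]]]
        L.mkD_lim_op_le_limsup[OF E[OF g] E[OF h]])

  have equicontinuous: "ennreal (cnorm A (\<alpha> g a \<ominus>\<^bsub>A\<^esub> \<alpha> h a)) \<le> lip A a * ennreal (K (\<delta> g h))"
    if g: "g \<in> carrier G" and h: "h \<in> carrier G" and a: "a \<in> ldom A" for g h a
  proof -
    have "cnorm A (\<alpha> g a \<ominus>\<^bsub>A\<^esub> \<alpha> h a) \<le> K (\<delta> g h) * enn2real (lip A a)"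
      unfolding \<alpha>_def
      by (rule L.lim_op_dist[OF E[OF g] E[OF h] K_lim'[OF g h] K_nonneg[OF G.nonneg] K_dist[OF \<kappa>[OF g] \<kappa>[OF h]]
            L.A.ldom_lip_ball[OF a] enn2real_nonneg])
    then have "ennreal (cnorm A (\<alpha> g a \<ominus>\<^bsub>A\<^esub> \<alpha> h a)) \<le> ennreal (K (\<delta> g h) * enn2real (lip A a))"
      by (rule ennreal_leI)
    also have "\<dots> = ennreal (K (\<delta> g h)) * ennreal (enn2real (lip A a))"
      by (rule ennreal_mult[OF K_nonneg[OF G.nonneg] enn2real_nonneg])
    also have "ennreal (enn2real (lip A a)) = lip A a" using a by (simp add: ldom_def)
    finally show ?thesis by (simp only: mult.commute)
  qed

  have positive: "positive_map A A (\<alpha> g)"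
    if pos: "\<forall>n. \<forall>g\<in>carrier (Gs n). positive_map (As n) (As n) (\<alpha>s n g)" and g: "g \<in> carrier G" for g
    unfolding \<alpha>_def by (rule L.lim_op_positive[OF E[OF g]]) (rule pos[rule_format, OF \<kappa>[OF g]])
  have morphism: "lipschitz_morphism A A (\<alpha> g)"
    if hom: "\<forall>n. \<forall>g\<in>carrier (Gs n). lipschitz_morphism (As n) (As n) (\<alpha>s n g)" and g: "g \<in> carrier G" for g
    unfolding lipschitz_morphism_def
  proof (rule conjI[OF _ linear[OF g]])
    have "star_hom (As n) (As n) (\<alpha>s n (\<kappa> n g))" for n
      using hom[rule_format, OF \<kappa>[OF g]] unfolding lipschitz_morphism_def by (rule conjunct1)
    then show "star_hom A A (\<alpha> g)" unfolding \<alpha>_def by (rule L.lim_op_star_hom[OF E[OF g]])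
  qed
  show ?thesis
    by (intro exI[of _ \<alpha>] conjI ballI impI main strong norms distances[THEN conjunct1] distances[THEN conjunct2]
        norms[THEN conjunct1] norms[THEN conjunct2, THEN bspec] equicontinuous positive morphism)
qed

end
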